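(* The unit vector basis $(e_i)_{i\in\mathbb{N}}$ of $\mathfrak{X}_{wh}$ is asymptotic $\ell_2$ for vectors with disjoint support, and therefore $\mathfrak{X}_{wh}$ is a weak Hilbert space.
   Context: Weak Hilbert space: an infinite dimensional Banach space $X$ for which there are $\delta,C>0$ such that every finite dimensional $E\subset X$ contains a subspace $F\subset E$ with $\dim F\ge\delta\dim E$, with Banach–Mazur distance from $F$ to $\ell_2^{\dim F}$ at most $C$, and with a projection $P:X\to F$ onto $F$ with $\|P\|\le C$. Asymptotic $\ell_2$ for vectors with disjoint supports: a space $X$ with a basis $(e_i)$ has this property if there is $C\ge1$ such that for every $n\in\mathbb{N}$, every sequence $(x_i)_{i=1}^n$ of disjointly supported normalized vectors with $n\le\operatorname{supp}x_i$ (i.e. $n\le\min\operatorname{supp}x_i$) for $i\le n$ is $C$-equivalent to the unit vector basis of $\ell_2^n$. The space $\mathfrak{X}_{wh}$. $c_{00}$ is the space of finitely supported real sequences with unit vectors $(e_n)$; $\operatorname{supp}x$ is the support of $x$. $Ba(\ell_2)$ is the closed unit ball of $\ell_2$ (finite sequences are regarded as elements of $\ell_2$). Schreier families: $\mathcal{S}_1=\{F\subset\mathbb{N}:|F|\le\min F\}$ and $\mathcal{S}_{n+1}=\{\bigcup_{i=1}^dF_i: F_1<\dots<F_d,\ F_i\in\mathcal{S}_n,\ \{\min F_i\}_{i=1}^d\in\mathcal{S}_1\}$. A finite sequence of sets $(E_i)_{i=1}^d$ is $\mathcal{S}_n$-allowable if the $E_i$ are pairwise disjoint finite subsets of $\mathbb{N}$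 and $\{\min E_i\}_{i=1}^d\in\mathcal{S}_n$; a sequence of vectors is $\mathcal{S}_n$-allowable if its supports are. Fix increasing sequences of positive integers $(m_j)_{j\ge0}$, $(n_j)_{j\ge0}$ with $m_0=m_1=2$, $n_0=1$, and for $j\ge2$: $m_{j+1}\ge m_j^3$, and $n_j$ is such that $\ell_j(n_{j-1}+1)<n_j$, where $\ell_j=3\log_2(m_j)+1$. Fix disjoint infinite $N_1,N_2\subset\mathbb{N}$ with $\mathbb{N}=N_1\cup N_2$, and let $\Sigma$ be the set of finite sequences $(E_i,2j_i)_{i=1}^n$ with $E_i\subset\mathbb{N}$ finite and pairwise disjoint, $j_1<\dots<j_n$, $j_1\in N_1$ and $j_i\in N_2$ for $i>1$. Fix an injective $\sigma:\Sigma\to N_2$ with $m_{2\sigma((E_1,2j_1),\dots,(E_{i+1},2j_{i+1}))}>m_{2\sigma((E_1,2j_1),\dots,(E_i,2j_i))}(\max E_i)^2$ and with $m_{2\sigma((E_1,2j_1),\dots,(E_p,2j_p))}>m_{2j_p}(\max E_p)^2$. A sequence $(E_i,2j_i)_i$ is $\sigma$-special if $j_1\in N_1$ and $\sigma((E_1,2j_1),\dots,(E_i,2j_i))=j_{i+1}$ for each $i\ge1$; a finite $\sigma$-special sequence $(E_i,2j_i)_{i=1}^p$ is $\mathcal{S}_{n_{2j+1}}$ $\sigma$-special if $\{\min E_i\}_{i=1}^p\in\mathcal{S}_{n_{2j+1}}$ and $2j_1>2j+2$. A sequence $(f_i)_{i=1}^p\subset c_{00}$ is an $\mathcal{S}_{n_{2j+1}}$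 $\sigma$-special sequence of functionals if there is an $\mathcal{S}_{n_{2j+1}}$ $\sigma$-special sequence $(E_i,2j_i)_{i=1}^p$ with $\operatorname{supp}f_i\subset E_i$ and $w(f_i)=m_{2j_i}$ for all $i$. $D_{wh}\subset c_{00}$ is the smallest set such that: (1) $\pm e_n^*\in D_{wh}$ for all $n$; (2) for each $j\ge0$, $\frac1{m_{2j}}\sum_{i=1}^d\lambda_if_i\in D_{wh}$ whenever $(f_i)_{i=1}^d\subset D_{wh}$ is $\mathcal{S}_{n_{2j}}$-allowable and $(\lambda_i)\in Ba(\ell_2)$; (3) for each $j\ge 0$, $\frac1{m_{2j+1}}\sum_{i=1}^p\lambda_if_i\in D_{wh}$ whenever $(f_i)_{i=1}^p\subset D_{wh}$ is an $\mathcal{S}_{n_{2j+1}}$ $\sigma$-special sequence of functionals and $(\lambda_i)\in Ba(\ell_2)$. The weight $w(f)$ of a functional produced by (2) or (3) is $m_{2j}$ or $m_{2j+1}$ respectively. $\mathfrak{X}_{wh}$ is the completion of $c_{00}$ under $\|x\|=\sup\{f(x):f\in D_{wh}\}$. *)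

theory Defs
  imports "HOL-Analysis.Analysis" "HOL-Analysis.Finite_Function_Topology"
begin

text \<open>
  Throughout, \<open>\<nat>\<close> is \<open>{1, 2, \<dots>}\<close>: index 0 of a sequence indexed by \<open>\<nat>\<close> is never used.
  Finitely supported sequences are elements of \<open>nat \<Rightarrow>\<^sub>0 real\<close>, used only as a vector space; the norm
  that the library puts on this type is the \<open>\<ell>\<^sub>1\<close> norm and plays no role here.
\<close>

definition c00 :: "(nat \<Rightarrow>\<^sub>0 real) set" where
  "c00 = {x. 0 \<notin> Poly_Mapping.keys x}"

abbreviation unit_vec :: "nat \<Rightarrow> nat \<Rightarrow>\<^sub>0 real" where
  "unit_vec k \<equiv> Poly_Mapping.single k 1"


section \<open>Operators between normed spaces given by a carrier and a norm\<close>

definition linear_on :: "'a::real_vector set \<Rightarrow> ('a \<Rightarrow> 'b::real_vector) \<Rightarrow> bool" where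
  "linear_on V T \<longleftrightarrow>
     (\<forall>x\<in>V. \<forall>y\<in>V. T (x + y) = T x + T y) \<and> (\<forall>c. \<forall>x\<in>V. T (c *\<^sub>R x) = c *\<^sub>R T x)"

definition bounded_linear_on ::
  "'a::real_vector set \<Rightarrow> ('a \<Rightarrow> real) \<Rightarrow> ('b::real_vector \<Rightarrow> real) \<Rightarrow> ('a \<Rightarrow> 'b) \<Rightarrow> bool" where
  "bounded_linear_on V p q T \<longleftrightarrow> linear_on V T \<and> (\<exists>K. \<forall>x\<in>V. q (T x) \<le> K * p x)"

definition opnorm_on ::
  "'a::real_vector set \<Rightarrow> ('a \<Rightarrow> real) \<Rightarrow> ('b::real_vector \<Rightarrow> real) \<Rightarrow> ('a \<Rightarrow> 'b) \<Rightarrow> real" where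
  "opnorm_on V p q T = (SUP x\<in>{x\<in>V. p x \<le> 1}. q (T x))"

text \<open>The value is \<open>\<infinity>\<close> if the two spaces are not isomorphic.\<close>

definition banach_mazur ::
  "'a::real_vector set \<Rightarrow> ('a \<Rightarrow> real) \<Rightarrow> 'b::real_vector set \<Rightarrow> ('b \<Rightarrow> real) \<Rightarrow> ereal" where
  "banach_mazur V p W q =
     (INF T\<in>{T. bij_betw T V W \<and> bounded_linear_on V p q T \<and>
                bounded_linear_on W q p (inv_into V T)}.
        ereal (opnorm_on V p q T * opnorm_on W q p (inv_into V T)))"

definition l2_space :: "nat \<Rightarrow> (nat \<Rightarrow>\<^sub>0 real) set" where
  "l2_space k = {x. Poly_Mapping.keys x \<subseteq> {1..k}}"

definition l2_norm :: "(nat \<Rightarrow>\<^sub>0 real) \<Rightarrow> real" where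
  "l2_norm x = L2_set (Poly_Mapping.lookup x) (Poly_Mapping.keys x)"

definition is_completion ::
  "'v::real_vector set \<Rightarrow> ('v \<Rightarrow> real) \<Rightarrow> 'a::real_normed_vector set \<Rightarrow> ('v \<Rightarrow> 'a) \<Rightarrow> bool" where
  "is_completion V p X \<iota> \<longleftrightarrow>
     subspace X \<and> complete X \<and> linear_on V \<iota> \<and> \<iota> ` V \<subseteq> X \<and>
     (\<forall>x\<in>V. norm (\<iota> x) = p x) \<and> X \<subseteq> closure (\<iota> ` V)"


section \<open>Weak Hilbert spaces\<close>

definition finite_dimensional :: "'a::real_vector set \<Rightarrow> bool" where
  "finite_dimensional E \<longleftrightarrow> (\<exists>B. finite B \<and> E \<subseteq> span B)"

definition projection_onto ::
  "'a::real_normed_vector set \<Rightarrow> 'a set \<Rightarrow> ('a \<Rightarrow> 'a) \<Rightarrow> bool" where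
  "projection_onto X F P \<longleftrightarrow>
     bounded_linear_on X norm norm P \<and> P ` X = F \<and> (\<forall>y\<in>F. P y = y)"

definition weak_Hilbert :: "'a::real_normed_vector set \<Rightarrow> bool" where
  "weak_Hilbert X \<longleftrightarrow>
     subspace X \<and> complete X \<and> \<not> finite_dimensional X \<and>
     (\<exists>\<delta>>0. \<exists>C>0. \<forall>E. subspace E \<and> E \<subseteq> X \<and> finite_dimensional E \<longrightarrow>
        (\<exists>F. subspace F \<and> F \<subseteq> E \<and> real (dim F) \<ge> \<delta> * real (dim E) \<and>
             banach_mazur F norm (l2_space (dim F)) l2_norm \<le> ereal C \<and>
             (\<exists>P. projection_onto X F P \<and> opnorm_on X norm norm P \<le> C)))"


section \<open>Asymptotic \<open>\<ell>\<^sub>2\<close> for vectors with disjoint supports\<close>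

text \<open>The condition \<open>a 0 = 0\<close> fixes the value at the unused index, so that \<open>a\<close> can be unique.\<close>

definition basis_expansion ::
  "(nat \<Rightarrow> 'a::real_normed_vector) \<Rightarrow> 'a \<Rightarrow> (nat \<Rightarrow> real) \<Rightarrow> bool" where
  "basis_expansion e x a \<longleftrightarrow> a 0 = 0 \<and> (\<lambda>N. \<Sum>i=1..N. a i *\<^sub>R e i) \<longlonglongrightarrow> x"

definition schauder_basis :: "'a::real_normed_vector set \<Rightarrow> (nat \<Rightarrow> 'a) \<Rightarrow> bool" where
  "schauder_basis X e \<longleftrightarrow> (\<forall>i\<ge>1. e i \<in> X) \<and> (\<forall>x\<in>X. \<exists>!a. basis_expansion e x a)"

definition basis_supp :: "(nat \<Rightarrow> 'a::real_normed_vector) \<Rightarrow> 'a \<Rightarrow> nat set" where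
  "basis_supp e x = {i. i \<ge> 1 \<and> (THE a. basis_expansion e x a) i \<noteq> 0}"

definition asymptotic_l2_disjoint ::
  "'a::real_normed_vector set \<Rightarrow> (nat \<Rightarrow> 'a) \<Rightarrow> bool" where
  "asymptotic_l2_disjoint X e \<longleftrightarrow>
     schauder_basis X e \<and>
     (\<exists>C\<ge>1. \<forall>(n::nat) x.
        (\<forall>i\<in>{1..n}. x i \<in> X \<and> norm (x i) = 1 \<and> (\<forall>k\<in>basis_supp e (x i). n \<le> k)) \<and>
        disjoint_family_on (\<lambda>i. basis_supp e (x i)) {1..n} \<longrightarrow>
        (\<forall>a. (1 / C) * L2_set a {1..n} \<le> norm (\<Sum>i=1..n. a i *\<^sub>R x i) \<and>
             norm (\<Sum>i=1..n. a i *\<^sub>R x i) \<le> C * L2_set a {1..n}))"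


section \<open>Schreier families and special sequences\<close>

text \<open>
  The families start at index 1; index 0 carries the customary \<open>\<S>\<^sub>0\<close> and is never used, because
  the sequence \<open>n\<close> below is positive. The empty set belongs to every family.
\<close>

fun schreier :: "nat \<Rightarrow> nat set set" where
  "schreier 0 = {F. F \<subseteq> {1..} \<and> finite F \<and> card F \<le> 1}"
| "schreier (Suc 0) = {F. F \<subseteq> {1..} \<and> finite F \<and> (F \<noteq> {} \<longrightarrow> card F \<le> Min F)}"
| "schreier (Suc (Suc n)) =
     {(\<Union>i<d. F i) | (d::nat) F.
        (\<forall>i<d. F i \<in> schreier (Suc n) \<and> F i \<noteq> {}) \<and>
        (\<forall>i<d. \<forall>j<d. i < j \<longrightarrow> (\<forall>a\<in>F i. \<forall>b\<in>F j. a < b)) \<and>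
        (\<lambda>i. Min (F i)) ` {..<d} \<in> schreier (Suc 0)}"

definition allowable :: "nat \<Rightarrow> nat \<Rightarrow> (nat \<Rightarrow> nat set) \<Rightarrow> bool" where
  "allowable N d E \<longleftrightarrow>
     (\<forall>i<d. E i \<subseteq> {1..} \<and> finite (E i) \<and> E i \<noteq> {}) \<and>
     disjoint_family_on E {..<d} \<and> (\<lambda>i. Min (E i)) ` {..<d} \<in> schreier N"

text \<open>
  A sequence \<open>(E\<^sub>i, 2j\<^sub>i)\<^sub>i\<close> is represented by the list of the pairs \<open>(E\<^sub>i, j\<^sub>i)\<close>; list positions
  start at 0.
\<close>

definition Sigma_seqs :: "nat set \<Rightarrow> nat set \<Rightarrow> (nat set \<times> nat) list set" where
  "Sigma_seqs N1 N2 =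
     {s. s \<noteq> [] \<and>
         (\<forall>i<length s. fst (s ! i) \<subseteq> {1..} \<and> finite (fst (s ! i)) \<and> fst (s ! i) \<noteq> {}) \<and>
         disjoint_family_on (\<lambda>i. fst (s ! i)) {..<length s} \<and>
         sorted_wrt (<) (map snd s) \<and>
         snd (s ! 0) \<in> N1 \<and> (\<forall>i. 0 < i \<and> i < length s \<longrightarrow> snd (s ! i) \<in> N2)}"

text \<open>Since \<open>m 0 = m 1\<close>, ``increasing'' is read as non-decreasing.\<close>

locale wh_parameters =
  fixes m n :: "nat \<Rightarrow> nat"
    and N1 N2 :: "nat set"
    and \<sigma> :: "(nat set \<times> nat) list \<Rightarrow> nat"
  assumes m_mono: "mono m" and n_mono: "mono n"
    and m_0: "m 0 = 2" and m_1: "m 1 = 2" and n_0: "n 0 = 1"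
    and m_growth: "\<And>j. j \<ge> 2 \<Longrightarrow> m (j + 1) \<ge> m j ^ 3"
    and n_growth: "\<And>j. j \<ge> 2 \<Longrightarrow>
          (3 * log 2 (real (m j)) + 1) * (real (n (j - 1)) + 1) < real (n j)"
    and N_disjoint: "N1 \<inter> N2 = {}" and N_cover: "N1 \<union> N2 = {1..}"
    and N1_infinite: "infinite N1" and N2_infinite: "infinite N2"
    and \<sigma>_inj: "inj_on \<sigma> (Sigma_seqs N1 N2)"
    and \<sigma>_range: "\<sigma> ` Sigma_seqs N1 N2 \<subseteq> N2"
    and \<sigma>_growth_prefix: "\<And>s i. s \<in> Sigma_seqs N1 N2 \<Longrightarrow> length s = i + 1 \<Longrightarrow> i \<ge> 1 \<Longrightarrow>
          m (2 * \<sigma> s) > m (2 * \<sigma> (take i s)) * (Max (fst (s ! (i - 1))))\<^sup>2"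
    and \<sigma>_growth_last: "\<And>s. s \<in> Sigma_seqs N1 N2 \<Longrightarrow>
          m (2 * \<sigma> s) > m (2 * snd (last s)) * (Max (fst (last s)))\<^sup>2"

definition sigma_special ::
  "nat set \<Rightarrow> nat set \<Rightarrow> ((nat set \<times> nat) list \<Rightarrow> nat) \<Rightarrow> (nat set \<times> nat) list \<Rightarrow> bool" where
  "sigma_special N1 N2 \<sigma> s \<longleftrightarrow>
     s \<in> Sigma_seqs N1 N2 \<and> (\<forall>i. 1 \<le> i \<and> i < length s \<longrightarrow> \<sigma> (take i s) = snd (s ! i))"

definition schreier_sigma_special ::
  "(nat \<Rightarrow> nat) \<Rightarrow> nat set \<Rightarrow> nat set \<Rightarrow> ((nat set \<times> nat) list \<Rightarrow> nat) \<Rightarrow> nat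
     \<Rightarrow> (nat set \<times> nat) list \<Rightarrow> bool" where
  "schreier_sigma_special n N1 N2 \<sigma> j s \<longleftrightarrow>
     sigma_special N1 N2 \<sigma> s \<and>
     (\<lambda>i. Min (fst (s ! i))) ` {..<length s} \<in> schreier (n (2 * j + 1)) \<and>
     2 * snd (s ! 0) > 2 * j + 2"


section \<open>The norming set and the norm\<close>

text \<open>
  \<open>has_weight \<dots> f w\<close> says that \<open>f\<close> is produced by one of the two averaging rules with weight \<open>w\<close>.
  The weight depends on how \<open>f\<close> is produced, hence it is a relation and not a function of \<open>f\<close>.
\<close>

inductive in_Dwh ::
  "(nat \<Rightarrow> nat) \<Rightarrow> (nat \<Rightarrow> nat) \<Rightarrow> nat set \<Rightarrow> nat set \<Rightarrow> ((nat set \<times> nat) list \<Rightarrow> nat)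
     \<Rightarrow> (nat \<Rightarrow>\<^sub>0 real) \<Rightarrow> bool"
and has_weight ::
  "(nat \<Rightarrow> nat) \<Rightarrow> (nat \<Rightarrow> nat) \<Rightarrow> nat set \<Rightarrow> nat set \<Rightarrow> ((nat set \<times> nat) list \<Rightarrow> nat)
     \<Rightarrow> (nat \<Rightarrow>\<^sub>0 real) \<Rightarrow> nat \<Rightarrow> bool"
for m n :: "nat \<Rightarrow> nat" and N1 N2 :: "nat set" and \<sigma> :: "(nat set \<times> nat) list \<Rightarrow> nat"
where
  unit_pos: "k \<ge> 1 \<Longrightarrow> in_Dwh m n N1 N2 \<sigma> (unit_vec k)"
| unit_neg: "k \<ge> 1 \<Longrightarrow> in_Dwh m n N1 N2 \<sigma> (- unit_vec k)"
| weighted: "has_weight m n N1 N2 \<sigma> f w \<Longrightarrow> in_Dwh m n N1 N2 \<sigma> f"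
| even_weight:
    "(\<And>i. i < d \<Longrightarrow> in_Dwh m n N1 N2 \<sigma> (f i)) \<Longrightarrow>
     allowable (n (2 * j)) d (\<lambda>i. Poly_Mapping.keys (f i)) \<Longrightarrow>
     (\<Sum>i<d. (c i)\<^sup>2) \<le> 1 \<Longrightarrow>
     has_weight m n N1 N2 \<sigma> ((1 / real (m (2 * j))) *\<^sub>R (\<Sum>i<d. c i *\<^sub>R f i)) (m (2 * j))"
| odd_weight:
    "schreier_sigma_special n N1 N2 \<sigma> j s \<Longrightarrow>
     (\<And>i. i < length s \<Longrightarrow> in_Dwh m n N1 N2 \<sigma> (f i)) \<Longrightarrow>
     (\<And>i. i < length s \<Longrightarrow> Poly_Mapping.keys (f i) \<subseteq> fst (s ! i)) \<Longrightarrow>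
     (\<And>i. i < length s \<Longrightarrow> has_weight m n N1 N2 \<sigma> (f i) (m (2 * snd (s ! i)))) \<Longrightarrow>
     (\<Sum>i<length s. (c i)\<^sup>2) \<le> 1 \<Longrightarrow>
     has_weight m n N1 N2 \<sigma>
       ((1 / real (m (2 * j + 1))) *\<^sub>R (\<Sum>i<length s. c i *\<^sub>R f i)) (m (2 * j + 1))"

definition D_wh ::
  "(nat \<Rightarrow> nat) \<Rightarrow> (nat \<Rightarrow> nat) \<Rightarrow> nat set \<Rightarrow> nat set \<Rightarrow> ((nat set \<times> nat) list \<Rightarrow> nat)
     \<Rightarrow> (nat \<Rightarrow>\<^sub>0 real) set" where
  "D_wh m n N1 N2 \<sigma> = {f. in_Dwh m n N1 N2 \<sigma> f}"

definition pairing :: "(nat \<Rightarrow>\<^sub>0 real) \<Rightarrow> (nat \<Rightarrow>\<^sub>0 real) \<Rightarrow> real" where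
  "pairing f x = (\<Sum>i\<in>Poly_Mapping.keys x. Poly_Mapping.lookup f i * Poly_Mapping.lookup x i)"

definition wh_norm ::
  "(nat \<Rightarrow> nat) \<Rightarrow> (nat \<Rightarrow> nat) \<Rightarrow> nat set \<Rightarrow> nat set \<Rightarrow> ((nat set \<times> nat) list \<Rightarrow> nat)
     \<Rightarrow> (nat \<Rightarrow>\<^sub>0 real) \<Rightarrow> real" where
  "wh_norm m n N1 N2 \<sigma> x = (SUP f\<in>D_wh m n N1 N2 \<sigma>. pairing f x)"

text \<open>
  \<open>X\<close> is (a copy of) the completion of \<open>c00\<close> under this norm, realised as a complete subspace of
  some normed space, with canonical embedding \<open>\<iota>\<close>; it is determined up to isometric isomorphism
  over \<open>c00\<close>. The supremum defining the norm is finite because the coordinates of the functionals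
  are bounded by 1.
\<close>

definition is_X_wh ::
  "(nat \<Rightarrow> nat) \<Rightarrow> (nat \<Rightarrow> nat) \<Rightarrow> nat set \<Rightarrow> nat set \<Rightarrow> ((nat set \<times> nat) list \<Rightarrow> nat)
     \<Rightarrow> 'a::real_normed_vector set \<Rightarrow> ((nat \<Rightarrow>\<^sub>0 real) \<Rightarrow> 'a) \<Rightarrow> bool" where
  "is_X_wh m n N1 N2 \<sigma> X \<iota> \<longleftrightarrow> is_completion c00 (wh_norm m n N1 N2 \<sigma>) X \<iota>"

end

theory Submission
  imports Defs
begin

text \<open>
  Every functional in \<open>D_wh\<close> has the form \<open>c \<cdot> w\<close> with \<open>c\<close> in the unit ball of \<open>\<ell>\<^sub>2\<close> and a weight
  \<open>w\<close> that admits every other \<open>c\<close> of norm 1. The norm is therefore a supremum of weighted \<open>\<ell>\<^sub>2\<close>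
  norms. This gives upper \<open>\<ell>\<^sub>2\<close> estimates with constant 1 for disjoint supports, and the averaging
  rule with \<open>j = 0\<close> gives the lower estimates.

  For the weak Hilbert property, a given subspace of dimension \<open>N\<close> is cut down to the vectors \<open>x\<close>
  whose first \<open>N div 2\<close> coordinates vanish. A net argument provides exponentially many (in \<open>N\<^sup>2\<close>)
  functionals that norm this tail up to a factor 2. So few functionals beyond \<open>N / 2\<close> are
  \<open>\<S>\<^sub>3\<close>-allowable, and \<open>n\<^sub>2 \<ge> 3\<close>: hence the weighted \<open>\<ell>\<^sub>2\<close> norm for the maximum of their weights
  is at most \<open>m\<^sub>2\<close> times the norm of the space. It is equivalent to the norm on the tail, and the
  projection that is orthogonal for it is bounded.
\<close>

section \<open>Schreier families\<close>

text \<open>The weak Hilbert property is drawn from the norming set itself, not from the asymptotic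
  estimates. The obstacle is the size of a norming family: for a subspace of dimension about
  \<open>q\<close> its cardinality has an exponent quadratic in \<open>q\<close>, while
  \<open>S_1\<close> guarantees only \<open>q\<close> sets beyond \<open>q\<close>, and the count
  \<open>q * (2 ^ q - 1)\<close> obtained for \<open>S_2\<close> is still too small. Two consecutive
  \<open>S_2\<close> blocks reach \<open>2 ^ 2 ^ q\<close>, so \<open>S_3\<close> suffices at the
  fixed price \<open>m 2\<close>. A maximum of weights is taken because a sum of the quadratic forms
  would cost a factor growing with the family. The pieces on which a given functional attains the
  maximum are disjoint, so a single average handles all of them. Changing \<open>c\<close> in
  \<open>c * w\<close> shrinks supports, which moves their minima to the right and can permute them.
  The averaging rules survive this because Schreier families are spreading and hereditary; hence the
  combinatorics of minima. In special sequences the replaced functionals must also keep their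
  weights, so the diagonal form is proved for each weight separately.\<close>

text \<open>Peeling off the first block allows induction on the number of blocks, which the indexed
  family inside \<open>schreier\<close> does not offer directly.\<close>

fun blocks :: "nat \<Rightarrow> nat \<Rightarrow> nat set \<Rightarrow> bool" where
  "blocks n 0 G \<longleftrightarrow> G = {}"
| "blocks n (Suc d) G \<longleftrightarrow>
     (\<exists>A B. G = A \<union> B \<and> A \<in> schreier n \<and> A \<noteq> {} \<and> blocks n d B \<and> (\<forall>a\<in>A. \<forall>b\<in>B. a < b))"

lemma blocks_iff_family:
  "blocks n d G \<longleftrightarrow> (\<exists>F. G = (\<Union>i<d. F i) \<and> (\<forall>i<d. F i \<in> schreier n \<and> F i \<noteq> {}) \<and>
     (\<forall>i<d. \<forall>j<d. i < j \<longrightarrow> (\<forall>a\<in>F i. \<forall>b\<in>F j. a < b)))"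
proof (induction d arbitrary: G)
  case 0
  then show ?case by auto
next
  case (Suc d)
  show ?case (is "?L \<longleftrightarrow> ?R")
  proof
    assume ?L
    then obtain A B where A: "G = A \<union> B" "A \<in> schreier n" "A \<noteq> {}" "\<forall>a\<in>A. \<forall>b\<in>B. a < b"
      and "blocks n d B" by auto
    from this(5) obtain F where F: "B = (\<Union>i<d. F i)" "\<forall>i<d. F i \<in> schreier n \<and> F i \<noteq> {}"
        "\<forall>i<d. \<forall>j<d. i < j \<longrightarrow> (\<forall>a\<in>F i. \<forall>b\<in>F j. a < b)"
      unfolding Suc by blast
    let ?F = "case_nat A F"
    have 1: "G = (\<Union>i<Suc d. ?F i)"
      using A(1) F(1) by (simp add: lessThan_Suc_eq_insert_0)
    have 2: "\<forall>i<Suc d. ?F i \<in> schreier n \<and> ?F i \<noteq> {}"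
      using A F(2) by (auto split: nat.split)
    have 3: "\<forall>i<Suc d. \<forall>j<Suc d. i < j \<longrightarrow> (\<forall>a\<in>?F i. \<forall>b\<in>?F j. a < b)"
    proof (intro allI impI)
      fix i j assume ij: "i < Suc d" "j < Suc d" "i < j"
      then obtain j' where j': "j = Suc j'" by (cases j) auto
      show "\<forall>a\<in>?F i. \<forall>b\<in>?F j. a < b"
      proof (cases i)
        case 0
        have "F j' \<subseteq> B" using ij(2) j' F(1) by auto
        then show ?thesis using 0 j' A(4) by auto
      next
        case (Suc i')
        then have "i' < d" "j' < d" "i' < j'" using ij j' by auto
        then have "\<forall>a\<in>F i'. \<forall>b\<in>F j'. a < b" using F(3) by blast
        then show ?thesis unfolding Suc j' by simp
      qed
    qed
    show ?R using 1 2 3 by blast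
  next
    assume ?R
    then obtain F where F: "G = (\<Union>i<Suc d. F i)" "\<forall>i<Suc d. F i \<in> schreier n \<and> F i \<noteq> {}"
        "\<forall>i<Suc d. \<forall>j<Suc d. i < j \<longrightarrow> (\<forall>a\<in>F i. \<forall>b\<in>F j. a < b)" by blast
    have "blocks n d (\<Union>i<d. F (Suc i))"
      unfolding Suc
    proof (intro exI[of _ "\<lambda>i. F (Suc i)"] conjI)
      show "\<forall>i<d. \<forall>j<d. i < j \<longrightarrow> (\<forall>a\<in>F (Suc i). \<forall>b\<in>F (Suc j). a < b)"
        using F(3) by (meson Suc_mono)
    qed (use F(2) in auto)
    moreover have "G = F 0 \<union> (\<Union>i<d. F (Suc i))"
      using F(1) by (simp add: lessThan_Suc_eq_insert_0)
    moreover have "\<forall>a\<in>F 0. \<forall>b\<in>(\<Union>i<d. F (Suc i)). a < b"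
      using F(3) by (metis UN_E lessThan_iff Suc_mono zero_less_Suc)
    moreover have "F 0 \<in> schreier n" "F 0 \<noteq> {}" using F(2) by auto
    ultimately show ?L unfolding blocks.simps by blast
  qed
qed

lemma schreier_finite_pos: "F \<in> schreier n \<Longrightarrow> finite F \<and> F \<subseteq> {1..}"
proof (induction n arbitrary: F rule: schreier.induct)
  case (3 n)
  from 3(3) obtain d :: nat and E where F: "F = (\<Union>i<d. E i)"
    "\<forall>i<d. E i \<in> schreier (Suc n) \<and> E i \<noteq> {}"
    unfolding schreier.simps(3) mem_Collect_eq by (elim exE conjE) (rule that)
  have "finite (E i) \<and> E i \<subseteq> {1..}" if "i < d" for i
    using "3.IH" F(2) that by blast
  then show ?case unfolding F(1) by auto
qed auto

text \<open>Minima of consecutive blocks increase strictly. The definition of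
  \<open>schreier\<close> measures the image set of the minima, and injectivity turns its
  cardinality into the number of blocks.\<close>

lemma card_Min_family:
  fixes F :: "nat \<Rightarrow> nat set"
  assumes "\<forall>i<d. finite (F i) \<and> F i \<noteq> {}"
    and "\<forall>i<d. \<forall>j<d. i < j \<longrightarrow> (\<forall>a\<in>F i. \<forall>b\<in>F j. a < b)"
  shows "card ((\<lambda>i. Min (F i)) ` {..<d}) = d"
proof -
  have "Min (F i) < Min (F j)" if "i < j" "j < d" for i j
  proof -
    have "i < d" using that by simp
    then have "Min (F i) \<in> F i" "Min (F j) \<in> F j" using assms(1) that by auto
    then show ?thesis using assms(2) that \<open>i < d\<close> by blast
  qed
  then have "inj_on (\<lambda>i. Min (F i)) {..<d}"
    by (intro linorder_inj_onI) (auto simp: neq_iff)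
  then show ?thesis by (simp add: card_image)
qed

lemma Min_family_0:
  fixes F :: "nat \<Rightarrow> nat set"
  assumes "\<forall>i<d. finite (F i) \<and> F i \<noteq> {}" "0 < d"
    and "\<forall>i<d. \<forall>j<d. i < j \<longrightarrow> (\<forall>a\<in>F i. \<forall>b\<in>F j. a < b)"
  shows "Min ((\<lambda>i. Min (F i)) ` {..<d}) = Min (F 0)" "Min (\<Union>i<d. F i) = Min (F 0)"
proof -
  have m: "Min (F 0) \<in> F 0" using assms(1,2) by auto
  have le: "Min (F 0) \<le> x" if "x \<in> F i" "i < d" for x i
  proof (cases "i = 0")
    case True
    then show ?thesis using that assms(1,2) by auto
  next
    case False
    then have "Min (F 0) < x" using assms(2,3) that m by blast
    then show ?thesis by simp
  qed
  show "Min ((\<lambda>i. Min (F i)) ` {..<d}) = Min (F 0)"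
    using assms(1,2) le[OF Min_in] by (intro Min_eqI) auto
  show "Min (\<Union>i<d. F i) = Min (F 0)"
  proof (rule Min_eqI)
    show "Min (F 0) \<in> (\<Union>i<d. F i)" using m assms(2) by blast
  qed (use assms(1) le in auto)
qed

text \<open>The minima of the blocks are distinct and the smallest of them is \<open>Min G\<close>,
  so their membership in \<open>S_1\<close> amounts to \<open>d \<le> Min G\<close>. The empty set
  is separate because \<open>Min {}\<close> is unspecified.\<close>

lemma schreier_Suc_Suc_iff:
  "G \<in> schreier (Suc (Suc n)) \<longleftrightarrow> G = {} \<or> (\<exists>d. blocks (Suc n) d G \<and> d \<le> Min G)"
proof
  assume "G \<in> schreier (Suc (Suc n))"
  then obtain d :: nat and F where F: "G = (\<Union>i<d. F i)"
        "\<forall>i<d. F i \<in> schreier (Suc n) \<and> F i \<noteq> {}"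
        "\<forall>i<d. \<forall>j<d. i < j \<longrightarrow> (\<forall>a\<in>F i. \<forall>b\<in>F j. a < b)"
    and S: "(\<lambda>i. Min (F i)) ` {..<d} \<in> schreier (Suc 0)"
    unfolding schreier.simps(3) mem_Collect_eq by (elim exE conjE) (rule that)
  have fin: "\<forall>i<d. finite (F i) \<and> F i \<noteq> {}" using F(2) schreier_finite_pos by blast
  show "G = {} \<or> (\<exists>d. blocks (Suc n) d G \<and> d \<le> Min G)"
  proof (cases "d = 0")
    case True
    then show ?thesis using F(1) by simp
  next
    case False
    have "d = card ((\<lambda>i. Min (F i)) ` {..<d})" using card_Min_family[OF fin F(3)] by simp
    also have "\<dots> \<le> Min ((\<lambda>i. Min (F i)) ` {..<d})"
    proof -
      have "(\<lambda>i. Min (F i)) ` {..<d} \<noteq> {}" using False by (simp add: lessThan_empty_iff)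
      then show ?thesis using S unfolding schreier.simps(2) mem_Collect_eq by blast
    qed
    also have "\<dots> = Min G" using Min_family_0[OF fin _ F(3)] F(1) False by simp
    finally show ?thesis unfolding blocks_iff_family using F by blast
  qed
next
  assume "G = {} \<or> (\<exists>d. blocks (Suc n) d G \<and> d \<le> Min G)"
  then show "G \<in> schreier (Suc (Suc n))"
  proof
    assume "G = {}"
    then show ?thesis unfolding schreier.simps(3) by (auto intro!: exI[of _ "0::nat"])
  next
    assume "\<exists>d. blocks (Suc n) d G \<and> d \<le> Min G"
    then obtain d F where d: "d \<le> Min G" and F: "G = (\<Union>i<d. F i)"
        "\<forall>i<d. F i \<in> schreier (Suc n) \<and> F i \<noteq> {}"
        "\<forall>i<d. \<forall>j<d. i < j \<longrightarrow> (\<forall>a\<in>F i. \<forall>b\<in>F j. a < b)"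
      unfolding blocks_iff_family by auto
    have fin: "\<forall>i<d. finite (F i) \<and> F i \<noteq> {}" using F(2) schreier_finite_pos by blast
    have "(\<lambda>i. Min (F i)) ` {..<d} \<in> schreier (Suc 0)"
    proof -
      have "(\<lambda>i. Min (F i)) ` {..<d} \<subseteq> {1..}"
      proof
        fix x assume "x \<in> (\<lambda>i. Min (F i)) ` {..<d}"
        then obtain i where i: "i < d" "x = Min (F i)" by auto
        then have "x \<in> F i" using fin by auto
        then show "x \<in> {1..}" using F(2) i schreier_finite_pos by blast
      qed
      moreover have "d \<le> Min ((\<lambda>i. Min (F i)) ` {..<d})" if "0 < d"
        using Min_family_0[OF fin that F(3)] d F(1) by simp
      ultimately show ?thesis
        unfolding schreier.simps(2) mem_Collect_eq card_Min_family[OF fin F(3)]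
        by (metis finite_imageI finite_lessThan image_empty lessThan_0 not_gr0)
    qed
    then show ?thesis unfolding schreier.simps(3) mem_Collect_eq
      using F by (intro exI[of _ d] exI[of _ F] conjI)
  qed
qed

lemma schreier_subset_Suc: "schreier (Suc n) \<subseteq> schreier (Suc (Suc n))"
proof
  fix G assume G: "G \<in> schreier (Suc n)"
  have "Min G \<ge> 1" if "G \<noteq> {}" using schreier_finite_pos[OF G] that by auto
  moreover have "blocks (Suc n) 1 G" if "G \<noteq> {}" using G that by auto
  ultimately show "G \<in> schreier (Suc (Suc n))" unfolding schreier_Suc_Suc_iff by blast
qed

lemma schreier_mono:
  assumes "1 \<le> a" "a \<le> b"
  shows "schreier a \<subseteq> schreier b"
  using assms(2)
proof (induction b rule: dec_induct)
  case (step b)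
  then show ?case using assms(1) schreier_subset_Suc[of "b - 1"] by (cases b) auto
qed simp

section \<open>Hereditary and spreading properties\<close>

lemma split_initial:
  fixes G :: "nat set"
  assumes "finite G" "a \<le> card G"
  obtains A B where "G = A \<union> B" "card A = a" "\<forall>x\<in>A. \<forall>y\<in>B. x < y"
proof -
  have "\<exists>A B. G = A \<union> B \<and> card A = a \<and> (\<forall>x\<in>A. \<forall>y\<in>B. x < y)"
    using assms
  proof (induction a arbitrary: G)
    case 0
    then show ?case by (intro exI[of _ "{}"] exI[of _ G]) auto
  next
    case (Suc a)
    have ne: "G \<noteq> {}" using Suc.prems by auto
    let ?G = "G - {Min G}"
    have "a \<le> card ?G" using Suc.prems ne by (simp add: card_Diff_singleton)
    then obtain A B where AB: "?G = A \<union> B" "card A = a" "\<forall>x\<in>A. \<forall>y\<in>B. x < y"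
      using Suc.IH[of ?G] Suc.prems(1) by blast
    have "finite A" using AB(1) Suc.prems(1) by (metis finite_Diff finite_Un)
    moreover have "Min G \<notin> A" using AB(1) by auto
    ultimately have 1: "card (insert (Min G) A) = Suc a" using AB(2) by simp
    have 2: "G = insert (Min G) A \<union> B" using AB(1) Min_in[OF Suc.prems(1) ne] by auto
    have "Min G < y" if "y \<in> B" for y
    proof -
      have "y \<in> ?G" using AB(1) that by auto
      then show ?thesis using Min_le[OF Suc.prems(1)] by (simp add: order_neq_le_trans)
    qed
    then have 3: "\<forall>x\<in>insert (Min G) A. \<forall>y\<in>B. x < y" using AB(3) by auto
    show ?case using 1 2 3 by blast
  qed
  then show thesis using that by blast
qed

text \<open>\<open>G\<close> is a spread of a subset of \<open>F\<close>, expressed by counting instead of an enumeration.\<close>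

definition sparser :: "nat set \<Rightarrow> nat set \<Rightarrow> bool" where
  "sparser G F \<longleftrightarrow> (\<forall>t. card (G \<inter> {..t}) \<le> card (F \<inter> {..t}))"

lemma sparser_card:
  assumes "sparser G F" "finite F" "finite G"
  shows "card G \<le> card F"
proof -
  let ?t = "Max (insert 0 (F \<union> G))"
  have t: "x \<le> ?t" if "x \<in> F \<union> G" for x using assms that by (intro Max_ge) auto
  have "F \<inter> {..?t} = F" "G \<inter> {..?t} = G" using t by auto
  then show ?thesis using assms(1) unfolding sparser_def by metis
qed

lemma sparser_Min:
  assumes "sparser G F" "finite F" "finite G" "G \<noteq> {}"
  shows "F \<noteq> {}" "Min F \<le> Min G"
proof -
  have "Min G \<in> G \<inter> {..Min G}" using assms by auto
  then have "card (G \<inter> {..Min G}) > 0" using assms(3) by (auto simp: card_gt_0_iff)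
  then have "card (F \<inter> {..Min G}) > 0" using assms(1) unfolding sparser_def
    by (meson less_le_trans)
  then obtain y where "y \<in> F" "y \<le> Min G" by (auto simp: card_gt_0_iff)
  then show "F \<noteq> {}" "Min F \<le> Min G" using assms(2) by (auto intro: Min.coboundedI order_trans)
qed

text \<open>As long as \<open>{..t}\<close> misses \<open>B\<close>, the counts of \<open>A\<close>
  and \<open>A \<union> B\<close> agree; afterwards all of \<open>A\<close> is counted and only the
  size of \<open>G'\<close> matters.\<close>

lemma sparser_initial:
  assumes "sparser G (A \<union> B)" "finite A" "finite G" "G' \<subseteq> G" "card G' \<le> card A"
    and "\<forall>a\<in>A. \<forall>b\<in>B. a < b"
  shows "sparser G' A"
  unfolding sparser_def
proof
  fix t
  show "card (G' \<inter> {..t}) \<le> card (A \<inter> {..t})"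
  proof (cases "B \<inter> {..t} = {}")
    case True
    then have "(A \<union> B) \<inter> {..t} = A \<inter> {..t}" by auto
    then have "card (G \<inter> {..t}) \<le> card (A \<inter> {..t})"
      using assms(1) unfolding sparser_def by metis
    moreover have "card (G' \<inter> {..t}) \<le> card (G \<inter> {..t})"
      using assms(3,4) by (intro card_mono) auto
    ultimately show ?thesis by simp
  next
    case False
    then have "A \<inter> {..t} = A" using assms(6) by fastforce
    moreover have "card (G' \<inter> {..t}) \<le> card G'"
      using finite_subset[OF assms(4,3)] by (intro card_mono) auto
    ultimately show ?thesis using assms(5) by simp
  qed
qed

lemma blocks_finite: "blocks n d G \<Longrightarrow> finite G"
  by (induction d arbitrary: G) (auto dest: schreier_finite_pos)

text \<open>Greedy matching: the first \<open>card A\<close> elements of \<open>G\<close> take the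
  place of the first block \<open>A\<close>, and the remainder is compared with \<open>B\<close>. If
  \<open>G\<close> runs out early, fewer blocks are used.\<close>

lemma blocks_sparser:
  assumes spread: "\<And>F G. F \<in> schreier n \<Longrightarrow> finite G \<Longrightarrow> G \<subseteq> {1..} \<Longrightarrow> sparser G F \<Longrightarrow> G \<in> schreier n"
    and "blocks n d F" "finite G" "G \<subseteq> {1..}" "sparser G F"
  shows "\<exists>d'\<le>d. blocks n d' G"
  using assms(2-)
proof (induction d arbitrary: F G)
  case 0
  then have "card G \<le> card {}" using sparser_card[of G "{}"] by simp
  then show ?case using 0 by simp
next
  case (Suc d)
  obtain A B where F: "F = A \<union> B" "A \<in> schreier n" "A \<noteq> {}" "blocks n d B"
    "\<forall>a\<in>A. \<forall>b\<in>B. a < b" using Suc.prems(1) by auto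
  have fA: "finite A" and fB: "finite B" using F schreier_finite_pos blocks_finite by blast+
  show ?case
  proof (cases "card G \<le> card A")
    case True
    have "sparser G A"
      using sparser_initial[of G A B G] F(1,5) Suc.prems fA True by auto
    then have "G \<in> schreier n" using spread F(2) Suc.prems by blast
    then have "blocks n (if G = {} then 0 else Suc 0) G" by auto
    then show ?thesis by (intro exI[of _ "if G = {} then 0 else Suc 0"]) auto
  next
    case False
    then obtain G0 G1 where G: "G = G0 \<union> G1" "card G0 = card A" "\<forall>x\<in>G0. \<forall>y\<in>G1. x < y"
      using split_initial[OF Suc.prems(2), of "card A"] by auto
    have fG: "finite G0" "finite G1" using G(1) Suc.prems(2) by auto
    have "sparser G0 A"
      using sparser_initial[of G A B G0] F(1,5) Suc.prems fA G by auto
    then have 1: "G0 \<in> schreier n" using spread[OF F(2)] Suc.prems G fG by blast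
    \<comment> \<open>Where \<open>{..t}\<close> meets \<open>G1\<close>, it contains all of
      \<open>G0\<close>; cancelling \<open>card G0 = card A\<close> from the two counts leaves the
      claim.\<close>
    have "sparser G1 B" unfolding sparser_def
    proof
      fix t
      show "card (G1 \<inter> {..t}) \<le> card (B \<inter> {..t})"
      proof (cases "G1 \<inter> {..t} = {}")
        case False
        then have G0t: "G0 \<inter> {..t} = G0" using G(3) by fastforce
        have "card (G \<inter> {..t}) = card (G0 \<inter> {..t}) + card (G1 \<inter> {..t})"
          unfolding G(1) Int_Un_distrib2 using fG G(3) by (intro card_Un_disjoint) auto
        moreover have "card (F \<inter> {..t}) \<le> card (A \<inter> {..t}) + card (B \<inter> {..t})"
          unfolding F(1) Int_Un_distrib2 by (rule card_Un_le)
        moreover have "card (A \<inter> {..t}) \<le> card A" using fA by (intro card_mono) auto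
        moreover have "card (G \<inter> {..t}) \<le> card (F \<inter> {..t})"
          using Suc.prems(4) unfolding sparser_def by blast
        ultimately show ?thesis using G0t G(2) by simp
      qed simp
    qed
    then obtain d' where d': "d' \<le> d" "blocks n d' G1"
      using Suc.IH[OF F(4) fG(2)] Suc.prems(3) G(1) by auto
    have "G0 \<noteq> {}" using G(2) F(3) fA by auto
    then have "blocks n (Suc d') G" using 1 d' G by auto
    then show ?thesis using d' by (intro exI[of _ "Suc d'"]) auto
  qed
qed

text \<open>The number of blocks can only drop and the minimum can only grow:
  \<open>d' \<le> d \<le> Min F \<le> Min G\<close>.\<close>

lemma schreier_spreading:
  "F \<in> schreier (Suc n) \<Longrightarrow> finite G \<Longrightarrow> G \<subseteq> {1..} \<Longrightarrow> sparser G F \<Longrightarrow> G \<in> schreier (Suc n)"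
proof (induction n arbitrary: F G)
  case 0
  have fF: "finite F" using 0 by auto
  have "card G \<le> Min G" if "G \<noteq> {}"
    using sparser_card[OF 0(4) fF 0(2)] sparser_Min[OF 0(4) fF 0(2) that] 0(1) by auto
  then show ?case using 0 by auto
next
  case (Suc n)
  show ?case
  proof (cases "G = {}")
    case False
    have fF: "finite F" using Suc.prems(1) schreier_finite_pos by blast
    note Mn = sparser_Min[OF Suc.prems(4) fF Suc.prems(2) False]
    then obtain d where d: "blocks (Suc n) d F" "d \<le> Min F"
      using Suc.prems(1) unfolding schreier_Suc_Suc_iff by blast
    obtain d' where "d' \<le> d" "blocks (Suc n) d' G"
      using blocks_sparser[OF _ d(1) Suc.prems(2-4)] Suc.IH by blast
    then show ?thesis unfolding schreier_Suc_Suc_iff using d(2) Mn(2) by fastforce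
  qed (simp add: schreier_Suc_Suc_iff del: schreier.simps)
qed

text \<open>Shrinking the sets moves every minimum to the right but may change the order of the
  minima. Counting is insensitive to the order; disjointness keeps the original minima distinct, so
  each index is counted on the right-hand side.\<close>

lemma sparser_Min_subfamily:
  fixes E E' :: "'i \<Rightarrow> nat set"
  assumes "finite I" and sub: "\<And>i. i \<in> I \<Longrightarrow> finite (E i) \<and> E' i \<noteq> {} \<and> E' i \<subseteq> E i"
    and disj: "disjoint_family_on E I"
  shows "sparser ((\<lambda>i. Min (E' i)) ` I) ((\<lambda>i. Min (E i)) ` I)"
  unfolding sparser_def
proof
  fix t
  let ?J = "{i \<in> I. Min (E' i) \<le> t}"
  have m: "Min (E i) \<in> E i" "Min (E i) \<le> Min (E' i)" if "i \<in> I" for i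
  proof -
    have "finite (E i)" "E i \<noteq> {}" "E' i \<noteq> {}" "E' i \<subseteq> E i" using sub[OF that] by auto
    then show "Min (E i) \<in> E i" "Min (E i) \<le> Min (E' i)" by (simp_all add: Min_antimono)
  qed
  have inj: "inj_on (\<lambda>i. Min (E i)) ?J"
  proof (rule inj_onI)
    fix i j assume "i \<in> ?J" "j \<in> ?J" "Min (E i) = Min (E j)"
    then show "i = j" using m(1)[of i] m(1)[of j] disj unfolding disjoint_family_on_def by auto
  qed
  have "card ((\<lambda>i. Min (E' i)) ` I \<inter> {..t}) \<le> card ((\<lambda>i. Min (E' i)) ` ?J)"
    using assms(1) by (intro card_mono) auto
  also have "\<dots> \<le> card ?J" using assms(1) by (intro card_image_le) auto
  also have "\<dots> = card ((\<lambda>i. Min (E i)) ` ?J)" using inj by (simp add: card_image)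
  also have "\<dots> \<le> card ((\<lambda>i. Min (E i)) ` I \<inter> {..t})"
    using assms(1) m(2) by (intro card_mono) (auto intro: order_trans)
  finally show "card ((\<lambda>i. Min (E' i)) ` I \<inter> {..t}) \<le> card ((\<lambda>i. Min (E i)) ` I \<inter> {..t})" .
qed

section \<open>Size of Schreier sets beyond a given index\<close>

lemma initial_lower_bound:
  fixes A :: "nat set"
  assumes "\<forall>x\<in>A. q \<le> x" "\<forall>x\<in>A. x < y" "A \<noteq> {}"
  shows "q + card A \<le> y"
proof -
  have "card A \<le> card {q..<y}" using assms by (intro card_mono) auto
  moreover have "q < y" using assms by fastforce
  ultimately show ?thesis by simp
qed

text \<open>The first \<open>q\<close> elements of a set beyond \<open>q\<close> form an
  \<open>S_1\<close> set, and what follows lies beyond \<open>2 * q\<close>. The admissible block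
  size thus doubles each time, and
  \<open>q + 2 * q + ... + 2 ^ (d - 1) * q = q * (2 ^ d - 1)\<close>.\<close>

lemma blocks_exponential:
  "1 \<le> q \<Longrightarrow> finite G \<Longrightarrow> \<forall>x\<in>G. q \<le> x \<Longrightarrow> card G \<le> q * (2 ^ d - 1) \<Longrightarrow> \<exists>d'\<le>d. blocks (Suc 0) d' G"
proof (induction d arbitrary: q G)
  case 0
  then show ?case by auto
next
  case (Suc d)
  have S1: "A \<in> schreier (Suc 0)" if "A \<subseteq> G" "card A \<le> q" for A
  proof -
    have "finite A" using that Suc.prems finite_subset by blast
    moreover have "q \<le> x" if "x \<in> A" for x using \<open>A \<subseteq> G\<close> Suc.prems(3) that by auto
    ultimately show ?thesis using that(2) Suc.prems(1) by (fastforce simp: Min_ge_iff)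
  qed
  show ?case
  proof (cases "card G \<le> q")
    case True
    then have "blocks (Suc 0) (if G = {} then 0 else Suc 0) G"
      using S1[of G] by (auto simp del: schreier.simps)
    then show ?thesis by (intro exI[of _ "if G = {} then 0 else Suc 0"]) auto
  next
    case False
    then obtain A B where G: "G = A \<union> B" "card A = q" "\<forall>x\<in>A. \<forall>y\<in>B. x < y"
      using split_initial[OF Suc.prems(2), of q] by auto
    have A: "A \<noteq> {}" using G(2) Suc.prems(1) by auto
    have "2 * q \<le> y" if "y \<in> B" for y
      using initial_lower_bound[of A q y] G Suc.prems(3) A that by auto
    moreover have "card B \<le> 2 * q * (2 ^ d - 1)"
    proof -
      have "card G = card A + card B" unfolding G(1)
        using Suc.prems(2) G by (intro card_Un_disjoint) auto
      moreover have "q * (2 ^ Suc d - 1) = q + 2 * q * (2 ^ d - (1::nat))"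
      proof -
        obtain e where "2 ^ d = Suc e" using not0_implies_Suc[of "2 ^ d"] by auto
        then show ?thesis by (simp add: algebra_simps)
      qed
      ultimately show ?thesis using Suc.prems(4) G(2) by simp
    qed
    ultimately obtain d' where "d' \<le> d" "blocks (Suc 0) d' B"
      using Suc.IH[of "2 * q" B] Suc.prems(1,2) G(1) by auto
    then have "blocks (Suc 0) (Suc d') G"
      using S1[of A] G A by (auto simp del: schreier.simps)
    then show ?thesis using \<open>d' \<le> d\<close> by (intro exI[of _ "Suc d'"]) auto
  qed
qed

text \<open>The case \<open>d = q\<close>: up to \<open>q\<close> blocks are allowed because
  \<open>q \<le> Min G\<close>.\<close>

lemma schreier_2_exponential:
  assumes "1 \<le> q" "finite G" "\<forall>x\<in>G. q \<le> x" "card G \<le> q * (2 ^ q - 1)"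
  shows "G \<in> schreier (Suc (Suc 0))"
proof (cases "G = {}")
  case False
  then have "q \<le> Min G" using assms by auto
  then show ?thesis unfolding schreier_Suc_Suc_iff
    using blocks_exponential[OF assms] order_trans by blast
qed (simp add: schreier_Suc_Suc_iff del: schreier.simps)

text \<open>Two \<open>S_2\<close> blocks suffice, and two are allowed because
  \<open>2 \<le> q \<le> Min G\<close>. Once the first \<open>q * (2 ^ q - 1)\<close> elements are
  removed, the rest lies beyond \<open>q * 2 ^ q\<close>, hence beyond \<open>2 ^ q\<close>, where
  the bound for \<open>S_2\<close> is already double exponential.\<close>

lemma schreier_3_double_exponential:
  assumes "2 \<le> q" "finite G" "\<forall>x\<in>G. q \<le> x" "card G \<le> 2 ^ 2 ^ q"
  shows "G \<in> schreier 3"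
proof -
  let ?a = "q * (2 ^ q - 1)"
  have "G \<in> schreier (Suc (Suc (Suc 0)))"
  proof (cases "card G \<le> ?a")
    case True
    then have "G \<in> schreier (Suc (Suc 0))" using schreier_2_exponential[of q G] assms by auto
    then show ?thesis using schreier_subset_Suc by blast
  next
    case False
    then obtain A B where G: "G = A \<union> B" "card A = ?a" "\<forall>x\<in>A. \<forall>y\<in>B. x < y"
      using split_initial[OF assms(2), of ?a] by auto
    have q2: "(2::nat) ^ q \<ge> 2" using assms(1) self_le_power[of "2::nat" q] by simp
    have A: "A \<noteq> {}" using G(2) assms(1) q2 by fastforce
    have fin: "finite A" "finite B" using G(1) assms(2) by auto
    have qa: "q + ?a = q * 2 ^ q"
      by (simp add: diff_mult_distrib2)
    have B: "q * 2 ^ q \<le> y" if "y \<in> B" for y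
      using initial_lower_bound[of A q y] G assms(3) A that qa by auto
    have A2: "A \<in> schreier (Suc (Suc 0))"
      using schreier_2_exponential[of q A] G assms fin by auto
    have B2: "B \<in> schreier (Suc (Suc 0))"
    proof (rule schreier_2_exponential[of "2 ^ q"])
      have "card B \<le> 2 ^ 2 ^ q"
        using assms(4) card_mono[of G B] G(1) assms(2) by auto
      also have "\<dots> \<le> 2 * (2 ^ 2 ^ q - 1)" 
        using self_le_power[of "2::nat" "2 ^ q"] q2 by simp
      also have "\<dots> \<le> 2 ^ q * (2 ^ 2 ^ q - 1)" using q2 by (intro mult_right_mono) auto
      finally show "card B \<le> 2 ^ q * (2 ^ 2 ^ q - 1)" .
      show "\<forall>x\<in>B. 2 ^ q \<le> x" 
      proof
        fix x assume "x \<in> B"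
        then have "q * 2 ^ q \<le> x" by (rule B)
        moreover have "1 * 2 ^ q \<le> q * 2 ^ q" using assms(1) by (intro mult_right_mono) auto
        ultimately show "2 ^ q \<le> x" by (metis le_trans mult_1)
      qed
    qed (use fin in auto)
    have "B \<noteq> {}" using False G(1,2) by auto
    then have "blocks (Suc (Suc 0)) (Suc 0) B"
      using B2 by (simp del: schreier.simps)
    then have "blocks (Suc (Suc 0)) (Suc (Suc 0)) G"
      unfolding blocks.simps(2)[of _ "Suc 0"] using A2 A G(1,3) by blast
    then have "blocks (Suc (Suc 0)) 2 G" by (simp only: numeral_2_eq_2)
    moreover have "2 \<le> Min G"
    proof -
      have "G \<noteq> {}" using A G(1) by auto
      then have "Min G \<in> G" using assms(2) by simp
      then show ?thesis using assms(1,3) by fastforce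
    qed
    ultimately show ?thesis unfolding schreier_Suc_Suc_iff by blast
  qed
  then show ?thesis by (simp only: numeral_3_eq_3)
qed

section \<open>Diagonal structure of the norming functionals\<close>

lemma lookup_scaleR:
  "Poly_Mapping.lookup (r *\<^sub>R x) k = r *\<^sub>R Poly_Mapping.lookup x k"
  for x :: "'a \<Rightarrow>\<^sub>0 'b::real_vector"
proof -
  have "{i. r *\<^sub>R Poly_Mapping.lookup x i \<noteq> 0} \<subseteq> Poly_Mapping.keys x"
    by (auto simp: in_keys_iff)
  then show ?thesis
    unfolding scaleR_poly_mapping_def by (simp add: finite_subset lookup_Abs_poly_mapping)
qed

text \<open>
  The functional \<open>f\<close> factors as \<open>c \<cdot> w\<close> with \<open>c\<close> in the ball of \<open>\<ell>\<^sub>2\<close>, and every other \<open>c\<close> in the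
  sphere of \<open>\<ell>\<^sub>2\<close> over the support of \<open>f\<close> again yields a functional of the same kind. Only the
  sphere is allowed because \<open>D_wh\<close> contains \<open>unit_vec k\<close> but not all of its multiples by
  scalars in \<open>[0, 1]\<close>.
\<close>

definition diagonal_family ::
  "((nat \<Rightarrow>\<^sub>0 real) \<Rightarrow> bool) \<Rightarrow> (nat \<Rightarrow>\<^sub>0 real) \<Rightarrow> (nat \<Rightarrow> real) \<Rightarrow> bool" where
  "diagonal_family Q f w \<longleftrightarrow>
     Poly_Mapping.keys f \<subseteq> {1..} \<and>
     (\<forall>k. 0 \<le> w k \<and> w k \<le> 1 \<and> (k \<notin> Poly_Mapping.keys f \<longrightarrow> w k = 0)) \<and>
     (\<exists>c. (\<forall>k. Poly_Mapping.lookup f k = c k * w k) \<and> (\<Sum>k\<in>Poly_Mapping.keys f. (c k)\<^sup>2) \<le> 1) \<and>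
     (\<forall>c. (\<Sum>k\<in>Poly_Mapping.keys f. (c k)\<^sup>2) = 1 \<longrightarrow>
        (\<exists>g. Q g \<and> (\<forall>k. Poly_Mapping.lookup g k = c k * w k)))"

lemma diagonal_family_pos:
  assumes "diagonal_family Q f w"
  shows "k \<in> Poly_Mapping.keys f \<longleftrightarrow> w k \<noteq> 0"
  using assms unfolding diagonal_family_def in_keys_iff by (metis mult_zero_right)

lemma diagonal_family_mono:
  assumes "diagonal_family Q f w" "\<And>g. Q g \<Longrightarrow> Q' g"
  shows "diagonal_family Q' f w"
proof -
  have "(\<exists>g. Q g \<and> P g) \<longrightarrow> (\<exists>g. Q' g \<and> P g)" for P using assms(2) by blast
  then show ?thesis using assms(1) unfolding diagonal_family_def by simp
qed

lemma sum_single_term: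
  assumes "finite A" "i \<in> A" "\<And>j. j \<in> A \<Longrightarrow> j \<noteq> i \<Longrightarrow> F j = 0"
  shows "sum F A = (F i :: 'b::comm_monoid_add)"
proof -
  have "sum F A = F i + sum F (A - {i})" using assms by (simp add: sum.remove)
  also have "sum F (A - {i}) = 0" using assms by (intro sum.neutral) auto
  finally show ?thesis by simp
qed

text \<open>Over a one-point support the sphere consists of the two signs, so both signed unit
  vectors must satisfy \<open>Q\<close>.\<close>

lemma diagonal_family_unit:
  assumes "1 \<le> k" "e = 1 \<or> e = -1" "Q (unit_vec k)" "Q (- unit_vec k)"
  shows "diagonal_family Q (e *\<^sub>R unit_vec k) (\<lambda>i. if i = k then 1 else 0)"
proof -
  have keys: "Poly_Mapping.keys (e *\<^sub>R unit_vec k) = {k}"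
    using assms(2) by (auto simp: in_keys_iff lookup_scaleR lookup_single when_def)
  have "\<exists>g. Q g \<and> (\<forall>i. Poly_Mapping.lookup g i = c i * (if i = k then 1 else 0))"
    if "(\<Sum>i\<in>{k}. (c i)\<^sup>2) = 1" for c :: "nat \<Rightarrow> real"
  proof -
    have "c k = 1 \<or> c k = -1" using that by (simp add: power2_eq_1_iff)
    then show ?thesis
    proof
      assume "c k = 1"
      then show ?thesis
        using assms(3) by (intro exI[of _ "unit_vec k"]) (auto simp: lookup_single when_def)
    next
      assume "c k = -1"
      then show ?thesis
        using assms(4) by (intro exI[of _ "- unit_vec k"]) (auto simp: lookup_single when_def)
    qed
  qed
  moreover have "\<exists>c. (\<forall>i. Poly_Mapping.lookup (e *\<^sub>R unit_vec k) i = c i * (if i = k then 1 else 0)) \<and>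
      (\<Sum>i\<in>{k}. (c i)\<^sup>2) \<le> 1"
    using assms(2)
    by (intro exI[of _ "\<lambda>i. e"]) (auto simp: lookup_scaleR lookup_single when_def)
  ultimately show ?thesis unfolding diagonal_family_def keys using assms(1) by auto
qed

text \<open>The inductive step, common to both averaging rules. A new \<open>c\<close> on the
  support of the average is split into its lengths on the disjoint pieces, which become the new
  coefficients, and its directions, which are realised by new functionals on the pieces. The
  assumption \<open>closed\<close> says that the rule tolerates such replacements.\<close>

lemma diagonal_family_combination:
  fixes M :: real and f :: "nat \<Rightarrow> nat \<Rightarrow>\<^sub>0 real"
  assumes M: "1 \<le> M"
    and disj: "disjoint_family_on (\<lambda>i. Poly_Mapping.keys (f i)) {..<d}"
    and fam: "\<And>i. i < d \<Longrightarrow> diagonal_family (Q i) (f i) (w i)"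
    and lam: "(\<Sum>i<d. (l i)\<^sup>2) \<le> 1"
    and closed: "\<And>g \<mu>. (\<Sum>i<d. (\<mu> i)\<^sup>2) \<le> 1 \<Longrightarrow>
       (\<And>i. i < d \<Longrightarrow> g i = f i \<or> Q i (g i) \<and> Poly_Mapping.keys (g i) \<noteq> {} \<and>
          Poly_Mapping.keys (g i) \<subseteq> Poly_Mapping.keys (f i)) \<Longrightarrow>
       P ((1 / M) *\<^sub>R (\<Sum>i<d. \<mu> i *\<^sub>R g i))"
  shows "\<exists>W. diagonal_family P ((1 / M) *\<^sub>R (\<Sum>i<d. l i *\<^sub>R f i)) W"
proof -
  let ?K = "\<lambda>i. Poly_Mapping.keys (f i)"
  let ?L = "\<lambda>i. Poly_Mapping.lookup (f i)"
  define h where "h = (1 / M) *\<^sub>R (\<Sum>i<d. l i *\<^sub>R f i)"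
  \<comment> \<open>The supports are disjoint, so the sum selects the weight of the piece that
    contains \<open>k\<close>. Pieces with \<open>l i = 0\<close> are left out because they do not
    belong to the support of \<open>h\<close>, off which \<open>W\<close> must vanish.\<close>
  define W where "W = (\<lambda>k. (1 / M) * (\<Sum>i<d. if l i \<noteq> 0 then w i k else 0))"
  have w0: "w i k = 0" if "i < d" "k \<notin> ?K i" for i k
    using fam[OF that(1)] that(2) unfolding diagonal_family_def by blast
  have wr: "0 \<le> w i k \<and> w i k \<le> 1" if "i < d" for i k
    using fam[OF that(1)] unfolding diagonal_family_def by blast
  have other: "k \<notin> ?K j" if "i < d" "j < d" "j \<noteq> i" "k \<in> ?K i" for i j k
    using disj that unfolding disjoint_family_on_def by blast
  have lh: "Poly_Mapping.lookup h k = (1 / M) * (\<Sum>i<d. l i * ?L i k)" for k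
    unfolding h_def by (simp add: lookup_scaleR lookup_sum)
  have single: "(\<Sum>j<d. F j) = F i" if "i < d" "k \<in> ?K i" "\<And>j. j < d \<Longrightarrow> k \<notin> ?K j \<Longrightarrow> F j = 0"
    for F :: "nat \<Rightarrow> real" and i k
    using that other by (intro sum_single_term) auto
  have hK: "Poly_Mapping.lookup h k = l i * ?L i k / M" if "i < d" "k \<in> ?K i" for i k
    using single[OF that, of "\<lambda>i. l i * ?L i k"] unfolding lh by (simp add: in_keys_iff)
  have h0: "Poly_Mapping.lookup h k = 0" if "\<And>i. i < d \<Longrightarrow> k \<notin> ?K i" for k
    using that unfolding lh by (simp add: in_keys_iff)
  have WK: "W k = (if l i \<noteq> 0 then w i k else 0) / M" if "i < d" "k \<in> ?K i" for i k
    using single[OF that, of "\<lambda>i. if l i \<noteq> 0 then w i k else 0"] w0 unfolding W_def by simp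
  have W0: "W k = 0" if "\<And>i. i < d \<Longrightarrow> k \<notin> ?K i" for k
    using that w0 unfolding W_def by (simp add: sum.neutral)
  let ?I = "{i. i < d \<and> l i \<noteq> 0}"
  have keys: "Poly_Mapping.keys h = (\<Union>i\<in>?I. ?K i)"
  proof (rule set_eqI)
    fix k
    show "k \<in> Poly_Mapping.keys h \<longleftrightarrow> k \<in> (\<Union>i\<in>?I. ?K i)"
    proof (cases "\<exists>i<d. k \<in> ?K i")
      case True
      then obtain i where i: "i < d" "k \<in> ?K i" by blast
      then have "k \<in> Poly_Mapping.keys h \<longleftrightarrow> l i \<noteq> 0"
        using hK[OF i] M i(2) by (simp add: in_keys_iff)
      then show ?thesis using i other by blast
    next
      case False
      then show ?thesis using h0[of k] by (auto simp: in_keys_iff)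
    qed
  qed
  have sumkeys: "(\<Sum>k\<in>Poly_Mapping.keys h. F k) = (\<Sum>i\<in>?I. \<Sum>k\<in>?K i. F k)" for F :: "nat \<Rightarrow> real"
    unfolding keys using other by (intro sum.UNION_disjoint) auto
  have pos: "Poly_Mapping.keys h \<subseteq> {1..}"
    using fam unfolding keys diagonal_family_def by blast
  have Wr: "0 \<le> W k \<and> W k \<le> 1 \<and> (k \<notin> Poly_Mapping.keys h \<longrightarrow> W k = 0)" for k
  proof (cases "\<exists>i<d. k \<in> ?K i")
    case True
    then obtain i where i: "i < d" "k \<in> ?K i" by blast
    have "w i k / M \<le> 1" using wr[OF i(1), of k] M by (simp add: divide_le_eq)
    then show ?thesis using WK[OF i] wr[OF i(1), of k] M i unfolding keys by auto
  next
    case False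
    then show ?thesis using W0[of k] by auto
  qed
  have "\<exists>C. (\<forall>k. Poly_Mapping.lookup h k = C k * W k) \<and> (\<Sum>k\<in>Poly_Mapping.keys h. (C k)\<^sup>2) \<le> 1"
  proof -
    have "\<forall>i. \<exists>c. i < d \<longrightarrow> (\<forall>k. ?L i k = c k * w i k) \<and> (\<Sum>k\<in>?K i. (c k)\<^sup>2) \<le> 1"
      using fam unfolding diagonal_family_def by blast
    then obtain c where c: "\<And>i k. i < d \<Longrightarrow> ?L i k = c i k * w i k"
      "\<And>i. i < d \<Longrightarrow> (\<Sum>k\<in>?K i. (c i k)\<^sup>2) \<le> 1" by metis
    define C where "C = (\<lambda>k. \<Sum>i<d. if k \<in> ?K i then l i * c i k else 0)"
    have CK: "C k = l i * c i k" if "i < d" "k \<in> ?K i" for i k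
      using single[OF that, of "\<lambda>i. if k \<in> ?K i then l i * c i k else 0"] that
      unfolding C_def by simp
    have "Poly_Mapping.lookup h k = C k * W k" for k
    proof (cases "\<exists>i<d. k \<in> ?K i")
      case True
      then obtain i where i: "i < d" "k \<in> ?K i" by blast
      then show ?thesis using hK[OF i] CK[OF i] WK[OF i] c(1)[OF i(1)] by auto
    next
      case False
      then show ?thesis using W0[of k] h0[of k] by auto
    qed
    moreover have "(\<Sum>k\<in>Poly_Mapping.keys h. (C k)\<^sup>2) \<le> 1"
    proof -
      have "(\<Sum>k\<in>Poly_Mapping.keys h. (C k)\<^sup>2) = (\<Sum>i\<in>?I. \<Sum>k\<in>?K i. (C k)\<^sup>2)" by (rule sumkeys)
      also have "\<dots> = (\<Sum>i\<in>?I. (l i)\<^sup>2 * (\<Sum>k\<in>?K i. (c i k)\<^sup>2))"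
      proof (rule sum.cong[OF refl])
        fix i assume "i \<in> ?I"
        then have "(\<Sum>k\<in>?K i. (C k)\<^sup>2) = (\<Sum>k\<in>?K i. (l i * c i k)\<^sup>2)"
          by (intro sum.cong) (auto simp: CK)
        then show "(\<Sum>k\<in>?K i. (C k)\<^sup>2) = (l i)\<^sup>2 * (\<Sum>k\<in>?K i. (c i k)\<^sup>2)"
          by (simp add: power_mult_distrib sum_distrib_left)
      qed
      also have "\<dots> \<le> (\<Sum>i\<in>?I. (l i)\<^sup>2 * 1)"
        using c(2) by (intro sum_mono mult_left_mono) auto
      also have "\<dots> \<le> (\<Sum>i<d. (l i)\<^sup>2)" by (simp, intro sum_mono2) auto
      finally show ?thesis using lam by simp
    qed
    ultimately show ?thesis by blast
  qed
  moreover have "\<exists>g. P g \<and> (\<forall>k. Poly_Mapping.lookup g k = c k * W k)"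
    if c1: "(\<Sum>k\<in>Poly_Mapping.keys h. (c k)\<^sup>2) = 1" for c
  proof -
    \<comment> \<open>\<open>\<nu> i\<close> is the length of \<open>c\<close> on piece
      \<open>i\<close>; for \<open>\<nu> i \<noteq> 0\<close>, dividing \<open>c\<close> by it gives
      a point of the sphere over that piece.\<close>
    define \<nu> where "\<nu> = (\<lambda>i. if l i \<noteq> 0 then L2_set c (?K i) else 0)"
    have nu_sum: "(\<Sum>i<d. (\<nu> i)\<^sup>2) = 1"
    proof -
      have "(\<Sum>i<d. (\<nu> i)\<^sup>2) = (\<Sum>i\<in>?I. (\<nu> i)\<^sup>2)"
        by (intro sum.mono_neutral_right) (auto simp: \<nu>_def)
      also have "\<dots> = (\<Sum>i\<in>?I. \<Sum>k\<in>?K i. (c k)\<^sup>2)"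
        by (intro sum.cong refl) (simp add: \<nu>_def L2_set_def sum_nonneg)
      finally show ?thesis using c1 unfolding sumkeys by simp
    qed
    \<comment> \<open>A piece of length 0 has no direction. The old \<open>f i\<close> stays there
      as a placeholder with coefficient 0, which keeps the index set of the average.\<close>
    have "\<exists>g. if \<nu> i = 0 then g = f i
        else Q i g \<and> (\<forall>k. Poly_Mapping.lookup g k = c k / \<nu> i * w i k)" if "i < d" for i
    proof (cases "\<nu> i = 0")
      case False
      then have sphere: "(\<Sum>k\<in>?K i. (c k / \<nu> i)\<^sup>2) = 1"
        unfolding \<nu>_def
        by (auto simp: L2_set_def power_divide sum_nonneg simp flip: sum_divide_distrib split: if_splits)
      have "\<forall>c. (\<Sum>k\<in>?K i. (c k)\<^sup>2) = 1 \<longrightarrow>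
          (\<exists>g. Q i g \<and> (\<forall>k. Poly_Mapping.lookup g k = c k * w i k))"
        using fam[OF that] unfolding diagonal_family_def by blast
      from this[THEN spec, of "\<lambda>k. c k / \<nu> i", THEN mp, OF sphere] show ?thesis using False by simp
    qed auto
    then obtain g where g: "\<And>i. i < d \<Longrightarrow> if \<nu> i = 0 then g i = f i
        else Q i (g i) \<and> (\<forall>k. Poly_Mapping.lookup (g i) k = c k / \<nu> i * w i k)" by metis
    have gi: "g i = f i \<or> Q i (g i) \<and> Poly_Mapping.keys (g i) \<noteq> {} \<and>
          Poly_Mapping.keys (g i) \<subseteq> ?K i" if i: "i < d" for i
    proof (cases "\<nu> i = 0")
      case True
      then show ?thesis using g[OF i] by simp
    next
      case False
      then have gl: "Q i (g i)" "\<And>k. Poly_Mapping.lookup (g i) k = c k / \<nu> i * w i k"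
        using g[OF i] by auto
      have "L2_set c (?K i) \<noteq> 0" using False unfolding \<nu>_def by (auto split: if_splits)
      then obtain k where k: "k \<in> ?K i" "c k \<noteq> 0" by (auto simp: L2_set_eq_0_iff)
      then have "w i k \<noteq> 0" using diagonal_family_pos[OF fam[OF i]] by blast
      then have "k \<in> Poly_Mapping.keys (g i)" using k False by (simp add: in_keys_iff gl)
      moreover have "Poly_Mapping.keys (g i) \<subseteq> ?K i"
        using w0[OF i] by (auto simp: in_keys_iff gl)
      ultimately show ?thesis using gl(1) by blast
    qed
    have "P ((1 / M) *\<^sub>R (\<Sum>i<d. \<nu> i *\<^sub>R g i))"
      using nu_sum gi by (intro closed) auto
    moreover have "Poly_Mapping.lookup ((1 / M) *\<^sub>R (\<Sum>i<d. \<nu> i *\<^sub>R g i)) k = c k * W k" for k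
    proof -
      have "\<nu> i * Poly_Mapping.lookup (g i) k = c k * (if l i \<noteq> 0 then w i k else 0)" if i: "i < d" for i
      proof (cases "\<nu> i = 0")
        case True
        show ?thesis
        proof (cases "l i \<noteq> 0 \<and> k \<in> ?K i")
          case True
          then have "c k = 0"
            using \<open>\<nu> i = 0\<close> unfolding \<nu>_def by (auto simp: L2_set_eq_0_iff split: if_splits)
          then show ?thesis using \<open>\<nu> i = 0\<close> by simp
        next
          case False
          then show ?thesis using \<open>\<nu> i = 0\<close> w0[OF i] by auto
        qed
      next
        case False
        then show ?thesis using g[OF i] by (auto simp: \<nu>_def)
      qed
      then show ?thesis
        unfolding W_def by (simp add: lookup_scaleR lookup_sum sum_distrib_left mult.left_commute)
    qed
    ultimately show ?thesis by blast
  qed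
  ultimately have "diagonal_family P h W" unfolding diagonal_family_def using pos Wr by blast
  then show ?thesis unfolding h_def by blast
qed

section \<open>The norming set: shrinking supports and diagonal form\<close>

context wh_parameters
begin

abbreviation "D \<equiv> in_Dwh m n N1 N2 \<sigma>"
abbreviation "weight \<equiv> has_weight m n N1 N2 \<sigma>"

lemma m_ge_1: "1 \<le> real (m j)"
proof -
  have "m 0 \<le> m j" using m_mono by (simp add: monoD)
  then show ?thesis using m_0 by simp
qed

lemma n_ge_1: "1 \<le> n j"
proof -
  have "n 0 \<le> n j" using n_mono by (simp add: monoD)
  then show ?thesis using n_0 by simp
qed

text \<open>The minima of the smaller sets are sparser than the original minima, so the spreading
  property applies; \<open>n j \<ge> 1\<close> puts the family within its range.\<close>

lemma allowable_subfamily: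
  assumes "allowable (n j) d E"
    and "\<And>i. i < d \<Longrightarrow> E' i \<subseteq> E i \<and> E' i \<noteq> {}"
  shows "allowable (n j) d E'"
proof -
  have fin: "finite (E' i)" "E' i \<subseteq> {1..}" if "i < d" for i
    using assms that unfolding allowable_def by (meson finite_subset subset_trans)+
  have disj: "disjoint_family_on E' {..<d}"
    using assms unfolding allowable_def disjoint_family_on_def by (metis disjoint_iff lessThan_iff subsetD)
  obtain n' where n': "n j = Suc n'" using n_ge_1[of j] by (cases "n j") auto
  have sp: "sparser ((\<lambda>i. Min (E' i)) ` {..<d}) ((\<lambda>i. Min (E i)) ` {..<d})"
    using assms unfolding allowable_def by (intro sparser_Min_subfamily) auto
  have "(\<lambda>i. Min (E' i)) ` {..<d} \<subseteq> {1..}"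
    using fin assms(2) Min_in by blast
  then have "(\<lambda>i. Min (E' i)) ` {..<d} \<in> schreier (n j)"
    unfolding n'
  proof (intro schreier_spreading[OF _ _ _ sp])
    show "(\<lambda>i. Min (E i)) ` {..<d} \<in> schreier (Suc n')"
      using assms(1) unfolding allowable_def n' by blast
  qed simp_all
  then show ?thesis unfolding allowable_def using fin disj assms(2) by blast
qed

text \<open>Simultaneous induction over both predicates. In the even rule the replacements stay in
  \<open>D\<close> and allowability passes to smaller supports. The odd rule prescribes the weight
  of each functional, so its induction hypothesis must produce replacements of the same weight; the
  special sequence \<open>s\<close> itself is left unchanged, since supports need only lie inside
  its sets.\<close>

lemma D_diagonal:
  "D f \<Longrightarrow> \<exists>w. diagonal_family D f w"
  and weight_diagonal:
  "weight f v \<Longrightarrow> \<exists>w. diagonal_family (\<lambda>g. weight g v) f w"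
proof (induction rule: in_Dwh_has_weight.inducts)
  case (unit_pos k)
  then show ?case
    using diagonal_family_unit[OF unit_pos, of 1 D, OF _ in_Dwh_has_weight.unit_pos
        in_Dwh_has_weight.unit_neg] by (simp only: scaleR_one simp_thms) blast
next
  case (unit_neg k)
  then show ?case
    using diagonal_family_unit[OF unit_neg, of "-1" D, OF _ in_Dwh_has_weight.unit_pos
        in_Dwh_has_weight.unit_neg] by (simp only: scaleR_minus1_left simp_thms) blast
next
  case (weighted f v)
  then obtain w where "diagonal_family (\<lambda>g. weight g v) f w" by blast
  then have "diagonal_family D f w"
    by (rule diagonal_family_mono) (rule in_Dwh_has_weight.weighted)
  then show ?case by blast
next
  case (even_weight d f j c)
  have "\<forall>i. \<exists>w. i < d \<longrightarrow> diagonal_family D (f i) w" using even_weight(2) by blast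
  then obtain w where w: "\<And>i. i < d \<Longrightarrow> diagonal_family D (f i) (w i)" by metis
  show ?case
  proof (rule diagonal_family_combination[where Q = "\<lambda>i. D", OF m_ge_1 _ w even_weight(4)])
    show "disjoint_family_on (\<lambda>i. Poly_Mapping.keys (f i)) {..<d}"
      using even_weight(3) unfolding allowable_def by blast
    fix g \<mu>
    assume "(\<Sum>i<d. (\<mu> i)\<^sup>2) \<le> (1::real)"
      and g: "\<And>i. i < d \<Longrightarrow> g i = f i \<or> D (g i) \<and> Poly_Mapping.keys (g i) \<noteq> {} \<and>
          Poly_Mapping.keys (g i) \<subseteq> Poly_Mapping.keys (f i)"
    moreover have "D (g i)" if "i < d" for i using g[OF that] even_weight(1)[OF that] by auto
    moreover have "allowable (n (2 * j)) d (\<lambda>i. Poly_Mapping.keys (g i))"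
      using even_weight(3)
    proof (rule allowable_subfamily)
      fix i assume "i < d"
      then show "Poly_Mapping.keys (g i) \<subseteq> Poly_Mapping.keys (f i) \<and> Poly_Mapping.keys (g i) \<noteq> {}"
        using g even_weight(3) unfolding allowable_def by fastforce
    qed
    ultimately show "weight ((1 / real (m (2 * j))) *\<^sub>R (\<Sum>i<d. \<mu> i *\<^sub>R g i)) (m (2 * j))"
      by (intro in_Dwh_has_weight.even_weight) auto
  qed
next
  case (odd_weight j s f c)
  let ?Q = "\<lambda>i g. weight g (m (2 * snd (s ! i)))"
  define w where "w = (\<lambda>i. SOME w. diagonal_family (?Q i) (f i) w)"
  have w: "diagonal_family (?Q i) (f i) (w i)" if "i < length s" for i
    unfolding w_def by (rule someI_ex[OF odd_weight(5)[OF that]])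
  show ?case
  proof (rule diagonal_family_combination[where Q = ?Q, OF m_ge_1 _ w])
    have disj: "disjoint_family_on (\<lambda>i. fst (s ! i)) {..<length s}"
      using odd_weight(1)
      unfolding schreier_sigma_special_def sigma_special_def Sigma_seqs_def mem_Collect_eq
      by (elim conjE)
    show "disjoint_family_on (\<lambda>i. Poly_Mapping.keys (f i)) {..<length s}"
      unfolding disjoint_family_on_def
    proof (intro ballI impI)
      fix i k assume ik: "i \<in> {..<length s}" "k \<in> {..<length s}" "i \<noteq> k"
      then have "fst (s ! i) \<inter> fst (s ! k) = {}" using disj unfolding disjoint_family_on_def by blast
      then show "Poly_Mapping.keys (f i) \<inter> Poly_Mapping.keys (f k) = {}"
        using odd_weight(6)[of i] odd_weight(6)[of k] ik by blast
    qed
    show "(\<Sum>i<length s. (c i)\<^sup>2) \<le> 1" by (rule odd_weight(7))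
    fix g \<mu>
    assume mu: "(\<Sum>i<length s. (\<mu> i)\<^sup>2) \<le> (1::real)"
      and g: "\<And>i. i < length s \<Longrightarrow> g i = f i \<or> ?Q i (g i) \<and> Poly_Mapping.keys (g i) \<noteq> {} \<and>
          Poly_Mapping.keys (g i) \<subseteq> Poly_Mapping.keys (f i)"
    have gw: "?Q i (g i)" if "i < length s" for i using g[OF that] odd_weight(4)[OF that] by auto
    show "weight ((1 / real (m (2 * j + 1))) *\<^sub>R (\<Sum>i<length s. \<mu> i *\<^sub>R g i)) (m (2 * j + 1))"
    proof (rule in_Dwh_has_weight.odd_weight[OF odd_weight(1) _ _ _ mu])
      fix i assume i: "i < length s"
      show "?Q i (g i)" "D (g i)" using gw[OF i] in_Dwh_has_weight.weighted by auto
      show "Poly_Mapping.keys (g i) \<subseteq> fst (s ! i)" using g[OF i] odd_weight(6)[OF i] by auto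
    qed
  qed
qed

lemma D_even_set:
  assumes "finite I" "\<And>i. i \<in> I \<Longrightarrow> D (f i)"
    and "\<And>i. i \<in> I \<Longrightarrow> Poly_Mapping.keys (f i) \<noteq> {}"
    and "disjoint_family_on (\<lambda>i. Poly_Mapping.keys (f i)) I"
    and "(\<lambda>i. Min (Poly_Mapping.keys (f i))) ` I \<in> schreier (n (2 * j))"
    and "(\<Sum>i\<in>I. (c i)\<^sup>2) \<le> 1"
  shows "D ((1 / real (m (2 * j))) *\<^sub>R (\<Sum>i\<in>I. c i *\<^sub>R f i))"
proof -
  obtain b where b: "bij_betw b {..<card I} I"
    using assms(1) ex_bij_betw_nat_finite by (metis atLeast0LessThan)
  then have bI: "b i \<in> I" if "i < card I" for i using that unfolding bij_betw_def by auto
  have "weight ((1 / real (m (2 * j))) *\<^sub>R (\<Sum>i<card I. c (b i) *\<^sub>R f (b i))) (m (2 * j))"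
  proof (rule in_Dwh_has_weight.even_weight)
    show "(\<Sum>i<card I. (c (b i))\<^sup>2) \<le> 1" 
      using assms(6) sum.reindex_bij_betw[OF b, of "\<lambda>i. (c i)\<^sup>2"] by simp
    show "D (f (b i))" if "i < card I" for i using assms(2) bI that by blast
    have "(\<lambda>i. Min (Poly_Mapping.keys (f (b i)))) ` {..<card I} \<in> schreier (n (2 * j))"
      using assms(5) b unfolding bij_betw_def by (metis image_image)
    moreover have "disjoint_family_on (\<lambda>i. Poly_Mapping.keys (f (b i))) {..<card I}"
      using assms(4) b bI unfolding disjoint_family_on_def bij_betw_def inj_on_def by (metis lessThan_iff)
    moreover have "Poly_Mapping.keys (f i) \<subseteq> {1..}" if "i \<in> I" for i
      using D_diagonal[OF assms(2)[OF that]] unfolding diagonal_family_def by blast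
    ultimately show "allowable (n (2 * j)) (card I) (\<lambda>i. Poly_Mapping.keys (f (b i)))"
      unfolding allowable_def using assms(3) bI by auto
  qed
  then show ?thesis 
    using sum.reindex_bij_betw[OF b, of "\<lambda>i. c i *\<^sub>R f i"] in_Dwh_has_weight.weighted by simp
qed

lemma D_unit: "1 \<le> k \<Longrightarrow> D (unit_vec k)"
  by (rule in_Dwh_has_weight.unit_pos)

lemma D_neg_unit: "1 \<le> k \<Longrightarrow> D (- unit_vec k)"
  by (rule in_Dwh_has_weight.unit_neg)

end

section \<open>The completed space\<close>

lemma c00_closed:
  "x \<in> c00 \<Longrightarrow> y \<in> c00 \<Longrightarrow> x + y \<in> c00" "x \<in> c00 \<Longrightarrow> r *\<^sub>R x \<in> c00" "0 \<in> c00"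
  "x \<in> c00 \<Longrightarrow> y \<in> c00 \<Longrightarrow> x - y \<in> c00" "1 \<le> k \<Longrightarrow> unit_vec k \<in> c00"
  unfolding c00_def by (simp_all add: in_keys_iff lookup_add lookup_scaleR lookup_minus lookup_single)

text \<open>A sum over the support of the functional still makes sense in the completion, where
  vectors may have infinite support.\<close>

lemma pairing_eq_sum_keys:
  "pairing f x = (\<Sum>k\<in>Poly_Mapping.keys f. Poly_Mapping.lookup f k * Poly_Mapping.lookup x k)"
proof -
  let ?F = "\<lambda>k. Poly_Mapping.lookup f k * Poly_Mapping.lookup x k"
  let ?I = "Poly_Mapping.keys f \<inter> Poly_Mapping.keys x"
  have "pairing f x = sum ?F ?I" unfolding pairing_def
    by (intro sum.mono_neutral_right) (auto simp: in_keys_iff)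
  also have "\<dots> = sum ?F (Poly_Mapping.keys f)"
    by (intro sum.mono_neutral_left) (auto simp: in_keys_iff)
  finally show ?thesis .
qed

context wh_parameters
begin

lemma D_lookup_le_1:
  assumes "D f"
  shows "\<bar>Poly_Mapping.lookup f k\<bar> \<le> 1"
proof (cases "k \<in> Poly_Mapping.keys f")
  case True
  obtain w c where w: "0 \<le> w k" "w k \<le> 1" "Poly_Mapping.lookup f k = c k * w k"
    "(\<Sum>k\<in>Poly_Mapping.keys f. (c k)\<^sup>2) \<le> 1"
    using D_diagonal[OF assms] unfolding diagonal_family_def by blast
  have "(c k)\<^sup>2 \<le> (\<Sum>k\<in>Poly_Mapping.keys f. (c k)\<^sup>2)"
    using True by (intro member_le_sum) auto
  then have "\<bar>c k\<bar> \<le> 1" using w(4) abs_square_le_1[of "c k"] by linarith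
  then show ?thesis using w(1-3) by (simp add: abs_mult mult_le_one)
qed (simp add: in_keys_iff)

lemma D_keys_pos: "D f \<Longrightarrow> Poly_Mapping.keys f \<subseteq> {1..}"
  using D_diagonal unfolding diagonal_family_def by blast

lemma pairing_bdd: "bdd_above ((\<lambda>f. pairing f x) ` D_wh m n N1 N2 \<sigma>)"
proof (rule bdd_aboveI2)
  fix f assume "f \<in> D_wh m n N1 N2 \<sigma>"
  then have f: "\<bar>Poly_Mapping.lookup f k\<bar> \<le> 1" for k unfolding D_wh_def using D_lookup_le_1 by blast
  show "pairing f x \<le> (\<Sum>k\<in>Poly_Mapping.keys x. \<bar>Poly_Mapping.lookup x k\<bar>)"
    unfolding pairing_def
  proof (rule sum_mono)
    fix k
    have "Poly_Mapping.lookup f k * Poly_Mapping.lookup x k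
        \<le> \<bar>Poly_Mapping.lookup f k\<bar> * \<bar>Poly_Mapping.lookup x k\<bar>" by (metis abs_ge_self abs_mult)
    also have "\<dots> \<le> 1 * \<bar>Poly_Mapping.lookup x k\<bar>" using f by (intro mult_right_mono) auto
    finally show "Poly_Mapping.lookup f k * Poly_Mapping.lookup x k \<le> \<bar>Poly_Mapping.lookup x k\<bar>" by simp
  qed
qed

lemma pairing_le_wh_norm: "D f \<Longrightarrow> pairing f x \<le> wh_norm m n N1 N2 \<sigma> x"
  unfolding wh_norm_def by (intro cSUP_upper pairing_bdd) (simp add: D_wh_def)

lemma wh_norm_attained_approx:
  assumes "0 < e"
  shows "\<exists>f. D f \<and> wh_norm m n N1 N2 \<sigma> x - e < pairing f x"
proof -
  have "unit_vec 1 \<in> D_wh m n N1 N2 \<sigma>" unfolding D_wh_def using D_unit by simp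
  then have "D_wh m n N1 N2 \<sigma> \<noteq> {}" by blast
  then have "\<exists>f\<in>D_wh m n N1 N2 \<sigma>. wh_norm m n N1 N2 \<sigma> x - e < pairing f x"
    using assms less_cSUP_iff[OF _ pairing_bdd] unfolding wh_norm_def by fastforce
  then show ?thesis unfolding D_wh_def by blast
qed

lemma lookup_le_wh_norm:
  assumes "x \<in> c00"
  shows "\<bar>Poly_Mapping.lookup x k\<bar> \<le> wh_norm m n N1 N2 \<sigma> x"
proof (cases "k = 0")
  case True
  \<comment> \<open>The values of two opposite functionals add up to 0, so the norm is
    nonnegative.\<close>
  have "pairing (unit_vec 1) x \<le> wh_norm m n N1 N2 \<sigma> x"
    "pairing (- unit_vec 1) x \<le> wh_norm m n N1 N2 \<sigma> x"
    using D_unit D_neg_unit pairing_le_wh_norm by simp_all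
  then have "0 \<le> wh_norm m n N1 N2 \<sigma> x" by (simp add: pairing_eq_sum_keys)
  then show ?thesis using True assms by (simp add: c00_def in_keys_iff)
next
  case False
  have "pairing (unit_vec k) x \<le> wh_norm m n N1 N2 \<sigma> x"
    "pairing (- unit_vec k) x \<le> wh_norm m n N1 N2 \<sigma> x"
    using False D_unit D_neg_unit pairing_le_wh_norm by simp_all
  then show ?thesis by (simp add: pairing_eq_sum_keys)
qed

end

locale wh_space = wh_parameters m n N1 N2 \<sigma>
  for m n :: "nat \<Rightarrow> nat" and N1 N2 :: "nat set" and \<sigma> :: "(nat set \<times> nat) list \<Rightarrow> nat" +
  fixes X :: "'a::real_normed_vector set" and \<iota> :: "(nat \<Rightarrow>\<^sub>0 real) \<Rightarrow> 'a"
  assumes is_X: "is_X_wh m n N1 N2 \<sigma> X \<iota>"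
begin

lemma X_subspace: "subspace X" and X_complete: "complete X"
  and \<iota>_in_X: "y \<in> c00 \<Longrightarrow> \<iota> y \<in> X"
  and norm_\<iota>: "y \<in> c00 \<Longrightarrow> norm (\<iota> y) = wh_norm m n N1 N2 \<sigma> y"
  and \<iota>_add: "y \<in> c00 \<Longrightarrow> z \<in> c00 \<Longrightarrow> \<iota> (y + z) = \<iota> y + \<iota> z"
  and \<iota>_scaleR: "y \<in> c00 \<Longrightarrow> \<iota> (r *\<^sub>R y) = r *\<^sub>R \<iota> y"
  and X_dense: "X \<subseteq> closure (\<iota> ` c00)"
  using is_X unfolding is_X_wh_def is_completion_def linear_on_def by auto

lemma \<iota>_diff: "y \<in> c00 \<Longrightarrow> z \<in> c00 \<Longrightarrow> \<iota> (y - z) = \<iota> y - \<iota> z"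
  using \<iota>_add[of y "(-1) *\<^sub>R z"] \<iota>_scaleR[of z "-1"] c00_closed(2)[of z "-1"] by simp

lemma lookup_diff_le:
  assumes "y \<in> c00" "z \<in> c00"
  shows "\<bar>Poly_Mapping.lookup y k - Poly_Mapping.lookup z k\<bar> \<le> norm (\<iota> y - \<iota> z)"
  using lookup_le_wh_norm[OF c00_closed(4)[OF assms], of k] assms
  by (simp add: lookup_minus norm_\<iota>[OF c00_closed(4)] flip: \<iota>_diff)

section \<open>Coordinates on the completion\<close>

text \<open>The completion is an abstract subspace, so coordinates are limits along some
  approximating sequence from \<open>c00\<close>; \<open>coord_limit\<close> shows that the choice
  does not matter.\<close>

definition coord :: "'a \<Rightarrow> nat \<Rightarrow> real" where
  "coord x k = lim (\<lambda>j. Poly_Mapping.lookup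
     ((SOME y. (\<forall>j. y j \<in> c00) \<and> (\<lambda>j. \<iota> (y j)) \<longlonglongrightarrow> x) j) k)"

lemma approx_exists:
  assumes "x \<in> X"
  shows "\<exists>y. (\<forall>j::nat. y j \<in> c00) \<and> (\<lambda>j. \<iota> (y j)) \<longlonglongrightarrow> x"
proof -
  have "x \<in> closure (\<iota> ` c00)" using assms X_dense by blast
  then obtain z where z: "\<And>j::nat. z j \<in> \<iota> ` c00" "z \<longlonglongrightarrow> x"
    unfolding closure_sequential by blast
  have "\<forall>j. \<exists>y. y \<in> c00 \<and> \<iota> y = z j" using z(1) by (metis imageE)
  then obtain y where "\<And>j. y j \<in> c00 \<and> \<iota> (y j) = z j" by metis
  then show ?thesis using z(2) by (intro exI[of _ y]) simp
qed

text \<open>Since \<open>D\<close> contains both signs of every unit vector, each coordinate is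
  1-Lipschitz for the norm. It therefore maps Cauchy sequences to Cauchy sequences and agrees in the
  limit along two approximations of \<open>x\<close>.\<close>

lemma coord_limit:
  assumes "x \<in> X" "\<And>j. y j \<in> c00" "(\<lambda>j. \<iota> (y j)) \<longlonglongrightarrow> x"
  shows "(\<lambda>j. Poly_Mapping.lookup (y j) k) \<longlonglongrightarrow> coord x k"
proof -
  define z :: "nat \<Rightarrow> nat \<Rightarrow>\<^sub>0 real" where "z = (SOME y. (\<forall>j. y j \<in> c00) \<and> (\<lambda>j. \<iota> (y j)) \<longlonglongrightarrow> x)"
  have z: "(\<forall>j. z j \<in> c00) \<and> (\<lambda>j. \<iota> (z j)) \<longlonglongrightarrow> x"
    unfolding z_def by (rule someI_ex[OF approx_exists[OF assms(1)]])
  have "Cauchy (\<lambda>j. Poly_Mapping.lookup (z j) k)"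
  proof (rule CauchyI)
    fix e :: real assume "0 < e"
    have "Cauchy (\<lambda>j. \<iota> (z j))" using z LIMSEQ_imp_Cauchy by blast
    then obtain M where M: "\<forall>i\<ge>M. \<forall>j\<ge>M. norm (\<iota> (z i) - \<iota> (z j)) < e"
      using CauchyD \<open>0 < e\<close> by blast
    have "norm (Poly_Mapping.lookup (z i) k - Poly_Mapping.lookup (z j) k) < e" if "M \<le> i" "M \<le> j" for i j
      using lookup_diff_le[of "z i" "z j" k] z M that by (metis le_less_trans real_norm_def)
    then show "\<exists>M. \<forall>i\<ge>M. \<forall>j\<ge>M. norm (Poly_Mapping.lookup (z i) k - Poly_Mapping.lookup (z j) k) < e"
      by blast
  qed
  then have "(\<lambda>j. Poly_Mapping.lookup (z j) k) \<longlonglongrightarrow> coord x k"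
    unfolding coord_def z_def[symmetric] using Cauchy_convergent convergent_LIMSEQ_iff by blast
  moreover have "(\<lambda>j. Poly_Mapping.lookup (y j) k - Poly_Mapping.lookup (z j) k) \<longlonglongrightarrow> 0"
  proof (rule Lim_null_comparison)
    have "(\<lambda>j. \<iota> (y j) - \<iota> (z j)) \<longlonglongrightarrow> x - x" using assms(3) z by (intro tendsto_diff) auto
    then show "(\<lambda>j. norm (\<iota> (y j) - \<iota> (z j))) \<longlonglongrightarrow> 0" by (simp add: tendsto_norm_zero)
    show "\<forall>\<^sub>F j in sequentially. norm (Poly_Mapping.lookup (y j) k - Poly_Mapping.lookup (z j) k)
        \<le> norm (\<iota> (y j) - \<iota> (z j))"
      using lookup_diff_le assms(2) z by (intro always_eventually) auto
  qed
  ultimately have "(\<lambda>j. (Poly_Mapping.lookup (y j) k - Poly_Mapping.lookup (z j) k)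
      + Poly_Mapping.lookup (z j) k) \<longlonglongrightarrow> 0 + coord x k" by (intro tendsto_add)
  then show ?thesis by simp
qed

lemma coord_\<iota>: "y \<in> c00 \<Longrightarrow> coord (\<iota> y) k = Poly_Mapping.lookup y k"
  using coord_limit[of "\<iota> y" "\<lambda>j. y" k] \<iota>_in_X by (simp add: LIMSEQ_const_iff)

lemma coord_unit: "1 \<le> i \<Longrightarrow> coord (\<iota> (unit_vec i)) k = (if k = i then 1 else 0)"
  by (simp add: coord_\<iota> c00_closed(5) lookup_single when_def)

lemma coord_add:
  assumes "x \<in> X" "y \<in> X"
  shows "coord (x + y) k = coord x k + coord y k"
proof -
  obtain u v where u: "\<And>j. u j \<in> c00" "(\<lambda>j. \<iota> (u j)) \<longlonglongrightarrow> x"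
    and v: "\<And>j. v j \<in> c00" "(\<lambda>j. \<iota> (v j)) \<longlonglongrightarrow> y"
    using approx_exists assms by metis
  have "(\<lambda>j. \<iota> (u j + v j)) \<longlonglongrightarrow> x + y" using tendsto_add[OF u(2) v(2)] u(1) v(1) by (simp add: \<iota>_add)
  then have "(\<lambda>j. Poly_Mapping.lookup (u j + v j) k) \<longlonglongrightarrow> coord (x + y) k"
    using u v assms X_subspace by (intro coord_limit) (auto intro: c00_closed subspace_add)
  moreover have "(\<lambda>j. Poly_Mapping.lookup (u j + v j) k) \<longlonglongrightarrow> coord x k + coord y k"
    unfolding lookup_add using u v assms by (intro tendsto_add coord_limit)
  ultimately show ?thesis by (rule LIMSEQ_unique)
qed

lemma coord_scaleR:
  assumes "x \<in> X"
  shows "coord (r *\<^sub>R x) k = r * coord x k"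
proof -
  obtain u where u: "\<And>j. u j \<in> c00" "(\<lambda>j. \<iota> (u j)) \<longlonglongrightarrow> x"
    using approx_exists assms by metis
  have "(\<lambda>j. \<iota> (r *\<^sub>R u j)) \<longlonglongrightarrow> r *\<^sub>R x"
    using tendsto_scaleR[OF tendsto_const u(2), of r] u(1) by (simp add: \<iota>_scaleR)
  then have "(\<lambda>j. Poly_Mapping.lookup (r *\<^sub>R u j) k) \<longlonglongrightarrow> coord (r *\<^sub>R x) k"
    using u assms X_subspace by (intro coord_limit) (auto intro: c00_closed subspace_scale)
  moreover have "(\<lambda>j. Poly_Mapping.lookup (r *\<^sub>R u j) k) \<longlonglongrightarrow> r * coord x k"
    unfolding lookup_scaleR real_scaleR_def using u assms by (intro tendsto_mult tendsto_const coord_limit)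
  ultimately show ?thesis by (rule LIMSEQ_unique)
qed

lemma coord_zero: "coord 0 k = 0"
  using coord_scaleR[of 0 0 k] X_subspace by (simp add: subspace_0)

lemma coord_diff: "x \<in> X \<Longrightarrow> y \<in> X \<Longrightarrow> coord (x - y) k = coord x k - coord y k"
  using coord_add[of x "(-1) *\<^sub>R y" k] coord_scaleR[of y "-1" k] X_subspace subspace_scale[of X y "-1"]
  by simp

lemma coord_sum:
  assumes "\<And>i. i \<in> I \<Longrightarrow> x i \<in> X"
  shows "(\<Sum>i\<in>I. a i *\<^sub>R x i) \<in> X"
    and "coord (\<Sum>i\<in>I. a i *\<^sub>R x i) k = (\<Sum>i\<in>I. a i * coord (x i) k)"
proof -
  show 1: "(\<Sum>i\<in>I. a i *\<^sub>R x i) \<in> X"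
    using assms X_subspace by (intro subspace_sum subspace_scale) auto
  show "coord (\<Sum>i\<in>I. a i *\<^sub>R x i) k = (\<Sum>i\<in>I. a i * coord (x i) k)"
    using assms
  proof (induction I rule: infinite_finite_induct)
    case (insert i I)
    have "(\<Sum>i\<in>I. a i *\<^sub>R x i) \<in> X" "a i *\<^sub>R x i \<in> X"
      using insert X_subspace by (auto intro!: subspace_sum subspace_scale)
    then show ?case using insert by (simp add: coord_add coord_scaleR)
  qed (auto simp: coord_zero)
qed

lemma coord_0:
  assumes "x \<in> X"
  shows "coord x 0 = 0"
proof -
  obtain u where u: "\<And>j. u j \<in> c00" "(\<lambda>j. \<iota> (u j)) \<longlonglongrightarrow> x"
    using approx_exists assms by metis
  have "(\<lambda>j. Poly_Mapping.lookup (u j) 0) \<longlonglongrightarrow> coord x 0" using u assms by (intro coord_limit)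
  moreover have "Poly_Mapping.lookup (u j) 0 = 0" for j using u(1)[of j] by (simp add: c00_def in_keys_iff)
  ultimately show ?thesis by (simp add: LIMSEQ_const_iff)
qed

section \<open>Action of the norming functionals on the completion\<close>

definition act :: "(nat \<Rightarrow>\<^sub>0 real) \<Rightarrow> 'a \<Rightarrow> real" where
  "act f x = (\<Sum>k\<in>Poly_Mapping.keys f. Poly_Mapping.lookup f k * coord x k)"

lemma act_superset:
  "finite A \<Longrightarrow> Poly_Mapping.keys f \<subseteq> A \<Longrightarrow> act f x = (\<Sum>k\<in>A. Poly_Mapping.lookup f k * coord x k)"
  unfolding act_def by (intro sum.mono_neutral_left) (auto simp: in_keys_iff)

lemma act_diff: "x \<in> X \<Longrightarrow> y \<in> X \<Longrightarrow> act f (x - y) = act f x - act f y"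
  unfolding act_def by (simp add: coord_diff right_diff_distrib sum_subtractf)

lemma act_add: "x \<in> X \<Longrightarrow> y \<in> X \<Longrightarrow> act f (x + y) = act f x + act f y"
  unfolding act_def by (simp add: coord_add distrib_left sum.distrib)

lemma act_scaleR: "x \<in> X \<Longrightarrow> act f (r *\<^sub>R x) = r * act f x"
  unfolding act_def by (simp add: coord_scaleR sum_distrib_left mult.left_commute)

lemma act_sum:
  assumes "\<And>i. i \<in> I \<Longrightarrow> x i \<in> X"
  shows "act f (\<Sum>i\<in>I. a i *\<^sub>R x i) = (\<Sum>i\<in>I. a i * act f (x i))"
proof -
  have "act f (\<Sum>i\<in>I. a i *\<^sub>R x i)
      = (\<Sum>k\<in>Poly_Mapping.keys f. \<Sum>i\<in>I. a i * (Poly_Mapping.lookup f k * coord (x i) k))"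
    unfolding act_def using coord_sum(2)[of I x a] assms
    by (simp add: sum_distrib_left mult.left_commute)
  also have "\<dots> = (\<Sum>i\<in>I. \<Sum>k\<in>Poly_Mapping.keys f. a i * (Poly_Mapping.lookup f k * coord (x i) k))"
    by (rule sum.swap)
  finally show ?thesis unfolding act_def by (simp add: sum_distrib_left)
qed

lemma act_combination: "finite I \<Longrightarrow> act (r *\<^sub>R (\<Sum>i\<in>I. c i *\<^sub>R f i)) x = r * (\<Sum>i\<in>I. c i * act (f i) x)"
proof -
  assume I: "finite I"
  let ?A = "\<Union>i\<in>I. Poly_Mapping.keys (f i)"
  let ?g = "r *\<^sub>R (\<Sum>i\<in>I. c i *\<^sub>R f i)"
  have l: "Poly_Mapping.lookup ?g k = r * (\<Sum>i\<in>I. c i * Poly_Mapping.lookup (f i) k)" for k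
    by (simp add: lookup_scaleR lookup_sum)
  have "Poly_Mapping.keys ?g \<subseteq> ?A"
  proof
    fix k assume "k \<in> Poly_Mapping.keys ?g"
    then have "(\<Sum>i\<in>I. c i * Poly_Mapping.lookup (f i) k) \<noteq> 0" unfolding in_keys_iff l by auto
    then show "k \<in> ?A" by (rule contrapos_np) (auto simp: in_keys_iff intro!: sum.neutral)
  qed
  then have "act ?g x = (\<Sum>k\<in>?A. Poly_Mapping.lookup ?g k * coord x k)"
    using I by (intro act_superset) auto
  also have "\<dots> = r * (\<Sum>k\<in>?A. \<Sum>i\<in>I. c i * (Poly_Mapping.lookup (f i) k * coord x k))"
    unfolding l by (simp add: sum_distrib_left sum_distrib_right mult_ac)
  also have "\<dots> = r * (\<Sum>i\<in>I. \<Sum>k\<in>?A. c i * (Poly_Mapping.lookup (f i) k * coord x k))"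
    by (rule arg_cong[OF sum.swap])
  also have "\<dots> = r * (\<Sum>i\<in>I. c i * (\<Sum>k\<in>?A. Poly_Mapping.lookup (f i) k * coord x k))"
    by (simp add: sum_distrib_left)
  also have "\<dots> = r * (\<Sum>i\<in>I. c i * act (f i) x)"
  proof -
    have "act (f i) x = (\<Sum>k\<in>?A. Poly_Mapping.lookup (f i) k * coord x k)" if "i \<in> I" for i
      using I that by (intro act_superset) auto
    then show ?thesis by simp
  qed
  finally show ?thesis .
qed

lemma act_le_norm:
  assumes "D f" "x \<in> X"
  shows "act f x \<le> norm x"
proof -
  obtain u where u: "\<And>j. u j \<in> c00" "(\<lambda>j. \<iota> (u j)) \<longlonglongrightarrow> x"
    using approx_exists assms by metis
  have "(\<lambda>j. pairing f (u j)) \<longlonglongrightarrow> act f x"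
    unfolding pairing_eq_sum_keys act_def
    using u assms(2) by (intro tendsto_sum tendsto_mult tendsto_const coord_limit)
  moreover have "(\<lambda>j. norm (\<iota> (u j))) \<longlonglongrightarrow> norm x" using u(2) by (rule tendsto_norm)
  moreover have "pairing f (u j) \<le> norm (\<iota> (u j))" for j
    using pairing_le_wh_norm[OF assms(1)] norm_\<iota> u(1) by simp
  ultimately show ?thesis by (intro LIMSEQ_le) auto
qed

lemma abs_act_le_norm: "D f \<Longrightarrow> x \<in> X \<Longrightarrow> \<bar>act f x\<bar> \<le> norm x"
  using act_le_norm[of f x] act_le_norm[of f "(-1) *\<^sub>R x"] act_scaleR[of x f "-1"] X_subspace
    subspace_scale[of X x "-1"] by auto

lemma act_norming:
  assumes "x \<in> X" "0 < e"
  shows "\<exists>f. D f \<and> norm x - e < act f x"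
proof -
  obtain y where y: "y \<in> c00" "dist (\<iota> y) x < e / 3"
  proof -
    have "x \<in> closure (\<iota> ` c00)" using assms X_dense by blast
    then obtain z where "z \<in> \<iota> ` c00" "dist z x < e / 3"
      unfolding closure_approachable using assms(2) by (metis zero_less_divide_iff zero_less_numeral)
    then show ?thesis using that by blast
  qed
  obtain f where f: "D f" "wh_norm m n N1 N2 \<sigma> y - e / 3 < pairing f y"
    using wh_norm_attained_approx[of "e / 3"] assms(2) by auto
  have "pairing f y = act f (\<iota> y)" unfolding act_def pairing_eq_sum_keys using y(1) by (simp add: coord_\<iota>)
  moreover have "\<bar>act f (\<iota> y - x)\<bar> \<le> norm (\<iota> y - x)"
    using y(1) assms(1) X_subspace by (intro abs_act_le_norm f subspace_diff \<iota>_in_X)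
  moreover have "norm x \<le> norm (\<iota> y) + norm (\<iota> y - x)" by norm
  ultimately have "norm x - e < act f x"
    using f(2) y assms(1) by (simp add: norm_\<iota> act_diff \<iota>_in_X dist_norm)
  then show ?thesis using f(1) by blast
qed

text \<open>The choice of \<open>c\<close> proportional to \<open>w * coord x\<close> is the
  equality case of Cauchy-Schwarz and yields a member of \<open>D\<close>. Together with
  \<open>act_le_L2\<close> this expresses the norm as a supremum of weighted \<open>l_2\<close>
  seminorms.\<close>

lemma diagonal_L2_le_norm:
  assumes "diagonal_family D f w" "x \<in> X"
  shows "L2_set (\<lambda>k. w k * coord x k) (Poly_Mapping.keys f) \<le> norm x"
proof (cases "L2_set (\<lambda>k. w k * coord x k) (Poly_Mapping.keys f) = 0")
  case False
  let ?K = "Poly_Mapping.keys f"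
  define L where "L = L2_set (\<lambda>k. w k * coord x k) ?K"
  define c where "c = (\<lambda>k. w k * coord x k / L)"
  have L2: "L\<^sup>2 = (\<Sum>k\<in>?K. (w k * coord x k)\<^sup>2)" unfolding L_def L2_set_def by (simp add: sum_nonneg)
  have L0: "L \<noteq> 0" using False unfolding L_def .
  have "(\<Sum>k\<in>?K. (c k)\<^sup>2) = 1"
    unfolding c_def power_divide sum_divide_distrib[symmetric] L2[symmetric] using L0 by simp
  then obtain g where g: "D g" "\<And>k. Poly_Mapping.lookup g k = c k * w k"
    using assms(1) unfolding diagonal_family_def by blast
  have "Poly_Mapping.keys g \<subseteq> ?K"
    using assms(1) unfolding diagonal_family_def by (auto simp: in_keys_iff g(2))
  then have "act g x = (\<Sum>k\<in>?K. Poly_Mapping.lookup g k * coord x k)" by (intro act_superset) auto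
  also have "\<dots> = (\<Sum>k\<in>?K. (w k * coord x k)\<^sup>2) / L"
    unfolding g(2) c_def by (simp add: power2_eq_square sum_divide_distrib mult_ac)
  also have "\<dots> = L" unfolding L2[symmetric] using L0 by (simp add: power2_eq_square)
  finally show ?thesis using act_le_norm[OF g(1) assms(2)] unfolding L_def by simp
qed simp

lemma norm_le_if_act_le:
  assumes "x \<in> X" "\<And>f. D f \<Longrightarrow> act f x \<le> B"
  shows "norm x \<le> B"
proof (rule field_le_epsilon)
  fix e :: real assume "0 < e"
  then obtain f where "D f" "norm x - e < act f x" using act_norming assms(1) by blast
  then show "norm x \<le> B + e" using assms(2)[of f] by linarith
qed

lemma act_le_L2:
  assumes "diagonal_family D f w"
  shows "act f x \<le> L2_set (\<lambda>k. w k * coord x k) (Poly_Mapping.keys f)"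
proof -
  let ?K = "Poly_Mapping.keys f"
  obtain c where c: "\<And>k. Poly_Mapping.lookup f k = c k * w k" "(\<Sum>k\<in>?K. (c k)\<^sup>2) \<le> 1"
    using assms unfolding diagonal_family_def by blast
  have "act f x \<le> (\<Sum>k\<in>?K. \<bar>c k\<bar> * \<bar>w k * coord x k\<bar>)"
    unfolding act_def c(1) by (intro sum_mono) (metis abs_ge_self abs_mult mult.assoc)
  also have "\<dots> \<le> L2_set c ?K * L2_set (\<lambda>k. w k * coord x k) ?K" by (rule L2_set_mult_ineq)
  also have "\<dots> \<le> 1 * L2_set (\<lambda>k. w k * coord x k) ?K"
    using c(2) by (intro mult_right_mono L2_set_nonneg) (simp add: L2_set_def)
  finally show ?thesis by simp
qed

section \<open>The unit vectors as a Schauder basis\<close>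

lemma coord_partial_sum:
  assumes "finite A" "A \<subseteq> {1..}"
  shows "coord (\<Sum>i\<in>A. a i *\<^sub>R \<iota> (unit_vec i)) k = (if k \<in> A then a k else 0)"
    and "(\<Sum>i\<in>A. a i *\<^sub>R \<iota> (unit_vec i)) \<in> X"
proof -
  have iX: "\<iota> (unit_vec i) \<in> X" if "i \<in> A" for i
    using that assms(2) by (intro \<iota>_in_X c00_closed) auto
  show "(\<Sum>i\<in>A. a i *\<^sub>R \<iota> (unit_vec i)) \<in> X" using iX by (rule coord_sum(1))
  have "coord (\<Sum>i\<in>A. a i *\<^sub>R \<iota> (unit_vec i)) k = (\<Sum>i\<in>A. a i * coord (\<iota> (unit_vec i)) k)"
    using iX by (rule coord_sum(2))
  also have "\<dots> = (\<Sum>i\<in>A. if k = i then a i else 0)"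
    using assms(2) by (intro sum.cong refl) (auto simp: coord_unit subset_iff)
  also have "\<dots> = (if k \<in> A then a k else 0)" using assms(1) by (simp add: sum.delta)
  finally show "coord (\<Sum>i\<in>A. a i *\<^sub>R \<iota> (unit_vec i)) k = (if k \<in> A then a k else 0)" .
qed

text \<open>Weighted \<open>l_2\<close> seminorms decrease when coordinates are deleted, so all
  coordinate projections are contractions.\<close>

lemma norm_partial_sum_le:
  assumes "finite A" "A \<subseteq> {1..}" "x \<in> X"
  shows "norm (\<Sum>i\<in>A. coord x i *\<^sub>R \<iota> (unit_vec i)) \<le> norm x"
proof (rule norm_le_if_act_le)
  let ?p = "\<Sum>i\<in>A. coord x i *\<^sub>R \<iota> (unit_vec i)"
  show "?p \<in> X" using assms(1,2) by (rule coord_partial_sum)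
  fix f assume "D f"
  then obtain w where w: "diagonal_family D f w" using D_diagonal by blast
  have "act f ?p \<le> L2_set (\<lambda>k. w k * coord ?p k) (Poly_Mapping.keys f)" using w by (rule act_le_L2)
  also have "\<dots> \<le> L2_set (\<lambda>k. w k * coord x k) (Poly_Mapping.keys f)"
    unfolding L2_set_def coord_partial_sum(1)[OF assms(1,2)]
    by (intro real_sqrt_le_mono sum_mono) auto
  also have "\<dots> \<le> norm x" using w assms(3) by (rule diagonal_L2_le_norm)
  finally show "act f ?p \<le> norm x" .
qed

lemma \<iota>_expansion:
  assumes "y \<in> c00" "finite A" "A \<subseteq> {1..}" "Poly_Mapping.keys y \<subseteq> A"
  shows "\<iota> y = (\<Sum>i\<in>A. Poly_Mapping.lookup y i *\<^sub>R \<iota> (unit_vec i))"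
proof -
  have \<iota>0: "\<iota> 0 = 0" using \<iota>_scaleR[of 0 0] c00_closed(3) by simp
  have "(\<Sum>i\<in>A. c i *\<^sub>R unit_vec i) \<in> c00 \<and>
      \<iota> (\<Sum>i\<in>A. c i *\<^sub>R unit_vec i) = (\<Sum>i\<in>A. c i *\<^sub>R \<iota> (unit_vec i))" for c
    using assms(2,3)
  proof (induction A rule: finite_induct)
    case (insert i A)
    then have "c i *\<^sub>R unit_vec i \<in> c00" "unit_vec i \<in> c00" by (auto intro!: c00_closed)
    then show ?case using insert by (auto simp: \<iota>_add \<iota>_scaleR intro!: c00_closed)
  qed (simp add: \<iota>0 c00_closed(3))
  moreover have "y = (\<Sum>i\<in>A. Poly_Mapping.lookup y i *\<^sub>R unit_vec i)"
  proof (rule poly_mapping_eqI)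
    fix k
    have "Poly_Mapping.lookup (\<Sum>i\<in>A. Poly_Mapping.lookup y i *\<^sub>R unit_vec i) k
        = (\<Sum>i\<in>A. if k = i then Poly_Mapping.lookup y i else 0)"
      unfolding lookup_sum lookup_scaleR by (intro sum.cong refl) (auto simp: lookup_single when_def)
    then show "Poly_Mapping.lookup y k
        = Poly_Mapping.lookup (\<Sum>i\<in>A. Poly_Mapping.lookup y i *\<^sub>R unit_vec i) k"
      using assms(2,4) by (auto simp: sum.delta in_keys_iff)
  qed
  ultimately show ?thesis by metis
qed

lemma abs_coord_le_norm:
  assumes "x \<in> X"
  shows "\<bar>coord x k\<bar> \<le> norm x"
proof (cases "k = 0")
  case False
  then have "\<bar>act (unit_vec k) x\<bar> \<le> norm x" using assms D_unit by (intro abs_act_le_norm) auto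
  then show ?thesis by (simp add: act_def)
qed (simp add: coord_0 assms)

text \<open>A vector of \<open>c00\<close> equals its partial sums from some index on. As partial
  sums are contractions, approximation by such a vector carries this over to \<open>x\<close> in the
  limit.\<close>

lemma coord_expansion:
  assumes "x \<in> X"
  shows "basis_expansion (\<lambda>i. \<iota> (unit_vec i)) x (coord x)"
  unfolding basis_expansion_def
proof
  show "coord x 0 = 0" using assms by (rule coord_0)
  show "(\<lambda>N. \<Sum>i=1..N. coord x i *\<^sub>R \<iota> (unit_vec i)) \<longlonglongrightarrow> x"
  proof (rule LIMSEQ_I)
    fix e :: real assume "0 < e"
    have "x \<in> closure (\<iota> ` c00)" using assms X_dense by blast
    then obtain z where "z \<in> \<iota> ` c00" "dist z x < e / 2"
      unfolding closure_approachable using \<open>0 < e\<close> by (metis zero_less_divide_iff zero_less_numeral)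
    then obtain y where y: "y \<in> c00" "norm (\<iota> y - x) < e / 2" by (auto simp: dist_norm)
    have yX: "\<iota> y \<in> X" using y(1) by (rule \<iota>_in_X)
    have "norm ((\<Sum>i=1..N. coord x i *\<^sub>R \<iota> (unit_vec i)) - x) < e"
      if N: "Max (insert 0 (Poly_Mapping.keys y)) \<le> N" for N
    proof -
      have "Poly_Mapping.keys y \<subseteq> {1..N}"
      proof
        fix k assume k: "k \<in> Poly_Mapping.keys y"
        then have "k \<le> Max (insert 0 (Poly_Mapping.keys y))" by (intro Max_ge) auto
        moreover have "k \<noteq> 0" 
        proof
          assume "k = 0"
          then show False using k y(1) by (simp add: c00_def)
        qed
        ultimately show "k \<in> {1..N}" using order_trans[OF _ N] by simp
      qed
      then have "(\<Sum>i=1..N. Poly_Mapping.lookup y i *\<^sub>R \<iota> (unit_vec i)) = \<iota> y"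
        by (intro \<iota>_expansion[OF y(1), symmetric]) auto
      then have y_eq: "(\<Sum>i=1..N. coord (\<iota> y) i *\<^sub>R \<iota> (unit_vec i)) = \<iota> y"
        using y(1) by (simp only: coord_\<iota>)
      have "(\<Sum>i=1..N. coord x i *\<^sub>R \<iota> (unit_vec i)) - \<iota> y
          = (\<Sum>i=1..N. coord x i *\<^sub>R \<iota> (unit_vec i)) - (\<Sum>i=1..N. coord (\<iota> y) i *\<^sub>R \<iota> (unit_vec i))"
        unfolding y_eq ..
      also have "\<dots> = (\<Sum>i=1..N. coord (x - \<iota> y) i *\<^sub>R \<iota> (unit_vec i))"
        by (simp add: coord_diff assms yX scaleR_diff_left sum_subtractf)
      finally have "norm ((\<Sum>i=1..N. coord x i *\<^sub>R \<iota> (unit_vec i)) - \<iota> y) \<le> norm (x - \<iota> y)"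
        using norm_partial_sum_le[of "{1..N}" "x - \<iota> y"] assms yX X_subspace by (simp add: subspace_diff)
      moreover have "(\<Sum>i=1..N. coord x i *\<^sub>R \<iota> (unit_vec i)) - x
          = ((\<Sum>i=1..N. coord x i *\<^sub>R \<iota> (unit_vec i)) - \<iota> y) + (\<iota> y - x)" by simp
      ultimately show ?thesis
        using y(2) norm_triangle_ineq[of "(\<Sum>i=1..N. coord x i *\<^sub>R \<iota> (unit_vec i)) - \<iota> y" "\<iota> y - x"]
        by (simp add: norm_minus_commute)
    qed
    then show "\<exists>M. \<forall>N\<ge>M. norm ((\<Sum>i=1..N. coord x i *\<^sub>R \<iota> (unit_vec i)) - x) < e" by blast
  qed
qed

text \<open>Coordinate \<open>k\<close> of every partial sum of length at least \<open>k\<close> is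
  \<open>a k\<close>, and coordinates are dominated by the norm.\<close>

lemma basis_expansion_unique:
  assumes "x \<in> X" "basis_expansion (\<lambda>i. \<iota> (unit_vec i)) x a"
  shows "a = coord x"
proof
  fix k
  show "a k = coord x k"
  proof (cases "k = 0")
    case True
    then show ?thesis using assms coord_0 unfolding basis_expansion_def by simp
  next
    case False
    let ?S = "\<lambda>N. \<Sum>i=1..N. a i *\<^sub>R \<iota> (unit_vec i)"
    have "(\<lambda>N. x - ?S N) \<longlonglongrightarrow> x - x"
      using assms(2) unfolding basis_expansion_def by (intro tendsto_diff) auto
    then have lim: "(\<lambda>N. norm (x - ?S N)) \<longlonglongrightarrow> 0" by (simp add: tendsto_norm_zero)
    have "\<bar>coord x k - a k\<bar> \<le> norm (x - ?S N)" if "k \<le> N" for N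
    proof -
      have S: "?S N \<in> X" "coord (?S N) k = a k"
        using coord_partial_sum[of "{1..N}" a] that False by auto
      show ?thesis
        using abs_coord_le_norm[of "x - ?S N" k] S assms(1) X_subspace by (simp add: coord_diff subspace_diff)
    qed
    then have "\<bar>coord x k - a k\<bar> \<le> 0" using lim by (intro LIMSEQ_le_const[OF lim]) blast
    then show ?thesis by simp
  qed
qed

lemma schauder_basis_unit_vectors: "schauder_basis X (\<lambda>i. \<iota> (unit_vec i))"
  unfolding schauder_basis_def
proof (intro conjI ballI allI impI)
  show "\<iota> (unit_vec i) \<in> X" if "1 \<le> i" for i using that by (intro \<iota>_in_X c00_closed(5))
  show "\<exists>!a. basis_expansion (\<lambda>i. \<iota> (unit_vec i)) x a" if "x \<in> X" for x
    using coord_expansion[OF that] basis_expansion_unique[OF that] by (rule ex1I)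
qed

lemma basis_supp_eq:
  assumes "x \<in> X"
  shows "basis_supp (\<lambda>i. \<iota> (unit_vec i)) x = {i. coord x i \<noteq> 0}"
proof -
  have "(THE a. basis_expansion (\<lambda>i. \<iota> (unit_vec i)) x a) = coord x"
    using coord_expansion[OF assms] basis_expansion_unique[OF assms] by (rule the_equality)
  then show ?thesis
    unfolding basis_supp_def using coord_0[OF assms] by (auto simp: Suc_le_eq) (metis not_gr0)
qed

section \<open>Estimates for disjointly supported vectors\<close>

text \<open>Only points of the sphere are known to give functionals, so the coefficients restricted
  to \<open>A\<close> are divided by their length \<open>L\<close>. As \<open>L \<le> 1\<close> and
  the value at \<open>x\<close> is positive, this does not decrease the value; positivity also
  excludes \<open>L = 0\<close>.\<close>

lemma act_restrict:
  assumes "D f" "x \<in> X" "0 < act f x" "{k. coord x k \<noteq> 0} \<subseteq> A"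
  obtains g where "D g" "Poly_Mapping.keys g \<subseteq> A" "act f x \<le> act g x"
proof -
  let ?K = "Poly_Mapping.keys f"
  obtain w where w: "diagonal_family D f w" using D_diagonal assms(1) by blast
  then obtain c where c: "\<And>k. Poly_Mapping.lookup f k = c k * w k" "(\<Sum>k\<in>?K. (c k)\<^sup>2) \<le> 1"
    unfolding diagonal_family_def by blast
  define L where "L = L2_set c (?K \<inter> A)"
  have L2: "L\<^sup>2 = (\<Sum>k\<in>?K \<inter> A. (c k)\<^sup>2)" unfolding L_def L2_set_def by (simp add: sum_nonneg)
  have "L \<noteq> 0"
  proof
    assume "L = 0"
    then have "\<forall>k\<in>?K \<inter> A. c k = 0" unfolding L_def by (simp add: L2_set_eq_0_iff)
    then have "act f x = 0" unfolding act_def using assms(4) by (intro sum.neutral) (auto simp: c(1))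
    then show False using assms(3) by simp
  qed
  then have Lpos: "0 < L" unfolding L_def using L2_set_nonneg by (metis less_le)
  have "L\<^sup>2 \<le> (\<Sum>k\<in>?K. (c k)\<^sup>2)" unfolding L2 by (intro sum_mono2) auto
  then have "L \<le> 1" using c(2) Lpos by (metis abs_of_pos abs_square_le_1 order_trans)
  define c' where "c' = (\<lambda>k. if k \<in> A then c k / L else 0)"
  have "(\<Sum>k\<in>?K. (c' k)\<^sup>2) = (\<Sum>k\<in>?K \<inter> A. (c k / L)\<^sup>2)"
    unfolding c'_def by (intro sum.mono_neutral_cong_right) auto
  also have "\<dots> = 1"
    unfolding power_divide sum_divide_distrib[symmetric] L2[symmetric] using Lpos by simp
  finally obtain g where g: "D g" "\<And>k. Poly_Mapping.lookup g k = c' k * w k"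
    using w unfolding diagonal_family_def by blast
  have gK: "Poly_Mapping.keys g \<subseteq> ?K"
    using w unfolding diagonal_family_def by (auto simp: in_keys_iff g(2))
  have gA: "Poly_Mapping.keys g \<subseteq> A" by (auto simp: in_keys_iff g(2) c'_def split: if_splits)
  have "act g x = (\<Sum>k\<in>?K. Poly_Mapping.lookup g k * coord x k)" using gK by (intro act_superset) auto
  also have "\<dots> = (\<Sum>k\<in>?K. Poly_Mapping.lookup f k * coord x k / L)"
    using assms(4) by (intro sum.cong refl) (auto simp: g(2) c(1) c'_def)
  also have "\<dots> = act f x / L" unfolding act_def by (simp add: sum_divide_distrib)
  finally have "act g x = act f x / L" .
  moreover have "act f x \<le> act f x / L"
    using \<open>L \<le> 1\<close> Lpos assms(3) by (simp add: le_divide_eq mult_left_le)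
  ultimately show thesis using that[OF g(1) gA] by simp
qed

text \<open>The coefficients \<open>c\<close> of a functional split over the disjoint supports into
  lengths \<open>\<nu> i\<close> with square sum at most 1. Cauchy-Schwarz on each support gives
  \<open>\<bar>act f (x i)\<bar> \<le> \<nu> i\<close>, because the weighted norm of
  \<open>x i\<close> is at most 1; a second Cauchy-Schwarz over \<open>I\<close> finishes.\<close>

lemma upper_l2_estimate:
  assumes x: "\<And>i. i \<in> I \<Longrightarrow> x i \<in> X \<and> norm (x i) \<le> 1" and I: "finite I"
    and disj: "disjoint_family_on (\<lambda>i. {k. coord (x i) k \<noteq> 0}) I"
  shows "norm (\<Sum>i\<in>I. a i *\<^sub>R x i) \<le> L2_set a I"
proof (rule norm_le_if_act_le)
  show "(\<Sum>i\<in>I. a i *\<^sub>R x i) \<in> X" using x by (intro coord_sum(1)) auto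
  fix f assume "D f"
  then obtain w where w: "diagonal_family D f w" using D_diagonal by blast
  let ?K = "Poly_Mapping.keys f"
  obtain c where c: "\<And>k. Poly_Mapping.lookup f k = c k * w k" "(\<Sum>k\<in>?K. (c k)\<^sup>2) \<le> 1"
    using w unfolding diagonal_family_def by blast
  let ?S = "\<lambda>i. ?K \<inter> {k. coord (x i) k \<noteq> 0}"
  define \<nu> where "\<nu> = (\<lambda>i. L2_set c (?S i))"
  have nu: "\<bar>act f (x i)\<bar> \<le> \<nu> i" if i: "i \<in> I" for i
  proof -
    have "act f (x i) = (\<Sum>k\<in>?S i. Poly_Mapping.lookup f k * coord (x i) k)"
      unfolding act_def by (intro sum.mono_neutral_right) auto
    also have "\<bar>\<dots>\<bar> \<le> (\<Sum>k\<in>?S i. \<bar>c k\<bar> * \<bar>w k * coord (x i) k\<bar>)"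
      unfolding c(1) by (rule order_trans[OF sum_abs]) (simp add: abs_mult mult.assoc)
    also have "\<dots> \<le> \<nu> i * L2_set (\<lambda>k. w k * coord (x i) k) (?S i)"
      unfolding \<nu>_def by (rule L2_set_mult_ineq)
    also have "L2_set (\<lambda>k. w k * coord (x i) k) (?S i) \<le> L2_set (\<lambda>k. w k * coord (x i) k) ?K"
      unfolding L2_set_def by (intro real_sqrt_le_mono sum_mono2) auto
    also have "\<dots> \<le> 1" using diagonal_L2_le_norm[OF w] x[OF i] order_trans by blast
    finally show ?thesis unfolding \<nu>_def by (simp add: mult_left_mono)
  qed
  have "(\<Sum>i\<in>I. (\<nu> i)\<^sup>2) = (\<Sum>i\<in>I. \<Sum>k\<in>?S i. (c k)\<^sup>2)"
    unfolding \<nu>_def L2_set_def by (simp add: sum_nonneg)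
  also have "\<dots> = (\<Sum>k\<in>(\<Union>i\<in>I. ?S i). (c k)\<^sup>2)"
    using I disj unfolding disjoint_family_on_def by (intro sum.UNION_disjoint[symmetric]) auto
  also have "\<dots> \<le> (\<Sum>k\<in>?K. (c k)\<^sup>2)" by (intro sum_mono2) auto
  finally have "(\<Sum>i\<in>I. (\<nu> i)\<^sup>2) \<le> 1" using c(2) by simp
  then have L1: "L2_set \<nu> I \<le> 1" by (simp add: L2_set_def)
  have "act f (\<Sum>i\<in>I. a i *\<^sub>R x i) = (\<Sum>i\<in>I. a i * act f (x i))" using x by (intro act_sum) auto
  also have "\<dots> \<le> (\<Sum>i\<in>I. \<bar>a i\<bar> * \<bar>\<nu> i\<bar>)"
  proof (rule sum_mono)
    fix i assume "i \<in> I"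
    then have "\<bar>a i\<bar> * \<bar>act f (x i)\<bar> \<le> \<bar>a i\<bar> * \<bar>\<nu> i\<bar>" using nu[of i] by (intro mult_left_mono) auto
    then show "a i * act f (x i) \<le> \<bar>a i\<bar> * \<bar>\<nu> i\<bar>" by (metis abs_ge_self abs_mult order_trans)
  qed
  also have "\<dots> \<le> L2_set a I * L2_set \<nu> I" by (rule L2_set_mult_ineq)
  also have "\<dots> \<le> L2_set a I" using L1 by (simp add: mult_left_le)
  finally show "act f (\<Sum>i\<in>I. a i *\<^sub>R x i) \<le> L2_set a I" .
qed

text \<open>Each \<open>x i\<close> is normed up to 1/2 by a functional living on its own support.
  The supports start at \<open>card I\<close> or later, so the minima form an \<open>S_1\<close> set
  and the rule with \<open>j = 0\<close> applies with coefficients \<open>a i / L\<close>. The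
  constant 1/4 is 1/2 from norming times \<open>1 / m 0 = 1/2\<close>.\<close>

lemma lower_l2_estimate:
  assumes x: "\<And>i. i \<in> I \<Longrightarrow> x i \<in> X \<and> norm (x i) = 1" and I: "finite I"
    and supp: "\<And>i k. i \<in> I \<Longrightarrow> coord (x i) k \<noteq> 0 \<Longrightarrow> card I \<le> k"
    and disj: "disjoint_family_on (\<lambda>i. {k. coord (x i) k \<noteq> 0}) I"
  shows "(1 / 4) * L2_set a I \<le> norm (\<Sum>i\<in>I. a i *\<^sub>R x i)"
proof (cases "L2_set a I = 0")
  case False
  let ?S = "\<lambda>i. {k. coord (x i) k \<noteq> 0}"
  define L where "L = L2_set a I"
  have Lpos: "0 < L" using False unfolding L_def by (metis L2_set_nonneg less_le)
  have L2: "L\<^sup>2 = (\<Sum>i\<in>I. (a i)\<^sup>2)" unfolding L_def L2_set_def by (simp add: sum_nonneg)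
  have "\<exists>g. D g \<and> Poly_Mapping.keys g \<subseteq> ?S i \<and> 1 / 2 \<le> act g (x i)" if i: "i \<in> I" for i
  proof -
    obtain f where f: "D f" "1 / 2 < act f (x i)" using act_norming[of "x i" "1/2"] x[OF i] by auto
    then obtain g where "D g" "Poly_Mapping.keys g \<subseteq> ?S i" "act f (x i) \<le> act g (x i)"
      using act_restrict[of f "x i" "?S i"] x[OF i] by auto
    then show ?thesis using f(2) by (intro exI[of _ g]) auto
  qed
  then obtain g where g: "\<And>i. i \<in> I \<Longrightarrow> D (g i)" "\<And>i. i \<in> I \<Longrightarrow> Poly_Mapping.keys (g i) \<subseteq> ?S i"
    "\<And>i. i \<in> I \<Longrightarrow> 1 / 2 \<le> act (g i) (x i)" by metis
  have gne: "Poly_Mapping.keys (g i) \<noteq> {}" if "i \<in> I" for i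
    using g(3)[OF that] unfolding act_def by auto
  have gMin: "card I \<le> Min (Poly_Mapping.keys (g i)) \<and> 1 \<le> Min (Poly_Mapping.keys (g i))" if "i \<in> I" for i
  proof -
    have "Min (Poly_Mapping.keys (g i)) \<in> Poly_Mapping.keys (g i)" using gne[OF that] by simp
    then show ?thesis using g(2)[OF that] supp[OF that] D_keys_pos[OF g(1)[OF that]] by auto
  qed
  define h where "h = (1 / real (m (2 * 0))) *\<^sub>R (\<Sum>i\<in>I. (a i / L) *\<^sub>R g i)"
  have "D h" unfolding h_def
  proof (rule D_even_set[OF I g(1) gne])
    show "disjoint_family_on (\<lambda>i. Poly_Mapping.keys (g i)) I"
      using disj g(2) unfolding disjoint_family_on_def by fast
    have "card ((\<lambda>i. Min (Poly_Mapping.keys (g i))) ` I) \<le> card I" using I by (rule card_image_le)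
    then have "card ((\<lambda>i. Min (Poly_Mapping.keys (g i))) ` I)
        \<le> Min ((\<lambda>i. Min (Poly_Mapping.keys (g i))) ` I)" if "I \<noteq> {}"
      using gMin I that by (simp add: order_trans)
    then show "(\<lambda>i. Min (Poly_Mapping.keys (g i))) ` I \<in> schreier (n (2 * 0))"
      using gMin I by (auto simp: n_0)
    show "(\<Sum>i\<in>I. (a i / L)\<^sup>2) \<le> 1"
      unfolding power_divide sum_divide_distrib[symmetric] L2[symmetric] using Lpos by simp
  qed
  have hx: "act h (x j) = (1 / 2) * (a j / L * act (g j) (x j))" if j: "j \<in> I" for j
  proof -
    have "act (g i) (x j) = 0" if "i \<in> I" "i \<noteq> j" for i
      unfolding act_def
    proof (rule sum.neutral, rule ballI)
      fix k assume "k \<in> Poly_Mapping.keys (g i)"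
      then have "k \<in> ?S i" using g(2) that by blast
      then have "k \<notin> ?S j" using disj that j unfolding disjoint_family_on_def by blast
      then show "Poly_Mapping.lookup (g i) k * coord (x j) k = 0" by simp
    qed
    then have "(\<Sum>i\<in>I. a i / L * act (g i) (x j)) = a j / L * act (g j) (x j)"
      using I j by (intro sum_single_term) auto
    then show ?thesis unfolding h_def act_combination[OF I] by (simp add: m_0)
  qed
  have "(1 / 4) * L = (1 / 4) * (L\<^sup>2 / L)" using Lpos by (simp add: power2_eq_square)
  also have "\<dots> = (\<Sum>j\<in>I. (1 / 4) * ((a j)\<^sup>2 / L))"
    unfolding L2 by (simp add: sum_divide_distrib sum_distrib_left)
  also have "\<dots> \<le> (\<Sum>j\<in>I. a j * act h (x j))"
  proof (rule sum_mono)
    fix j assume j: "j \<in> I"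
    have "(1 / 4) * ((a j)\<^sup>2 / L) = (1 / 2) * ((a j)\<^sup>2 / L) * (1 / 2)" by simp
    also have "\<dots> \<le> (1 / 2) * ((a j)\<^sup>2 / L) * act (g j) (x j)"
      using g(3)[OF j] Lpos by (intro mult_left_mono) auto
    also have "\<dots> = a j * act h (x j)" unfolding hx[OF j] by (simp add: power2_eq_square)
    finally show "(1 / 4) * ((a j)\<^sup>2 / L) \<le> a j * act h (x j)" .
  qed
  also have "\<dots> = act h (\<Sum>j\<in>I. a j *\<^sub>R x j)" using x by (intro act_sum[symmetric]) auto
  also have "\<dots> \<le> norm (\<Sum>j\<in>I. a j *\<^sub>R x j)"
    using x by (intro act_le_norm \<open>D h\<close> coord_sum(1)) auto
  finally show ?thesis unfolding L_def .
qed simp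

theorem asymptotic_l2: "asymptotic_l2_disjoint X (\<lambda>i. \<iota> (unit_vec i))"
  unfolding asymptotic_l2_disjoint_def
proof (intro conjI exI[of _ 4] allI impI)
  show "schauder_basis X (\<lambda>i. \<iota> (unit_vec i))" by (rule schauder_basis_unit_vectors)
next
  fix N :: nat and x a
  assume as: "(\<forall>i\<in>{1..N}. x i \<in> X \<and> norm (x i) = 1 \<and>
      (\<forall>k\<in>basis_supp (\<lambda>i. \<iota> (unit_vec i)) (x i). N \<le> k)) \<and>
    disjoint_family_on (\<lambda>i. basis_supp (\<lambda>i. \<iota> (unit_vec i)) (x i)) {1..N}"
  have supp: "basis_supp (\<lambda>i. \<iota> (unit_vec i)) (x i) = {k. coord (x i) k \<noteq> 0}" if "i \<in> {1..N}" for i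
    using as that by (intro basis_supp_eq) blast
  have disj: "disjoint_family_on (\<lambda>i. {k. coord (x i) k \<noteq> 0}) {1..N}"
    using as supp unfolding disjoint_family_on_def by (metis (no_types, lifting))
  have k: "card {1..N} \<le> k" if "i \<in> {1..N}" "coord (x i) k \<noteq> 0" for i k
    using as supp[OF that(1)] that by fastforce
  show "(1 / 4) * L2_set a {1..N} \<le> norm (\<Sum>i=1..N. a i *\<^sub>R x i)"
    using as k disj by (intro lower_l2_estimate) blast+
  have "norm (\<Sum>i=1..N. a i *\<^sub>R x i) \<le> L2_set a {1..N}"
    using as disj by (intro upper_l2_estimate) force+
  also have "\<dots> \<le> 4 * L2_set a {1..N}" using L2_set_nonneg[of a "{1..N}"] by linarith
  finally show "norm (\<Sum>i=1..N. a i *\<^sub>R x i) \<le> 4 * L2_set a {1..N}" .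
qed simp

end

section \<open>Hilbertian subspaces\<close>

lemma linear_on_simps:
  assumes "linear_on V T"
  shows "x \<in> V \<Longrightarrow> y \<in> V \<Longrightarrow> T (x + y) = T x + T y" "x \<in> V \<Longrightarrow> T (c *\<^sub>R x) = c *\<^sub>R T x"
  using assms unfolding linear_on_def by auto

lemma linear_on_sum:
  assumes "linear_on V T" "subspace V" "finite I" "\<And>i. i \<in> I \<Longrightarrow> x i \<in> V"
  shows "T (\<Sum>i\<in>I. a i *\<^sub>R x i) = (\<Sum>i\<in>I. a i *\<^sub>R T (x i))"
  using assms(3,4)
proof (induction I rule: finite_induct)
  case empty
  have "T (0 *\<^sub>R 0) = 0 *\<^sub>R T 0" using assms(1,2) by (intro linear_on_simps) (auto intro: subspace_0)
  then show ?case by simp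
next
  case (insert i I)
  then have "a i *\<^sub>R x i \<in> V" "(\<Sum>i\<in>I. a i *\<^sub>R x i) \<in> V"
    using assms(2) by (auto intro!: subspace_scale subspace_sum)
  then show ?case using insert linear_on_simps[OF assms(1)] by simp
qed

lemma linear_on_diff:
  assumes "linear_on V T" "subspace V" "x \<in> V" "y \<in> V"
  shows "T (x - y) = T x - T y"
proof -
  have "T (x + (-1) *\<^sub>R y) = T x + (-1) *\<^sub>R T y"
    using assms linear_on_simps[OF assms(1)] by (simp only: subspace_scale)
  then show ?thesis by simp
qed

lemma linear_on_subset: "linear_on V T \<Longrightarrow> U \<subseteq> V \<Longrightarrow> linear_on U T"
  unfolding linear_on_def by blast

lemma finite_dimensional_subset: "finite_dimensional E \<Longrightarrow> F \<subseteq> E \<Longrightarrow> finite_dimensional F"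
  unfolding finite_dimensional_def by blast

lemma finite_dimensional_basis:
  assumes "finite_dimensional E" "subspace E"
  obtains B where "finite B" "independent B" "span B = E" "card B = dim E"
proof -
  obtain A where A: "finite A" "E \<subseteq> span A" using assms(1) unfolding finite_dimensional_def by blast
  obtain B where B: "B \<subseteq> E" "independent B" "E \<subseteq> span B" "card B = dim E"
    using real_vector.basis_exists by blast
  have "finite B" using real_vector.independent_span_bound[OF A(1) B(2)] A(2) B(1) by blast
  moreover have "span B = E" using B assms(2) real_vector.span_subspace by blast
  ultimately show thesis using that B by blast
qed

lemma kernel_subspace:
  fixes \<phi> :: "'a::real_vector \<Rightarrow> real"
  assumes "subspace E" "linear_on E \<phi>"
  shows "subspace {x \<in> E. \<phi> x = 0}"
proof -
  have "\<phi> (0 *\<^sub>R 0) = 0" using linear_on_simps(2)[OF assms(2) subspace_0[OF assms(1)], of 0] by simp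
  then show ?thesis
    using assms linear_on_simps[OF assms(2)] unfolding subspace_def by auto
qed

lemma dim_kernel:
  fixes \<phi> :: "'a::real_vector \<Rightarrow> real"
  assumes "subspace E" "finite_dimensional E" "linear_on E \<phi>" "v \<in> E" "\<phi> v \<noteq> 0"
  shows "dim E = Suc (dim {x \<in> E. \<phi> x = 0})"
proof -
  let ?K = "{x \<in> E. \<phi> x = 0}"
  have K: "subspace ?K" by (rule kernel_subspace[OF assms(1,3)])
  obtain B where B: "finite B" "independent B" "span B = ?K" "card B = dim ?K"
    using finite_dimensional_basis[OF finite_dimensional_subset[OF assms(2)] K] by blast
  have v: "v \<notin> span B" using assms(5) B(3) by auto
  then have ind: "independent (insert v B)" using B(2) by (rule independent_insertI)
  have vB: "v \<notin> B" using v span_base by blast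
  have "span (insert v B) = E"
  proof
    have "insert v B \<subseteq> E" using assms(4) B(3) span_superset[of B] by auto
    then show "span (insert v B) \<subseteq> E" using assms(1) by (rule span_minimal)
    show "E \<subseteq> span (insert v B)"
    proof
      fix x assume x: "x \<in> E"
      let ?y = "x - (\<phi> x / \<phi> v) *\<^sub>R v"
      have sv: "(\<phi> x / \<phi> v) *\<^sub>R v \<in> E" using assms(1,4) by (rule subspace_scale)
      have "\<phi> ?y = 0"
        using linear_on_diff[OF assms(3,1) x sv] linear_on_simps(2)[OF assms(3,4)] assms(5) by simp
      then have "?y \<in> span B" using B(3) subspace_diff[OF assms(1) x sv] by simp
      then show "x \<in> span (insert v B)" unfolding span_insert by blast
    qed
  qed
  then have "dim E = card (insert v B)" using real_vector.dim_eq_card[OF _ ind, of E] span_span by metis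
  then show ?thesis using B(1,4) vB by simp
qed

lemma dim_0_trivial:
  assumes "subspace E" "finite_dimensional E" "dim E = 0"
  shows "E = {0}"
  using finite_dimensional_basis[OF assms(2,1)] assms(3) by (metis card_0_eq span_empty)

lemma dim_Suc_nontrivial:
  fixes E :: "'a::real_vector set"
  assumes "dim E = Suc k" "subspace E"
  obtains v where "v \<in> E" "v \<noteq> 0"
proof (cases "E \<subseteq> {0}")
  case True
  then have "E \<subseteq> span {}" by simp
  then have "dim E \<le> card ({} :: 'a set)" by (intro real_vector.dim_le_card) auto
  then show thesis using assms(1) by simp
qed (use that in blast)

text \<open>Gram-Schmidt by induction on the dimension: the orthogonal complement of a normalised
  \<open>v\<close> inside \<open>F\<close> is the kernel of \<open>ip _ v\<close>, so its dimension
  drops by one. Definiteness is assumed only on \<open>F\<close>, as the forms used later may be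
  degenerate on the whole space.\<close>

lemma orthonormal_basis:
  fixes ip :: "'a::real_vector \<Rightarrow> 'a \<Rightarrow> real"
  assumes "subspace F" "finite_dimensional F"
    and "\<And>y. y \<in> F \<Longrightarrow> linear_on F (\<lambda>x. ip x y)" "\<And>x y. ip x y = ip y x"
    and "\<And>x. x \<in> F \<Longrightarrow> x \<noteq> 0 \<Longrightarrow> 0 < ip x x"
  shows "\<exists>b. (\<forall>i\<in>{1..dim F}. b i \<in> F) \<and>
     (\<forall>i\<in>{1..dim F}. \<forall>j\<in>{1..dim F}. ip (b i) (b j) = (if i = j then 1 else 0)) \<and>
     (\<forall>x\<in>F. x = (\<Sum>i=1..dim F. ip x (b i) *\<^sub>R b i))"
  using assms
proof (induction "dim F" arbitrary: F)
  case 0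
  then have "F = {0}" using dim_0_trivial by metis
  then show ?case using 0 by auto
next
  case (Suc k)
  obtain u where u: "u \<in> F" "u \<noteq> 0" using dim_Suc_nontrivial Suc.hyps(2) Suc.prems(1) by metis
  note lin = linear_on_simps[OF Suc.prems(3)]
  have lin2: "ip y (c *\<^sub>R x) = c * ip y x" if "x \<in> F" "y \<in> F" for x y c
    using lin(2)[OF that(2,1)] Suc.prems(4) by simp
  let ?r = "1 / sqrt (ip u u)"
  define v where "v = ?r *\<^sub>R u"
  have v: "v \<in> F" unfolding v_def using Suc.prems(1) u(1) by (rule subspace_scale)
  have "ip v v = ?r * (?r * ip u u)"
    using lin(2)[OF v u(1)] lin2[OF u(1) u(1)] unfolding v_def by simp
  then have vv: "ip v v = 1" using Suc.prems(5)[OF u] by (simp add: field_simps)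
  let ?\<phi> = "\<lambda>x. ip x v"
  let ?G = "{x \<in> F. ip x v = 0}"
  have l: "linear_on F ?\<phi>" using Suc.prems(3) v by blast
  have dG: "k = dim ?G" using dim_kernel[OF Suc.prems(1,2) l v] vv Suc.hyps(2) by simp
  have "\<exists>b. (\<forall>i\<in>{1..dim ?G}. b i \<in> ?G) \<and>
     (\<forall>i\<in>{1..dim ?G}. \<forall>j\<in>{1..dim ?G}. ip (b i) (b j) = (if i = j then 1 else 0)) \<and>
     (\<forall>x\<in>?G. x = (\<Sum>i=1..dim ?G. ip x (b i) *\<^sub>R b i))"
  proof (rule Suc.hyps(1)[OF dG])
    show "subspace ?G" using kernel_subspace[OF Suc.prems(1) l] .
    show "finite_dimensional ?G" by (rule finite_dimensional_subset[OF Suc.prems(2)]) blast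
    show "linear_on ?G (\<lambda>x. ip x y)" if "y \<in> ?G" for y
      by (rule linear_on_subset[OF Suc.prems(3)]) (use that in blast)+
    show "ip x y = ip y x" for x y by (rule Suc.prems(4))
    show "0 < ip x x" if "x \<in> ?G" "x \<noteq> 0" for x using Suc.prems(5) that by blast
  qed
  then obtain b where B: "\<forall>i\<in>{1..k}. b i \<in> ?G"
    "\<forall>i\<in>{1..k}. \<forall>j\<in>{1..k}. ip (b i) (b j) = (if i = j then 1 else 0)"
    "\<forall>x\<in>?G. x = (\<Sum>i=1..k. ip x (b i) *\<^sub>R b i)"
    unfolding dG[symmetric] by (elim exE conjE) (rule that)
  note b = B(1)[THEN bspec] B(2)[THEN bspec, THEN bspec] B(3)[THEN bspec]
  define b' where "b' = b(Suc k := v)"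
  have b': "b' i = b i" if "i \<in> {1..k}" for i using that unfolding b'_def by auto
  have bv: "ip (b i) v = 0" "ip v (b i) = 0" "b i \<in> F" if "i \<in> {1..k}" for i
  proof -
    show *: "ip (b i) v = 0" "b i \<in> F" using b(1)[OF that] by auto
    show "ip v (b i) = 0" using *(1) by (simp only: Suc.prems(4)[of v])
  qed
  have split: "i \<in> {1..k} \<or> i = Suc k" if "i \<in> {1..Suc k}" for i using that by auto
  have "x = (\<Sum>i=1..Suc k. ip x (b' i) *\<^sub>R b' i)" if x: "x \<in> F" for x
  proof -
    let ?y = "x - ip x v *\<^sub>R v"
    have sv: "ip x v *\<^sub>R v \<in> F" using Suc.prems(1) v by (rule subspace_scale)
    have ipy: "ip ?y z = ip x z - ip x v * ip v z" if "z \<in> F" for z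
      using linear_on_diff[OF Suc.prems(3)[OF that] Suc.prems(1) x sv] lin(2)[OF that v] by simp
    have "?y \<in> ?G" using ipy[OF v] vv subspace_diff[OF Suc.prems(1) x sv] by simp
    then have "?y = (\<Sum>i=1..k. ip ?y (b i) *\<^sub>R b i)" by (rule b(3))
    also have "\<dots> = (\<Sum>i=1..k. ip x (b' i) *\<^sub>R b' i)"
      using ipy bv b' by (intro sum.cong refl) simp
    finally have "x = (\<Sum>i=1..k. ip x (b' i) *\<^sub>R b' i) + ip x v *\<^sub>R v" by (simp add: algebra_simps)
    then show ?thesis by (simp add: b'_def)
  qed
  moreover have "b' i \<in> F" if "i \<in> {1..Suc k}" for i
    using split[OF that] b' bv(3) v by (auto simp: b'_def)
  moreover have "ip (b' i) (b' j) = (if i = j then 1 else 0)" if "i \<in> {1..Suc k}" "j \<in> {1..Suc k}" for i j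
  proof -
    from split[OF that(1)] split[OF that(2)] show ?thesis
    proof (elim disjE)
      assume ij: "i \<in> {1..k}" "j \<in> {1..k}"
      then show ?thesis using b(2) by (simp only: b')
    next
      assume "i \<in> {1..k}" "j = Suc k"
      then show ?thesis using bv(1)[of i] b'[of i] by (simp add: b'_def)
    next
      assume "i = Suc k" "j \<in> {1..k}"
      then show ?thesis using bv(2)[of j] b'[of j] by (auto simp: b'_def)
    next
      assume "i = Suc k" "j = Suc k"
      then show ?thesis using vv by (simp add: b'_def)
    qed
  qed
  ultimately show ?case unfolding Suc.hyps(2)[symmetric] by (intro exI[of _ b'] conjI ballI)
qed

section \<open>Projections and distances from a semi-inner product\<close>

lemma opnorm_on_le:
  assumes "0 \<in> V" "p 0 \<le> 1" "0 \<le> K" "\<And>x. x \<in> V \<Longrightarrow> q (T x) \<le> K * p x"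
  shows "opnorm_on V p q T \<le> K"
  unfolding opnorm_on_def
proof (rule cSUP_least)
  show "{x \<in> V. p x \<le> 1} \<noteq> {}" using assms(1,2) by blast
  fix x assume x: "x \<in> {x \<in> V. p x \<le> 1}"
  then have "q (T x) \<le> K * p x" using assms(4) by blast
  also have "\<dots> \<le> K * 1" using x assms(3) by (intro mult_left_mono) auto
  finally show "q (T x) \<le> K" by simp
qed

text \<open>A real supremum dominates its members only if the set is bounded above, hence the bound
  \<open>K\<close>.\<close>

lemma opnorm_on_nonneg:
  assumes "0 \<in> V" "p 0 \<le> 1" "0 \<le> K" "\<And>x. x \<in> V \<Longrightarrow> q (T x) \<le> K * p x" "0 \<le> q (T 0)"
  shows "0 \<le> opnorm_on V p q T"
proof -
  have "q (T x) \<le> K" if "x \<in> V" "p x \<le> 1" for x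
    using assms(4)[OF that(1)] mult_left_mono[OF that(2) assms(3)] by simp
  then have "bdd_above ((\<lambda>x. q (T x)) ` {x \<in> V. p x \<le> 1})" by (intro bdd_aboveI2[of _ _ K]) auto
  then have "q (T 0) \<le> opnorm_on V p q T"
    unfolding opnorm_on_def using assms(1,2) by (intro cSUP_upper) auto
  then show ?thesis using assms(5) by linarith
qed

lemma l2_norm_eq:
  assumes "x \<in> l2_space k"
  shows "l2_norm x = L2_set (Poly_Mapping.lookup x) {1..k}"
  using assms unfolding l2_norm_def L2_set_def l2_space_def
  by (intro arg_cong[of _ _ sqrt] sum.mono_neutral_left) (auto simp: in_keys_iff)

text \<open>The lower bound makes \<open>ip\<close> definite on \<open>F\<close>, so an orthonormal
  basis exists. Bessel's inequality and the upper bound control the coefficients of \<open>x\<close>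
  by \<open>\<beta> * norm x\<close>; the lower bound controls a combination by the length of its
  coefficients divided by \<open>\<alpha>\<close>. Both the orthogonal projection and the coordinate
  isomorphism cost \<open>\<beta> / \<alpha>\<close>.\<close>

lemma hilbertian_complemented:
  fixes ip :: "'a::real_normed_vector \<Rightarrow> 'a \<Rightarrow> real"
  assumes X: "subspace X" and F: "subspace F" "finite_dimensional F" "F \<subseteq> X"
    and lin: "\<And>y. y \<in> X \<Longrightarrow> linear_on X (\<lambda>x. ip x y)" and sym: "\<And>x y. ip x y = ip y x"
    and nn: "\<And>x. 0 \<le> ip x x"
    and ab: "0 < \<alpha>" "0 \<le> \<beta>"
    and lower: "\<And>x. x \<in> F \<Longrightarrow> \<alpha> * norm x \<le> sqrt (ip x x)"
    and upper: "\<And>x. x \<in> X \<Longrightarrow> sqrt (ip x x) \<le> \<beta> * norm x"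
  shows "banach_mazur F norm (l2_space (dim F)) l2_norm \<le> ereal (\<beta> / \<alpha>)"
    and "\<exists>P. projection_onto X F P \<and> opnorm_on X norm norm P \<le> \<beta> / \<alpha>"
proof -
  define k where "k = dim F"
  have "0 < ip x x" if "x \<in> F" "x \<noteq> 0" for x
  proof -
    have "0 < \<alpha> * norm x" using ab(1) that by simp
    then have "0 < sqrt (ip x x)" using lower[OF that(1)] by linarith
    then show ?thesis by simp
  qed
  then have "\<exists>b. (\<forall>i\<in>{1..k}. b i \<in> F) \<and>
     (\<forall>i\<in>{1..k}. \<forall>j\<in>{1..k}. ip (b i) (b j) = (if i = j then 1 else 0)) \<and>
     (\<forall>x\<in>F. x = (\<Sum>i=1..k. ip x (b i) *\<^sub>R b i))"
    unfolding k_def using F(3)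
    by (intro orthonormal_basis[OF F(1,2) linear_on_subset[OF lin F(3)] sym]) blast+
  then obtain b where B: "\<forall>i\<in>{1..k}. b i \<in> F"
    "\<forall>i\<in>{1..k}. \<forall>j\<in>{1..k}. ip (b i) (b j) = (if i = j then 1 else 0)"
    "\<forall>x\<in>F. x = (\<Sum>i=1..k. ip x (b i) *\<^sub>R b i)"
    by (elim exE conjE) (rule that)
  note b = B(1)[THEN bspec] B(2)[THEN bspec, THEN bspec] B(3)[THEN bspec]
  have bX: "b i \<in> X" if "i \<in> {1..k}" for i using b(1)[OF that] F(3) by blast
  define comb where "comb = (\<lambda>c. \<Sum>i=1..k. c i *\<^sub>R b i)"
  have combF: "comb c \<in> F" for c
    unfolding comb_def using b(1) F(1) by (auto intro!: subspace_sum subspace_scale)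
  have ip_comb: "ip (comb c) y = (\<Sum>i=1..k. c i * ip (b i) y)" if "y \<in> X" for c y
    unfolding comb_def using linear_on_sum[OF lin[OF that] X finite_atLeastAtMost bX, where a = c] by simp
  have comb_b: "ip (comb c) (b j) = c j" if j: "j \<in> {1..k}" for c j
  proof -
    have "ip (comb c) (b j) = (\<Sum>i=1..k. if i = j then c i else 0)"
      unfolding ip_comb[OF bX[OF j]] using b(2) j by (intro sum.cong refl) auto
    then show ?thesis using j by simp
  qed
  have comb_comb: "ip (comb c) (comb c) = (\<Sum>i=1..k. (c i)\<^sup>2)" for c
  proof -
    have "ip (comb c) (comb c) = (\<Sum>i=1..k. c i * ip (b i) (comb c))"
      using combF F(3) by (intro ip_comb) auto
    also have "\<dots> = (\<Sum>i=1..k. c i * ip (comb c) (b i))" by (simp add: sym[of "comb c"])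
    finally show ?thesis by (simp add: comb_b power2_eq_square)
  qed
  let ?a = "\<lambda>x i. ip x (b i)"
  \<comment> \<open>Bessel's inequality is the expansion of
    \<open>ip (x - ?p) (x - ?p) \<ge> 0\<close> for the orthogonal projection \<open>?p\<close>.
    Only semidefiniteness on \<open>X\<close> enters.\<close>
  have bessel: "(\<Sum>i=1..k. (?a x i)\<^sup>2) \<le> ip x x" if x: "x \<in> X" for x
  proof -
    let ?p = "comb (?a x)"
    have p: "?p \<in> X" using combF F(3) by blast
    have "ip ?p x = (\<Sum>i=1..k. (?a x i)\<^sup>2)"
      unfolding ip_comb[OF x] by (simp add: power2_eq_square sym[of x])
    then have px: "ip ?p x = ip ?p ?p" by (simp only: comb_comb)
    have d: "x - ?p \<in> X" using X x p by (rule subspace_diff)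
    have "ip (x - ?p) (x - ?p) = ip x (x - ?p) - ip ?p (x - ?p)"
      by (rule linear_on_diff[OF lin[OF d] X x p])
    also have "\<dots> = ip (x - ?p) x - ip (x - ?p) ?p" by (rule arg_cong2[where f = minus, OF sym sym])
    also have "\<dots> = ip x x - ip ?p ?p"
      using linear_on_diff[OF lin[OF x] X x p] linear_on_diff[OF lin[OF p] X x p] px sym[of x ?p] by simp
    finally show ?thesis using nn[of "x - ?p"] comb_comb by simp
  qed
  have norm_comb: "norm (comb c) \<le> L2_set c {1..k} / \<alpha>" for c
    using lower[OF combF] ab(1) unfolding comb_comb L2_set_def by (simp add: field_simps)
  have coeff_le: "L2_set (?a x) {1..k} \<le> \<beta> * norm x" if "x \<in> X" for x
    using bessel[OF that] upper[OF that] unfolding L2_set_def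
    by (meson order_trans real_sqrt_le_mono)
  have F_comb: "comb (?a x) = x" if "x \<in> F" for x using b(3)[OF that] unfolding comb_def by simp
  have lin_a: "x \<in> X \<Longrightarrow> y \<in> X \<Longrightarrow> ?a (x + y) i = ?a x i + ?a y i"
    "x \<in> X \<Longrightarrow> ?a (c *\<^sub>R x) i = c * ?a x i" if "i \<in> {1..k}" for x y c i
    using linear_on_simps[OF lin[OF bX[OF that]]] by auto
  have ab': "0 \<le> \<beta> / \<alpha>" using ab by simp

  define P where "P = (\<lambda>x. comb (?a x))"
  have P_le: "norm (P x) \<le> \<beta> / \<alpha> * norm x" if "x \<in> X" for x
    using norm_comb[of "?a x"] coeff_le[OF that] ab(1) unfolding P_def
    by (simp add: divide_right_mono order_trans)
  have "linear_on X P"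
    unfolding linear_on_def P_def comb_def
    using lin_a by (simp add: scaleR_add_left sum.distrib scaleR_sum_right)
  moreover have "P ` X = F"
  proof
    show "P ` X \<subseteq> F" unfolding P_def using combF by blast
    show "F \<subseteq> P ` X"
    proof
      fix x assume "x \<in> F"
      then have "x = P x" "x \<in> X" using F_comb F(3) unfolding P_def by auto
      then show "x \<in> P ` X" by blast
    qed
  qed
  moreover have "\<forall>y\<in>F. P y = y" using F_comb unfolding P_def by blast
  ultimately have "projection_onto X F P"
    unfolding projection_onto_def bounded_linear_on_def using P_le by blast
  moreover have "opnorm_on X norm norm P \<le> \<beta> / \<alpha>"
    using X ab' P_le by (intro opnorm_on_le) (auto simp: subspace_0)
  ultimately show "\<exists>P. projection_onto X F P \<and> opnorm_on X norm norm P \<le> \<beta> / \<alpha>" by blast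

  define T where "T = (\<lambda>x. \<Sum>i=1..k. ?a x i *\<^sub>R unit_vec i)"
  define S where "S = (\<lambda>z. comb (Poly_Mapping.lookup z))"
  have lookup_T: "Poly_Mapping.lookup (T x) i = (if i \<in> {1..k} then ?a x i else 0)" for x i
  proof -
    have "Poly_Mapping.lookup (T x) i = (\<Sum>j=1..k. if i = j then ?a x j else 0)"
      unfolding T_def lookup_sum lookup_scaleR
      by (intro sum.cong refl) (auto simp: lookup_single when_def)
    then show ?thesis by (simp add: sum.delta)
  qed
  have T_l2: "T x \<in> l2_space k" for x
    unfolding l2_space_def by (auto simp: in_keys_iff lookup_T split: if_splits)
  have ST: "S (T x) = x" if "x \<in> F" for x
  proof -
    have "S (T x) = comb (?a x)" unfolding S_def comb_def by (intro sum.cong refl) (simp add: lookup_T)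
    then show ?thesis using F_comb[OF that] by simp
  qed
  have TS: "T (S z) = z" if "z \<in> l2_space k" for z
  proof (rule poly_mapping_eqI)
    fix i
    have "Poly_Mapping.lookup z i = 0" if "i \<notin> {1..k}"
      using \<open>z \<in> l2_space k\<close> that unfolding l2_space_def by (auto simp: in_keys_iff)
    then show "Poly_Mapping.lookup (T (S z)) i = Poly_Mapping.lookup z i"
      unfolding lookup_T S_def using comb_b by auto
  qed
  have S_F: "S z \<in> F" for z unfolding S_def by (rule combF)
  have bij: "bij_betw T F (l2_space k)"
    using ST TS T_l2 S_F by (intro bij_betwI[where g = S]) auto
  have inv: "inv_into F T z = S z" if "z \<in> l2_space k" for z
    using inv_into_f_eq[OF bij_betw_imp_inj_on[OF bij] S_F TS[OF that]] .
  have l2T: "l2_norm (T x) \<le> \<beta> * norm x" if "x \<in> F" for x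
  proof -
    have "l2_norm (T x) = L2_set (?a x) {1..k}"
      unfolding l2_norm_eq[OF T_l2] by (intro L2_set_cong refl) (simp add: lookup_T)
    then show ?thesis using coeff_le that F(3) by auto
  qed
  have nS: "norm (inv_into F T z) \<le> 1 / \<alpha> * l2_norm z" if "z \<in> l2_space k" for z
    using norm_comb[of "Poly_Mapping.lookup z"] unfolding inv[OF that] l2_norm_eq[OF that] S_def by simp
  have l2_sub: "x + y \<in> l2_space k" "c *\<^sub>R x \<in> l2_space k" "0 \<in> l2_space k"
    if "x \<in> l2_space k" "y \<in> l2_space k" for x y c
    using that unfolding l2_space_def
    by (auto simp: in_keys_iff lookup_add lookup_scaleR subset_iff)
      (metis add_0)+
  have linT: "linear_on F T"
    unfolding linear_on_def T_def
    using lin_a F(3) by (simp add: subset_iff scaleR_add_left sum.distrib scaleR_sum_right)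
  have "linear_on (l2_space k) S"
    unfolding linear_on_def S_def comb_def
    by (simp add: lookup_add lookup_scaleR scaleR_add_left sum.distrib scaleR_sum_right)
  then have linS: "linear_on (l2_space k) (inv_into F T)"
    using l2_sub inv unfolding linear_on_def by simp
  have 0: "0 \<in> l2_space k" "l2_norm 0 = 0" unfolding l2_space_def l2_norm_def by auto
  let ?nT = "opnorm_on F norm l2_norm T" and ?nS = "opnorm_on (l2_space k) l2_norm norm (inv_into F T)"
  have "?nT \<le> \<beta>" using l2T ab F(1) by (intro opnorm_on_le) (auto simp: subspace_0)
  moreover have "?nS \<le> 1 / \<alpha>" using nS ab 0 by (intro opnorm_on_le) auto
  \<comment> \<open>Multiplying the two operator norm bounds requires this factor to be
    nonnegative.\<close>
  moreover have "0 \<le> ?nS" using nS ab 0 by (intro opnorm_on_nonneg[where K = "1 / \<alpha>"]) auto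
  ultimately have "?nT * ?nS \<le> \<beta> * (1 / \<alpha>)" using ab by (intro mult_mono) auto
  moreover have "banach_mazur F norm (l2_space k) l2_norm \<le> ereal (?nT * ?nS)"
    unfolding banach_mazur_def bounded_linear_on_def
    using bij linT linS l2T nS by (intro INF_lower) blast
  ultimately show "banach_mazur F norm (l2_space (dim F)) l2_norm \<le> ereal (\<beta> / \<alpha>)"
    unfolding k_def[symmetric] by (metis ereal_less_eq(3) order_trans times_divide_eq_right mult.right_neutral)
qed

section \<open>Weak Hilbert property\<close>

context wh_space
begin

section \<open>Norming a finite-dimensional subspace by few functionals\<close>

lemma linear_on_act: "linear_on X (act f)"
  unfolding linear_on_def by (simp add: act_add act_scaleR)

text \<open>
  One coordinate is split off with a functional \<open>f\<close> of the norming set; the decomposition costs a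
  factor 3 and the halving of the radius a factor 2, hence the powers of 6.
\<close>

lemma ball_cover:
  assumes "subspace F" "finite_dimensional F" "F \<subseteq> X"
  shows "\<exists>S. finite S \<and> S \<subseteq> F \<and> card S \<le> 6 ^ (dim F * (r + dim F)) \<and>
     (\<forall>x\<in>F. norm x \<le> 6 ^ r \<longrightarrow> (\<exists>s\<in>S. norm (x - s) \<le> 1))"
  using assms
proof (induction "dim F" arbitrary: F r)
  case 0
  then have "F = {0}" using dim_0_trivial by metis
  then show ?case by (intro exI[of _ "{0}"]) simp
next
  case (Suc k)
  obtain u where u: "u \<in> F" "u \<noteq> 0" using dim_Suc_nontrivial Suc.hyps(2) Suc.prems(1) by metis
  define v where "v = (1 / norm u) *\<^sub>R u"
  have v: "v \<in> F" "norm v = 1"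
    unfolding v_def using Suc.prems(1) u by (auto intro: subspace_scale)
  then have vX: "v \<in> X" using Suc.prems(3) by blast
  obtain f where f: "D f" "1 / 2 < act f v"
    using act_norming[OF vX, of "1/2"] v(2) by auto
  let ?G = "{x \<in> F. act f x = 0}"
  have lin: "linear_on F (act f)" by (rule linear_on_subset[OF linear_on_act Suc.prems(3)])
  have dG: "k = dim ?G" using dim_kernel[OF Suc.prems(1,2) lin v(1)] f(2) Suc.hyps(2) by simp
  \<comment> \<open>The dimension drops by one while the exponent of the radius grows by one; this
    trade is the source of \<open>dim F * (r + dim F)\<close>.\<close>
  have "\<exists>S. finite S \<and> S \<subseteq> ?G \<and> card S \<le> 6 ^ (dim ?G * (Suc r + dim ?G)) \<and>
     (\<forall>x\<in>?G. norm x \<le> 6 ^ Suc r \<longrightarrow> (\<exists>s\<in>S. norm (x - s) \<le> 1))"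
  proof (rule Suc.hyps(1)[OF dG kernel_subspace[OF Suc.prems(1) lin]])
    show "finite_dimensional ?G" by (rule finite_dimensional_subset[OF Suc.prems(2)]) blast
    show "?G \<subseteq> X" using Suc.prems(3) by blast
  qed
  then obtain S where S: "finite S" "S \<subseteq> ?G" "card S \<le> 6 ^ (k * (Suc r + k))"
    "\<forall>x\<in>?G. norm x \<le> 6 ^ Suc r \<longrightarrow> (\<exists>s\<in>S. norm (x - s) \<le> 1)"
    unfolding dG[symmetric] by (elim exE conjE) (rule that)
  \<comment> \<open>On the ball of radius \<open>6 ^ r\<close> the functional \<open>f\<close> is at
    most \<open>6 ^ r\<close>, and \<open>act f v > 1 / 2\<close>. The coefficient along
    \<open>v\<close> is thus at most \<open>2 * 6 ^ r\<close> in absolute value, and rounding stays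
    in this range.\<close>
  define J where "J = {-2 * 6 ^ r..2 * 6 ^ r :: int}"
  define T where "T = (\<lambda>(j, s). real_of_int j *\<^sub>R v + (1 / 2) *\<^sub>R s) ` (J \<times> S)"
  have "card J \<le> 6 ^ Suc r"
  proof -
    have "(1::int) \<le> 6 ^ r" by simp
    then have "4 * 6 ^ r + 1 \<le> (6::int) ^ Suc r" unfolding power_Suc by linarith
    then have "nat (4 * 6 ^ r + 1) \<le> nat ((6::int) ^ Suc r)" by (rule nat_mono)
    then show ?thesis unfolding J_def by (simp add: nat_mult_distrib nat_power_eq)
  qed
  have "card T \<le> card (J \<times> S)" unfolding T_def using S(1) by (intro card_image_le) (simp add: J_def)
  also have "\<dots> \<le> 6 ^ Suc r * 6 ^ (k * (Suc r + k))"
    using \<open>card J \<le> 6 ^ Suc r\<close> S(3) by (simp only: card_cartesian_product mult_le_mono)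
  also have "\<dots> = 6 ^ (Suc r + k * (Suc r + k))" by (simp only: power_add)
  also have "\<dots> \<le> 6 ^ (Suc k * (r + Suc k))" by (intro power_increasing) (simp_all add: algebra_simps)
  finally have cT: "card T \<le> 6 ^ (dim F * (r + dim F))" unfolding Suc.hyps(2) .
  have "T \<subseteq> F" unfolding T_def using S(2) v(1) Suc.prems(1)
    by (auto intro!: subspace_add subspace_scale)
  moreover have "\<exists>s\<in>T. norm (x - s) \<le> 1" if x: "x \<in> F" "norm x \<le> 6 ^ r" for x
  proof -
    define a where "a = act f x / act f v"
    define y where "y = x - a *\<^sub>R v"
    have xX: "x \<in> X" using x(1) Suc.prems(3) by blast
    have av: "a *\<^sub>R v \<in> F" using Suc.prems(1) v(1) by (rule subspace_scale)
    have fx: "\<bar>act f x\<bar> \<le> 6 ^ r" using abs_act_le_norm[OF f(1) xX] x(2) by linarith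
    have "\<bar>a\<bar> = \<bar>act f x\<bar> / act f v" unfolding a_def using f(2) by (simp add: abs_divide)
    also have "\<dots> \<le> 6 ^ r / (1 / 2)" using fx f(2) by (intro frac_le) auto
    finally have a: "\<bar>a\<bar> \<le> 2 * 6 ^ r" by simp
    have yF: "y \<in> F" unfolding y_def using Suc.prems(1) x(1) av by (rule subspace_diff)
    have "act f y = act f x - a * act f v"
      unfolding y_def using linear_on_diff[OF lin Suc.prems(1) x(1) av] act_scaleR[OF vX] by simp
    then have "act f y = 0" unfolding a_def using f(2) by simp
    \<comment> \<open>The doubled kernel part has norm at most
      \<open>2 * (3 * 6 ^ r) = 6 ^ Suc r\<close>. Approximating it within 1 leaves an error 1/2 for
      \<open>y\<close>; rounding along \<open>v\<close> contributes the other 1/2.\<close>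
    then have "2 *\<^sub>R y \<in> ?G" using subspace_scale[OF kernel_subspace[OF Suc.prems(1) lin]] yF by blast
    moreover have "norm (2 *\<^sub>R y) \<le> 6 ^ Suc r"
    proof -
      have "norm y \<le> norm x + norm (a *\<^sub>R v)" unfolding y_def by (rule norm_triangle_ineq4)
      then have "norm y \<le> 3 * 6 ^ r" using x(2) a v(2) by simp
      then show ?thesis by simp
    qed
    ultimately obtain s where s: "s \<in> S" "norm (2 *\<^sub>R y - s) \<le> 1" using S(4) by blast
    have r: "\<bar>of_int (round a) - a\<bar> \<le> 1 / 2" by (rule of_int_round_abs_le)
    have "round a \<in> J"
    proof -
      have "\<bar>real_of_int (round a)\<bar> < 2 * 6 ^ r + 1" using r a by linarith
      then have "real_of_int \<bar>round a\<bar> < real_of_int (2 * 6 ^ r + 1)" by simp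
      then have "\<bar>round a\<bar> < 2 * 6 ^ r + 1" by (simp only: of_int_less_iff)
      then show ?thesis unfolding J_def by auto
    qed
    then have "real_of_int (round a) *\<^sub>R v + (1 / 2) *\<^sub>R s \<in> T" unfolding T_def using s(1) by auto
    moreover have "norm (x - (real_of_int (round a) *\<^sub>R v + (1 / 2) *\<^sub>R s)) \<le> 1"
    proof -
      have "x - (real_of_int (round a) *\<^sub>R v + (1 / 2) *\<^sub>R s)
          = (a - real_of_int (round a)) *\<^sub>R v + (1 / 2) *\<^sub>R (2 *\<^sub>R y - s)"
        unfolding y_def by (simp add: algebra_simps)
      also have "norm \<dots> \<le> norm ((a - real_of_int (round a)) *\<^sub>R v) + norm ((1 / 2) *\<^sub>R (2 *\<^sub>R y - s))"
        by (rule norm_triangle_ineq)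
      also have "\<dots> = \<bar>a - real_of_int (round a)\<bar> + 1 / 2 * norm (2 *\<^sub>R y - s)"
        using v(2) by (simp only: norm_scaleR) simp
      also have "\<dots> \<le> 1" using r s(2) by linarith
      finally show ?thesis .
    qed
    ultimately show ?thesis by blast
  qed
  moreover have "finite T" unfolding T_def J_def using S(1) by simp
  ultimately show ?case using cT by blast
qed

text \<open>Scale \<open>x\<close> to norm 6 and take a net point \<open>s\<close> within distance
  1, so \<open>norm s \<ge> 5\<close>. The functional chosen for \<open>s\<close> loses at most 1/2
  on \<open>s\<close> and 1 in passing to the scaled vector. What remains is more than 3, half of
  the norm.\<close>

lemma norming_family:
  assumes "subspace F" "finite_dimensional F" "F \<subseteq> X"
  shows "\<exists>S. finite S \<and> S \<noteq> {} \<and> (\<forall>f\<in>S. D f) \<and> card S \<le> 6 ^ (dim F * (1 + dim F)) \<and>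
     (\<forall>x\<in>F. \<exists>f\<in>S. norm x / 2 \<le> act f x)"
proof -
  obtain S where S: "finite S" "S \<subseteq> F" "card S \<le> 6 ^ (dim F * (1 + dim F))"
     "\<forall>x\<in>F. norm x \<le> 6 ^ 1 \<longrightarrow> (\<exists>s\<in>S. norm (x - s) \<le> 1)"
    using ball_cover[OF assms, of 1] by blast
  have "\<exists>f. D f \<and> norm s - 1 / 2 < act f s" if "s \<in> S" for s
    using act_norming[of s "1/2"] S(2) assms(3) that by auto
  then obtain g where g: "\<And>s. s \<in> S \<Longrightarrow> D (g s) \<and> norm s - 1 / 2 < act (g s) s" by metis
  have ne: "S \<noteq> {}" using S(4) subspace_0[OF assms(1)] by fastforce
  have "\<exists>f\<in>g ` S. norm x / 2 \<le> act f x" if x: "x \<in> F" for x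
  proof (cases "x = 0")
    case True
    have "act f (0 *\<^sub>R x) = 0" for f using act_scaleR[of x f 0] x assms(3) by auto
    then show ?thesis using ne True by auto
  next
    case False
    define z where "z = (6 / norm x) *\<^sub>R x"
    have z: "z \<in> F" "norm z = 6" unfolding z_def using assms(1) x False by (auto intro: subspace_scale)
    then obtain s where s: "s \<in> S" "norm (z - s) \<le> 1" using S(4) by auto
    have zs: "z \<in> X" "s \<in> X" "x \<in> X" using z(1) s(1) S(2) assms(3) x by auto
    have "\<bar>act (g s) (z - s)\<bar> \<le> 1"
      using abs_act_le_norm[of "g s" "z - s"] g[OF s(1)] zs X_subspace s(2)
      by (meson order_trans subspace_diff)
    moreover have "norm z \<le> norm (z - s) + norm s" by norm
    moreover have "act (g s) (z - s) = act (g s) z - act (g s) s" using zs(1,2) by (rule act_diff)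
    ultimately have "3 \<le> act (g s) z" using g[OF s(1)] s(2) z(2) by linarith
    also have "\<dots> = 6 / norm x * act (g s) x" unfolding z_def using zs(3) by (rule act_scaleR)
    finally have "norm x / 2 \<le> act (g s) x" using False by (simp add: field_simps)
    then show ?thesis using s(1) by blast
  qed
  moreover have "card (g ` S) \<le> 6 ^ (dim F * (1 + dim F))"
    using card_image_le[OF S(1), of g] S(3) by linarith
  ultimately show ?thesis using S(1) ne g by (intro exI[of _ "g ` S"]) blast
qed

section \<open>One weight dominating the whole family\<close>

text \<open>The growth condition at \<open>j = 2\<close>, with \<open>m 2 \<ge> 2\<close> and
  \<open>n 1 \<ge> 1\<close>, even gives \<open>n 2 > (3 * 1 + 1) * 2 = 8\<close>.\<close>

lemma schreier_3_subset: "schreier 3 \<subseteq> schreier (n (2 * 1))"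
proof -
  have "m 1 \<le> m 2" using m_mono by (simp add: monoD)
  then have "1 \<le> log 2 (real (m 2))" using m_1 by simp
  moreover have "1 \<le> n 1" by (rule n_ge_1)
  ultimately have "4 * 2 \<le> (3 * log 2 (real (m 2)) + 1) * (real (n (2 - 1)) + 1)"
    by (intro mult_mono) auto
  then have "3 \<le> n 2" using n_growth[of 2] by simp
  then show ?thesis by (intro schreier_mono) auto
qed

text \<open>
  The weight \<open>w\<close> is the pointwise maximum of the weights of the functionals in \<open>S\<close>. The coordinates
  are divided according to where the maximum is attained; double exponentially many pieces beyond
  \<open>q\<close> are still \<open>\<S>\<^sub>3\<close>-allowable, so the averaging rule of weight \<open>m 2\<close> combines them.
\<close>

lemma maximal_weight:
  assumes "finite S" "S \<noteq> {}" "\<And>f. f \<in> S \<Longrightarrow> D f" "2 \<le> q" "card S \<le> 2 ^ 2 ^ q"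
  obtains J w where "finite J"
    and "\<And>x. x \<in> X \<Longrightarrow> L2_set (\<lambda>k. w k * coord x k) J \<le> real (m 2) * norm x"
    and "\<And>f x. f \<in> S \<Longrightarrow> x \<in> X \<Longrightarrow> (\<And>k. k < q \<Longrightarrow> coord x k = 0) \<Longrightarrow>
       act f x \<le> L2_set (\<lambda>k. w k * coord x k) J"
proof -
  let ?K = Poly_Mapping.keys
  obtain W where W: "\<And>f. f \<in> S \<Longrightarrow> diagonal_family D f (W f)"
    using D_diagonal[OF assms(3)] by metis
  have W0: "0 \<le> W f k" "k \<notin> ?K f \<Longrightarrow> W f k = 0" if "f \<in> S" for f k
    using W[OF that] unfolding diagonal_family_def by auto
  have "\<exists>f\<in>S. \<forall>g\<in>S. W g k \<le> W f k" for k
  proof -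
    have "Max ((\<lambda>f. W f k) ` S) \<in> (\<lambda>f. W f k) ` S" using assms(1,2) by (intro Max_in) auto
    then obtain f where "f \<in> S" "Max ((\<lambda>f. W f k) ` S) = W f k" by blast
    then show ?thesis using assms(1) by (intro bexI[of _ f]) (auto simp flip: \<open>Max _ = _\<close>)
  qed
  then obtain ch where ch: "\<And>k. ch k \<in> S" "\<And>k f. f \<in> S \<Longrightarrow> W f k \<le> W (ch k) k" by metis
  define w where "w = (\<lambda>k. W (ch k) k)"
  define J where "J = (\<Union>f\<in>S. ?K f) \<inter> {q..}"
  have finJ: "finite J" unfolding J_def using assms(1) by auto
  \<comment> \<open>The pieces \<open>B f\<close> partition \<open>J\<close> according to the
    functional chosen at each coordinate; on \<open>B f\<close> the maximal weight is that of
    \<open>f\<close>.\<close>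
  define B where "B = (\<lambda>f. {k \<in> J. ch k = f})"
  have BJ: "B f \<subseteq> J" "finite (B f)" for f using finJ unfolding B_def by auto
  have upper: "L2_set (\<lambda>k. w k * coord x k) J \<le> real (m 2) * norm x" if x: "x \<in> X" for x
  proof (cases "L2_set (\<lambda>k. w k * coord x k) J = 0")
    case False
    define L where "L = L2_set (\<lambda>k. w k * coord x k) J"
    define l where "l = (\<lambda>f. L2_set (\<lambda>k. w k * coord x k) (B f))"
    \<comment> \<open>Pieces on which \<open>x\<close> has weighted length 0 are dropped: they
      cannot be normalised, and allowability demands nonempty supports.\<close>
    define I where "I = {f \<in> S. l f \<noteq> 0}"
    have Lpos: "0 < L" using False unfolding L_def by (metis L2_set_nonneg less_le)
    have l2: "(l f)\<^sup>2 = (\<Sum>k\<in>B f. (w k * coord x k)\<^sup>2)" for f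
      unfolding l_def L2_set_def by (simp add: sum_nonneg)
    have finI: "finite I" and IS: "I \<subseteq> S" unfolding I_def using assms(1) by auto
    have "L\<^sup>2 = (\<Sum>k\<in>J. (w k * coord x k)\<^sup>2)" unfolding L_def L2_set_def by (simp add: sum_nonneg)
    also have "\<dots> = (\<Sum>f\<in>S. \<Sum>k\<in>B f. (w k * coord x k)\<^sup>2)"
      unfolding B_def using finJ assms(1) ch(1) by (intro sum.group[symmetric]) auto
    also have "\<dots> = (\<Sum>f\<in>I. (l f)\<^sup>2)"
      unfolding l2[symmetric] I_def using assms(1) by (intro sum.mono_neutral_right) auto
    finally have L2: "L\<^sup>2 = (\<Sum>f\<in>I. (l f)\<^sup>2)" .
    have "\<exists>g. D g \<and> ?K g \<subseteq> B f \<and> act g x = l f" if f: "f \<in> I" for f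
    proof -
      have fS: "f \<in> S" and l0: "l f \<noteq> 0" using f unfolding I_def by auto
      \<comment> \<open>The Cauchy-Schwarz extremal on the piece: the resulting functional lives on
        \<open>B f\<close> and takes the value \<open>l f\<close> at \<open>x\<close>.\<close>
      define c where "c = (\<lambda>k. if k \<in> B f then w k * coord x k / l f else 0)"
      have wB: "w k = W f k" if "k \<in> B f" for k using that unfolding w_def B_def by auto
      have "(\<Sum>k\<in>?K f. (c k)\<^sup>2) = (\<Sum>k\<in>?K f \<inter> B f. (w k * coord x k / l f)\<^sup>2)"
        unfolding c_def by (intro sum.mono_neutral_cong_right) auto
      also have "\<dots> = (\<Sum>k\<in>B f. (w k * coord x k / l f)\<^sup>2)"
        using BJ W0(2)[OF fS] wB by (intro sum.mono_neutral_left) auto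
      also have "\<dots> = 1"
        unfolding power_divide sum_divide_distrib[symmetric] l2[symmetric] using l0 by simp
      finally obtain g where g: "D g" "\<And>k. Poly_Mapping.lookup g k = c k * W f k"
        using W[OF fS] unfolding diagonal_family_def by blast
      have gB: "?K g \<subseteq> B f" by (auto simp: in_keys_iff g(2) c_def split: if_splits)
      then have "act g x = (\<Sum>k\<in>B f. Poly_Mapping.lookup g k * coord x k)"
        using BJ by (intro act_superset) auto
      also have "\<dots> = (\<Sum>k\<in>B f. (w k * coord x k)\<^sup>2 / l f)"
        by (intro sum.cong refl) (simp add: g(2) c_def wB power2_eq_square)
      also have "\<dots> = l f"
        unfolding sum_divide_distrib[symmetric] l2[symmetric] using l0 by (simp add: power2_eq_square)
      finally show ?thesis using g(1) gB by blast
    qed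
    then obtain g where g: "\<And>f. f \<in> I \<Longrightarrow> D (g f)" "\<And>f. f \<in> I \<Longrightarrow> ?K (g f) \<subseteq> B f"
      "\<And>f. f \<in> I \<Longrightarrow> act (g f) x = l f" by metis
    have gne: "?K (g f) \<noteq> {}" if "f \<in> I" for f
      using g(3)[OF that] that unfolding act_def I_def by auto
    \<comment> \<open>The coefficients \<open>l f / L\<close> are extremal again, so
      \<open>act h x = L / m 2\<close>. Each \<open>g f\<close> lives on its piece beyond
      \<open>q\<close>, and there are at most \<open>card S\<close> of them, so allowability follows
      from the double exponential bound.\<close>
    define h where "h = (1 / real (m (2 * 1))) *\<^sub>R (\<Sum>f\<in>I. (l f / L) *\<^sub>R g f)"
    have "D h" unfolding h_def
    proof (rule D_even_set[OF finI g(1) gne])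
      show "disjoint_family_on (\<lambda>f. ?K (g f)) I"
        using g(2) unfolding disjoint_family_on_def B_def by blast
      show "(\<Sum>f\<in>I. (l f / L)\<^sup>2) \<le> 1"
        unfolding power_divide sum_divide_distrib[symmetric] L2[symmetric] using Lpos by simp
      have "card ((\<lambda>f. Min (?K (g f))) ` I) \<le> card S"
        using card_image_le[OF finI] card_mono[OF assms(1) IS] order_trans by blast
      then have "card ((\<lambda>f. Min (?K (g f))) ` I) \<le> 2 ^ 2 ^ q" using assms(5) by linarith
      moreover have "q \<le> Min (?K (g f))" if "f \<in> I" for f
      proof -
        have "Min (?K (g f)) \<in> ?K (g f)" using gne[OF that] by simp
        then show ?thesis using g(2)[OF that] unfolding B_def J_def by auto
      qed
      ultimately have "(\<lambda>f. Min (?K (g f))) ` I \<in> schreier 3"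
        using finI assms(4) by (intro schreier_3_double_exponential[of q]) auto
      then show "(\<lambda>f. Min (?K (g f))) ` I \<in> schreier (n (2 * 1))" using schreier_3_subset by blast
    qed
    have "act h x = 1 / real (m 2) * (\<Sum>f\<in>I. l f / L * l f)"
      unfolding h_def act_combination[OF finI] using g(3) by simp
    also have "(\<Sum>f\<in>I. l f / L * l f) = L\<^sup>2 / L"
      unfolding L2 by (simp add: sum_divide_distrib power2_eq_square)
    also have "\<dots> = L" using Lpos by (simp add: power2_eq_square)
    finally have "L / real (m 2) \<le> norm x" using act_le_norm[OF \<open>D h\<close> x] by simp
    then show ?thesis using m_ge_1[of 2] unfolding L_def by (simp add: field_simps)
  qed simp
  have lower: "act f x \<le> L2_set (\<lambda>k. w k * coord x k) J"
    if f: "f \<in> S" and x: "x \<in> X" and x0: "\<And>k. k < q \<Longrightarrow> coord x k = 0" for f x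
  proof -
    have "act f x \<le> L2_set (\<lambda>k. W f k * coord x k) (?K f)" using W[OF f] by (rule act_le_L2)
    \<comment> \<open>Cutting at \<open>q\<close> is harmless here because the coordinates of
      \<open>x\<close> below \<open>q\<close> vanish.\<close>
    also have "\<dots> = L2_set (\<lambda>k. W f k * coord x k) (?K f \<inter> {q..})"
      unfolding L2_set_def
    proof (intro arg_cong[of _ _ sqrt] sum.mono_neutral_right ballI)
      fix k assume "k \<in> ?K f - ?K f \<inter> {q..}"
      then have "k < q" by auto
      then show "(W f k * coord x k)\<^sup>2 = 0" using x0 by simp
    qed auto
    also have "\<dots> \<le> L2_set (\<lambda>k. w k * coord x k) (?K f \<inter> {q..})"
      unfolding L2_set_def
    proof (intro real_sqrt_le_mono sum_mono)
      fix k
      have "(W f k)\<^sup>2 \<le> (w k)\<^sup>2" unfolding w_def using W0(1)[OF f] ch(2)[OF f] by (intro power_mono) auto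
      then show "(W f k * coord x k)\<^sup>2 \<le> (w k * coord x k)\<^sup>2"
        unfolding power_mult_distrib by (intro mult_right_mono) auto
    qed
    also have "\<dots> \<le> L2_set (\<lambda>k. w k * coord x k) J"
      unfolding L2_set_def J_def using f assms(1) by (intro real_sqrt_le_mono sum_mono2) auto
    finally show ?thesis .
  qed
  show thesis using that[OF finJ upper lower] .
qed

section \<open>Dimension counts and the choice of the subspaces\<close>

text \<open>Each vanishing condition costs at most one dimension. Coordinate 0 is always 0, so the
  \<open>Suc p\<close> conditions \<open>i < Suc p\<close> cost only \<open>p\<close>.\<close>

lemma dim_tail_subspace:
  assumes "subspace E" "finite_dimensional E" "E \<subseteq> X"
  shows "subspace {x \<in> E. \<forall>i<q. coord x i = 0}"
    and "dim E \<le> dim {x \<in> E. \<forall>i<Suc p. coord x i = 0} + p"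
proof -
  have lin: "linear_on E (\<lambda>x. coord x i)" for i
    unfolding linear_on_def using assms(3) by (auto simp: coord_add coord_scaleR subset_iff)
  have sub: "subspace {x \<in> E. \<forall>i<q. coord x i = 0}" for q
  proof (induction q)
    case (Suc q)
    have "{x \<in> E. \<forall>i<Suc q. coord x i = 0} = {x \<in> {x \<in> E. \<forall>i<q. coord x i = 0}. coord x q = 0}"
      by (auto simp: less_Suc_eq)
    then show ?case using kernel_subspace[OF Suc linear_on_subset[OF lin]] by auto
  qed (simp add: assms(1))
  then show "subspace {x \<in> E. \<forall>i<q. coord x i = 0}" .
  show "dim E \<le> dim {x \<in> E. \<forall>i<Suc p. coord x i = 0} + p"
  proof (induction p)
    case 0
    have "{x \<in> E. \<forall>i<Suc 0. coord x i = 0} = E" using coord_0 assms(3) by auto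
    then show ?case by simp
  next
    case (Suc p)
    let ?F = "{x \<in> E. \<forall>i<Suc p. coord x i = 0}"
    have eq: "{x \<in> E. \<forall>i<Suc (Suc p). coord x i = 0} = {x \<in> ?F. coord x (Suc p) = 0}"
      by (auto simp: less_Suc_eq)
    have "dim ?F \<le> Suc (dim {x \<in> ?F. coord x (Suc p) = 0})"
    proof (cases "\<exists>v\<in>?F. coord v (Suc p) \<noteq> 0")
      case True
      then obtain v where v: "v \<in> ?F" "coord v (Suc p) \<noteq> 0" by blast
      have "finite_dimensional ?F" by (rule finite_dimensional_subset[OF assms(2)]) blast
      moreover have "linear_on ?F (\<lambda>x. coord x (Suc p))" by (rule linear_on_subset[OF lin]) blast
      ultimately show ?thesis using dim_kernel[where \<phi> = "\<lambda>x. coord x (Suc p)", OF sub[of "Suc p"] _ _ v] by simp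
    next
      case False
      then have "{x \<in> ?F. coord x (Suc p) = 0} = ?F" by blast
      then show ?thesis by simp
    qed
    then show ?case using Suc unfolding eq by linarith
  qed
qed

text \<open>The coordinate functionals separate the unit vectors, so \<open>card A + 1\<close> of
  them are independent, too many for the span of \<open>A\<close>.\<close>

lemma infinite_dimensional: "\<not> finite_dimensional X"
proof
  assume "finite_dimensional X"
  then obtain A where A: "finite A" "X \<subseteq> span A" unfolding finite_dimensional_def by blast
  let ?e = "\<lambda>i. \<iota> (unit_vec i)"
  let ?I = "{1..Suc (card A)}"
  have coord_e: "coord (?e i) k = (if k = i then 1 else 0)" if "i \<in> ?I" for i k
    using coord_partial_sum(1)[of "{i}" "\<lambda>_. 1" k] that by simp
  have eX: "?e i \<in> X" if "i \<in> ?I" for i using that by (intro \<iota>_in_X c00_closed) auto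
  have inj: "inj_on ?e ?I"
  proof (rule inj_onI)
    fix i j assume "i \<in> ?I" "j \<in> ?I" "?e i = ?e j"
    then show "i = j" using coord_e[of i i] coord_e[of j i] by (simp split: if_splits)
  qed
  have "independent (?e ` ?I)"
    unfolding real_vector.independent_explicit_finite_subsets
  proof (intro allI impI ballI)
    fix T u t assume T: "T \<subseteq> ?e ` ?I" "finite T" "(\<Sum>v\<in>T. u v *\<^sub>R v) = 0" "t \<in> T"
    then obtain j where j: "j \<in> ?I" "t = ?e j" by blast
    have "coord (\<Sum>v\<in>T. u v *\<^sub>R v) j = (\<Sum>v\<in>T. u v * coord v j)"
      using T(1) eX by (intro coord_sum(2)) auto
    also have "\<dots> = u t * coord t j"
    proof (rule sum_single_term[OF T(2,4)])
      fix v assume v: "v \<in> T" "v \<noteq> t"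
      then obtain i where i: "i \<in> ?I" "v = ?e i" using T(1) by blast
      then have "j \<noteq> i" using v(2) j(2) by blast
      then show "u v * coord v j = 0" using coord_e[OF i(1)] i(2) by simp
    qed
    finally show "u t = 0" using T(3) j coord_e[of j j] by (simp add: coord_zero)
  qed
  then have "card (?e ` ?I) \<le> card A"
    using real_vector.independent_span_bound[OF A(1)] A(2) eX by blast
  then show False using inj by (simp add: card_image)
qed

text \<open>Since \<open>6 \<le> 2 ^ 3\<close>, it is enough that
  \<open>3 * k * (k + 1) \<le> 12 * q * (q + 1) \<le> 2 ^ q\<close>; the induction for the last
  inequality starts at \<open>q = 12\<close>, where it reads \<open>1872 \<le> 4096\<close>.\<close>

lemma six_power_le:
  assumes "12 \<le> q" "k \<le> 2 * q"
  shows "(6::nat) ^ (k * (1 + k)) \<le> 2 ^ 2 ^ q"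
proof -
  have *: "12 * q * (q + 1) \<le> 2 ^ q" if "12 \<le> q" for q :: nat
    using that
  proof (induction q rule: dec_induct)
    case (step q)
    have "12 * Suc q * (Suc q + 1) \<le> 2 * (12 * q * (q + 1))"
    proof -
      have "Suc q + 1 \<le> 2 * q" using step by simp
      then have "12 * Suc q * (Suc q + 1) \<le> 12 * Suc q * (2 * q)" by (rule mult_le_mono2)
      then show ?thesis by (simp add: algebra_simps)
    qed
    then show ?case using step by simp
  qed simp
  have "(6::nat) ^ (k * (1 + k)) \<le> 8 ^ (k * (1 + k))" by (intro power_mono) auto
  also have "\<dots> = (2 ^ 3) ^ (k * (1 + k))" by simp
  also have "\<dots> = 2 ^ (3 * (k * (1 + k)))" by (simp only: power_mult)
  also have "3 * (k * (1 + k)) \<le> 3 * (2 * q * (1 + 2 * q))"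
    using assms(2) by (intro mult_le_mono le_refl add_le_mono)
  also have "\<dots> \<le> 12 * q * (q + 1)" by (simp add: algebra_simps)
  also have "\<dots> \<le> 2 ^ q" using * assms(1) by blast
  finally show ?thesis by (simp add: power_increasing)
qed

text \<open>With \<open>p = dim E div 2\<close> the tail keeps at least half of the dimension, and
  \<open>dim ?F \<le> dim E \<le> 2 * Suc p\<close> lets the double exponential absorb the norming
  family. The bound 22 is what makes \<open>Suc p \<ge> 12\<close>. The constant is
  \<open>\<beta> / \<alpha>\<close> with \<open>\<beta> = m 2\<close> and
  \<open>\<alpha> = 1 / 2\<close>.\<close>

lemma large_hilbertian_subspace:
  assumes E: "subspace E" "finite_dimensional E" "E \<subseteq> X" and dimE: "22 \<le> dim E"
  obtains F where "subspace F" "F \<subseteq> E" "dim E \<le> 2 * dim F"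
    "banach_mazur F norm (l2_space (dim F)) l2_norm \<le> ereal (2 * real (m 2))"
    "\<exists>P. projection_onto X F P \<and> opnorm_on X norm norm P \<le> 2 * real (m 2)"
proof -
  define p where "p = dim E div 2"
  let ?q = "Suc p"
  let ?F = "{x \<in> E. \<forall>i<?q. coord x i = 0}"
  have F: "subspace ?F" by (rule dim_tail_subspace[OF E])
  have FE: "?F \<subseteq> E" by blast
  then have FX: "?F \<subseteq> X" using E(3) by blast
  have Ffd: "finite_dimensional ?F" by (rule finite_dimensional_subset[OF E(2)]) blast
  have dF: "dim E \<le> dim ?F + p" by (rule dim_tail_subspace[OF E])
  have dFE: "dim ?F \<le> dim E"
  proof -
    obtain B where B: "finite B" "span B = E" "card B = dim E"
      using finite_dimensional_basis[OF E(2,1)] by blast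
    show ?thesis using real_vector.dim_le_card[of ?F B] B FE by auto
  qed
  obtain S where S: "finite S" "S \<noteq> {}" "\<And>f. f \<in> S \<Longrightarrow> D f" "card S \<le> 6 ^ (dim ?F * (1 + dim ?F))"
     "\<And>x. x \<in> ?F \<Longrightarrow> \<exists>f\<in>S. norm x / 2 \<le> act f x"
    using norming_family[OF F Ffd FX] by blast
  have "dim E \<le> 2 * ?q" and p2: "2 * p \<le> dim E" unfolding p_def by simp_all
  then have "dim ?F \<le> 2 * ?q" using dFE by linarith
  moreover have "12 \<le> ?q" using dimE unfolding p_def by linarith
  ultimately have "card S \<le> 2 ^ 2 ^ ?q" using six_power_le[of ?q "dim ?F"] S(4) by linarith
  then obtain J w where J: "finite J"
    and up: "\<And>x. x \<in> X \<Longrightarrow> L2_set (\<lambda>k. w k * coord x k) J \<le> real (m 2) * norm x"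
    and lo: "\<And>f x. f \<in> S \<Longrightarrow> x \<in> X \<Longrightarrow> (\<And>k. k < ?q \<Longrightarrow> coord x k = 0) \<Longrightarrow>
       act f x \<le> L2_set (\<lambda>k. w k * coord x k) J"
    using maximal_weight[OF S(1-3), of ?q] \<open>12 \<le> ?q\<close> by auto
  \<comment> \<open>This form sees only the finitely many coordinates in \<open>J\<close>, so it is
    degenerate on \<open>X\<close>; the lower bound below makes it definite on the tail.\<close>
  define ip where "ip = (\<lambda>x y. \<Sum>k\<in>J. (w k * coord x k) * (w k * coord y k))"
  have ip: "sqrt (ip x x) = L2_set (\<lambda>k. w k * coord x k) J" for x
    unfolding ip_def L2_set_def by (simp add: power2_eq_square)
  have "linear_on X (\<lambda>x. ip x y)" for y
    unfolding linear_on_def ip_def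
    by (simp add: coord_add coord_scaleR algebra_simps sum.distrib sum_distrib_left)
  moreover have "ip x y = ip y x" for x y unfolding ip_def by (simp add: mult.commute)
  moreover have "0 \<le> ip x x" for x unfolding ip_def by (intro sum_nonneg) simp
  moreover have "1 / 2 * norm x \<le> sqrt (ip x x)" if x: "x \<in> ?F" for x
  proof -
    obtain f where f: "f \<in> S" "norm x / 2 \<le> act f x" using S(5)[OF x] by blast
    moreover have "act f x \<le> sqrt (ip x x)" unfolding ip using f(1) x FX by (intro lo) auto
    ultimately show ?thesis by simp
  qed
  moreover have "sqrt (ip x x) \<le> real (m 2) * norm x" if "x \<in> X" for x
    unfolding ip using that by (rule up)
  ultimately have "banach_mazur ?F norm (l2_space (dim ?F)) l2_norm \<le> ereal (real (m 2) / (1 / 2))"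
    "\<exists>P. projection_onto X ?F P \<and> opnorm_on X norm norm P \<le> real (m 2) / (1 / 2)"
    using hilbertian_complemented[OF X_subspace F Ffd FX, of ip "1 / 2" "real (m 2)"] by auto
  moreover have "dim E \<le> 2 * dim ?F" using dF p2 by linarith
  ultimately show thesis using that[OF F FE] by (simp add: mult.commute)
qed

text \<open>In dimension below 22 a single line is enough: a functional norming its direction up to
  1/2 gives a rank-one form with \<open>\<alpha> = 1 / 2\<close> and \<open>\<beta> = 1\<close>. The
  factor 22 compares \<open>dim E\<close> with dimension 1.\<close>

lemma small_hilbertian_subspace:
  assumes E: "subspace E" "finite_dimensional E" "E \<subseteq> X" and dimE: "dim E < 22"
  obtains F where "subspace F" "F \<subseteq> E" "dim E \<le> 22 * dim F"
    "banach_mazur F norm (l2_space (dim F)) l2_norm \<le> ereal 2"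
    "\<exists>P. projection_onto X F P \<and> opnorm_on X norm norm P \<le> 2"
proof (cases "dim E")
  case 0
  then have E0: "E = {0}" using dim_0_trivial E by blast
  \<comment> \<open>For \<open>E = {0}\<close> the zero form serves, with
    \<open>\<beta> = 0\<close>, as its lower bound on \<open>E\<close> is trivial.\<close>
  have "linear_on X (\<lambda>x. 0 :: real)" unfolding linear_on_def by simp
  then have "banach_mazur E norm (l2_space (dim E)) l2_norm \<le> ereal (0 / 1)"
    "\<exists>P. projection_onto X E P \<and> opnorm_on X norm norm P \<le> 0 / 1"
    using hilbertian_complemented[OF X_subspace E, of "\<lambda>_ _. 0" 1 0] E0 by auto
  moreover have "ereal (0 / 1) \<le> ereal 2" by simp
  ultimately show thesis using that[OF E(1)] 0 by (metis order_refl order_trans div_by_1 zero_le zero_le_numeral)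
next
  case (Suc k)
  then obtain v where v: "v \<in> E" "v \<noteq> 0" using dim_Suc_nontrivial E(1) by metis
  let ?F = "span {v}"
  have FE: "?F \<subseteq> E" using v(1) E(1) by (intro span_minimal) auto
  have vX: "v \<in> X" and FX: "?F \<subseteq> X" using FE v(1) E(3) by auto
  have Ffd: "finite_dimensional ?F" by (rule finite_dimensional_subset[OF E(2) FE])
  have dF: "dim ?F = 1" using real_vector.dim_span_eq_card_independent[of "{v}"] v(2) by simp
  obtain f where f: "D f" "norm v - norm v / 2 < act f v" using act_norming[OF vX, of "norm v / 2"] v(2) by auto
  define ip where "ip = (\<lambda>x y. act f x * act f y)"
  have ip: "sqrt (ip x x) = \<bar>act f x\<bar>" for x unfolding ip_def by simp
  have "linear_on X (\<lambda>x. ip x y)" for y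
    unfolding linear_on_def ip_def by (simp add: act_add act_scaleR algebra_simps)
  moreover have "ip x y = ip y x" for x y unfolding ip_def by (simp add: mult.commute)
  moreover have "0 \<le> ip x x" for x unfolding ip_def by simp
  moreover have "1 / 2 * norm x \<le> sqrt (ip x x)" if x: "x \<in> ?F" for x
  proof -
    obtain c where c: "x = c *\<^sub>R v" using x by (auto simp: span_singleton)
    have "1 / 2 * norm x = \<bar>c\<bar> * (norm v / 2)" unfolding c by simp
    also have "\<dots> \<le> \<bar>c\<bar> * \<bar>act f v\<bar>" using f(2) by (intro mult_left_mono) auto
    also have "\<dots> = sqrt (ip x x)" unfolding ip c act_scaleR[OF vX] by (simp add: abs_mult)
    finally show ?thesis .
  qed
  moreover have "sqrt (ip x x) \<le> 1 * norm x" if "x \<in> X" for x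
    unfolding ip using abs_act_le_norm[OF f(1) that] by simp
  ultimately have "banach_mazur ?F norm (l2_space (dim ?F)) l2_norm \<le> ereal (1 / (1 / 2))"
    "\<exists>P. projection_onto X ?F P \<and> opnorm_on X norm norm P \<le> 1 / (1 / 2)"
    using hilbertian_complemented[OF X_subspace subspace_span Ffd FX, of ip "1 / 2" 1] by auto
  then show thesis using that[OF subspace_span FE] dimE dF by simp
qed

text \<open>The ratio 1/22 comes from the lines used in small dimensions, since large ones keep one
  half; the constant \<open>2 * m 2\<close> comes from the large dimensions and dominates the 2 of
  the lines.\<close>

theorem weak_Hilbert_X: "weak_Hilbert X"
  unfolding weak_Hilbert_def
proof (rule conjI[OF X_subspace conjI[OF X_complete conjI[OF infinite_dimensional]]],
    rule exI[of _ "1 / 22"], rule conjI, simp, rule exI[of _ "2 * real (m 2)"], intro conjI allI impI)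
  show "0 < 2 * real (m 2)" using m_ge_1[of 2] by simp
  fix E assume "subspace E \<and> E \<subseteq> X \<and> finite_dimensional E"
  then have E: "subspace E" "finite_dimensional E" "E \<subseteq> X" by auto
  show "\<exists>F. subspace F \<and> F \<subseteq> E \<and> 1 / 22 * real (dim E) \<le> real (dim F) \<and>
      banach_mazur F norm (l2_space (dim F)) l2_norm \<le> ereal (2 * real (m 2)) \<and>
      (\<exists>P. projection_onto X F P \<and> opnorm_on X norm norm P \<le> 2 * real (m 2))"
  proof (cases "dim E < 22")
    case True
    have m2: "2 \<le> 2 * real (m 2)" using m_ge_1[of 2] by simp
    obtain F where F: "subspace F" "F \<subseteq> E" "dim E \<le> 22 * dim F"
      "banach_mazur F norm (l2_space (dim F)) l2_norm \<le> ereal 2"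
      "\<exists>P. projection_onto X F P \<and> opnorm_on X norm norm P \<le> 2"
      using small_hilbertian_subspace[OF E True] by blast
    have "banach_mazur F norm (l2_space (dim F)) l2_norm \<le> ereal (2 * real (m 2))"
      using F(4) m2 by (rule order_trans[OF _ ereal_less_eq(3)[THEN iffD2]])
    moreover have "\<exists>P. projection_onto X F P \<and> opnorm_on X norm norm P \<le> 2 * real (m 2)"
      using F(5) m2 order_trans by blast
    moreover have "1 / 22 * real (dim E) \<le> real (dim F)" using F(3) by linarith
    ultimately show ?thesis using F(1,2) by blast
  next
    case False
    then have "22 \<le> dim E" by simp
    then obtain F where F: "subspace F" "F \<subseteq> E" "dim E \<le> 2 * dim F"
      "banach_mazur F norm (l2_space (dim F)) l2_norm \<le> ereal (2 * real (m 2))"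
      "\<exists>P. projection_onto X F P \<and> opnorm_on X norm norm P \<le> 2 * real (m 2)"
      using large_hilbertian_subspace[OF E] by blast
    moreover have "1 / 22 * real (dim E) \<le> real (dim F)" using F(3) by linarith
    ultimately show ?thesis by blast
  qed
qed

end

theorem proposition4p10:
  fixes m n :: "nat \<Rightarrow> nat"
    and N1 N2 :: "nat set"
    and \<sigma> :: "(nat set \<times> nat) list \<Rightarrow> nat"
    and X :: "'a::real_normed_vector set"
    and \<iota> :: "(nat \<Rightarrow>\<^sub>0 real) \<Rightarrow> 'a"
  assumes "wh_parameters m n N1 N2 \<sigma>"
    and "is_X_wh m n N1 N2 \<sigma> X \<iota>"
  shows "asymptotic_l2_disjoint X (\<lambda>i. \<iota> (unit_vec i)) \<and> weak_Hilbert X"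
proof -
  interpret wh_space m n N1 N2 \<sigma> X \<iota>
    using assms by (intro wh_space.intro wh_space_axioms.intro)
  show ?thesis using asymptotic_l2 weak_Hilbert_X by blast
qed

end
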